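(* For any measurable functions $f,g:\mathbb{R}^n\to[0,1]$ and any $-1<\rho<1$ with $\rho\ne0$, if $$\mathbb{E}_\rho\, J(f(X),g(Y);\rho)=J(\mathbb{E} f,\mathbb{E} g;\rho),$$ then there exist $a,b,d\in\mathbb{R}^n$ such that either $$f(x)=\Phi(\langle a,x-b\rangle)\ \text{ a.s.}\quad\text{and}\quad g(x)=\Phi(\langle a,x-d\rangle)\ \text{ a.s.},$$ or $$f(x)=1_{\{\langle a,x-b\rangle\ge0\}}\ \text{ a.s.}\quad\text{and}\quad g(x)=1_{\{\langle a,x-d\rangle\ge0\}}\ \text{ a.s.}$$
   Context: $\gamma_n$ is the standard Gaussian measure on $\mathbb{R}^n$; "a.s." refers to $\gamma_n$. For $-1<\rho<1$, $\mathbb{E}_\rho$ is expectation for a pair $(X,Y)$ of jointly Gaussian vectors in $\mathbb{R}^n$, each standard Gaussian, with $\mathbb{E} X_iY_j=\delta_{ij}\rho$ ($\delta_{ij}$ the Kronecker delta); $\Pr_\rho$ is the corresponding probability. $\mathbb{E} f=\int f\,d\gamma_n$. $\Phi$ is the standard normal distribution function on $\mathbb{R}$, with $\Phi^{-1}(0)=-\infty$, $\Phi^{-1}(1)=+\infty$. For $x,y\in[0,1]$, $J(x,y;\rho)=\Pr_\rho(X_1\le\Phi^{-1}(x),\,Y_1\le\Phi^{-1}(y))$. $\langle\cdot,\cdot\rangle$ is the Euclidean inner product.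
   Formalization: Added assumptions: neither f nor g is a.s. 0 or a.s. 1, and f, g are not both a.s. constant. Without them the claim fails, e.g. f = g = 0 gives equality but neither form holds; of the excluded equality cases it holds only for the constant pairs (1/2,1/2) and (1,1). *)

theory Defs
  imports "HOL-Probability.Probability"
begin

definition std_gauss :: "'a::euclidean_space measure" where
  "std_gauss = density lborel (\<lambda>x. ennreal (\<Prod>b\<in>Basis. std_normal_density (x \<bullet> b)))"

text \<open>
  The law of the pair \<open>(X, Y)\<close>.  If \<open>X\<close> and \<open>Z\<close> are independent standard Gaussian vectors and
  \<open>Y = \<rho> X + sqrt (1 - \<rho>\<^sup>2) Z\<close>, then \<open>(X, Y)\<close> is jointly Gaussian (a linear image of a standard
  Gaussian vector), \<open>Y\<close> is standard Gaussian, and the \<open>i\<close>-th coordinate of \<open>X\<close> and the \<open>j\<close>-th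
  coordinate of \<open>Y\<close> have covariance \<open>\<rho>\<close> if \<open>i = j\<close> and \<open>0\<close> otherwise.  A centred Gaussian law is
  determined by its covariance, so this is the only such law.
\<close>

definition gauss_pair :: "real \<Rightarrow> ('a::euclidean_space \<times> 'a) measure" where
  "gauss_pair \<rho> = distr (std_gauss \<Otimes>\<^sub>M std_gauss) borel
     (\<lambda>(x, z). (x, \<rho> *\<^sub>R x + sqrt (1 - \<rho>\<^sup>2) *\<^sub>R z))"

definition Phi :: "real \<Rightarrow> real" where
  "Phi = cdf std_normal_distribution"

definition Phi_inv :: "real \<Rightarrow> ereal" where
  "Phi_inv x = (if x \<le> 0 then -\<infinity> else if x \<ge> 1 then \<infinity> else ereal (THE t. Phi t = x))"

text \<open>
  Only the first coordinates of \<open>X\<close> and \<open>Y\<close> enter \<open>J\<close>; their joint law is \<^term>\<open>gauss_pair \<rho>\<close>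
  in dimension one.
\<close>

definition J :: "real \<Rightarrow> real \<Rightarrow> real \<Rightarrow> real" where
  "J x y \<rho> = measure (gauss_pair \<rho> :: (real \<times> real) measure)
     {(u, v). ereal u \<le> Phi_inv x \<and> ereal v \<le> Phi_inv y}"

lemma space_std_gauss [simp]: "space std_gauss = UNIV"
  by (simp add: std_gauss_def)

lemma sets_std_gauss [simp, measurable_cong]: "sets std_gauss = sets borel"
  by (simp add: std_gauss_def)

lemma prob_space_std_gauss: "prob_space (std_gauss :: 'a::euclidean_space measure)"
proof
  interpret N: prob_space std_normal_distribution
    by (rule prob_space_normal_density) simp
  have 1: "(\<integral>\<^sup>+t. ennreal (std_normal_density t) \<partial>lborel) = 1"
    using N.emeasure_space_1 by (simp add: emeasure_density)
  have "emeasure std_gauss (space (std_gauss :: 'a measure)) =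
      (\<integral>\<^sup>+x. (\<Prod>b\<in>Basis. ennreal (std_normal_density (x \<bullet> b))) \<partial>(lborel :: 'a measure))"
    by (simp add: std_gauss_def emeasure_density prod_ennreal)
  also have "\<dots> = (\<Prod>b\<in>(Basis :: 'a set). \<integral>\<^sup>+t. ennreal (std_normal_density t) \<partial>lborel)"
    by (rule nn_integral_lborel_prod) auto
  finally show "emeasure std_gauss (space (std_gauss :: 'a measure)) = 1"
    by (simp add: 1)
qed

lemma sets_gauss_pair [simp, measurable_cong]: "sets (gauss_pair \<rho>) = sets borel"
  by (simp add: gauss_pair_def)

lemma prob_space_gauss_pair:
  "prob_space (gauss_pair \<rho> :: ('a::euclidean_space \<times> 'a) measure)"
proof -
  interpret G: prob_space "std_gauss :: 'a measure" by (rule prob_space_std_gauss)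
  interpret P: pair_prob_space "std_gauss :: 'a measure" "std_gauss :: 'a measure" ..
  show ?thesis
    unfolding gauss_pair_def by (rule P.prob_space_distr) (simp add: borel_prod[symmetric])
qed

end

theory Submission
  imports Defs
begin

text \<open>
  Write \<open>deficit f g\<close> for \<open>J (E f) (E g) - E J (f X) (g Y)\<close>, multiplied by the sign of \<open>\<rho>\<close>.
  Splitting \<open>X = c X\<^sub>1 + s X\<^sub>2\<close> with \<open>c\<^sup>2 + s\<^sup>2 = 1\<close>, and \<open>Y\<close> likewise, writes the deficit of \<open>(f, g)\<close> as that of
  the averaged pair plus the mean deficit of the pairs \<open>f (c x + s \<cdot>)\<close>, \<open>g (c y + s \<cdot>)\<close>. At a small scale \<open>h\<close> the
  deficit of smooth functions is, up to \<open>o(h\<^sup>2)\<close>, a positive multiple of \<open>h\<^sup>2\<close> times the square of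
  the difference of the gradients of \<open>\<Phi>\<^sup>-\<^sup>1 \<circ> f\<close> at \<open>x\<close> and \<open>\<Phi>\<^sup>-\<^sup>1 \<circ> g\<close> at \<open>y\<close>: hence, halving the variance
  repeatedly, deficits are nonnegative.

  If the deficit vanishes, then so does the deficit of the Ornstein--Uhlenbeck smoothings of \<open>f\<close> and \<open>g\<close>
  at every point and scale. So the gradients of \<open>\<Phi>\<^sup>-\<^sup>1 \<circ> f\<close> and \<open>\<Phi>\<^sup>-\<^sup>1 \<circ> g\<close> for the smoothed
  functions are one and the same constant, and the smoothings are \<open>\<Phi> (a \<bullet> x + b)\<close> and \<open>\<Phi> (a \<bullet> x + d)\<close>.
  Almost everywhere limits of such functions, as the smoothing is removed, are again of this form or half-spaces.
\<close>

section \<open>Gaussian measures\<close>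

text \<open>Two obstacles shape the argument: the second derivatives of \<open>J\<close> blow up at
  the edges of the unit square, and f, g are only measurable. For the inequality both are removed by
  perturbation: \<open>ou\<close> gives a second-order Taylor bound,
  \<open>(1 - 2 * e) * f + e\<close> keeps the values inside [e, 1-e], and the deficit is Lipschitz
  in L1, so its sign survives the limit. Halving k times produces 2^k pieces at scale h = 2^(-k/2).
  An error of size \<eta> h^2 + C h^3 per piece is just small enough to be summed, provided \<eta>
  and C are common to all pieces; hence the insistence on uniform constants. The quadratic form of
  the expansion has to degenerate: its kernel consists of the pairs of gradients of \<Phi>(a.x + b)
  and \<Phi>(a.y + d) with a common a, and such pairs have zero deficit.\<close>

lemma std_gauss_density_eq:
  fixes x :: "'a::euclidean_space"
  shows "(\<Prod>b\<in>Basis. std_normal_density (x \<bullet> b)) =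
    (1 / sqrt (2 * pi)) ^ DIM('a) * exp (- (x \<bullet> x) / 2)"
proof -
  have "(\<Prod>b\<in>Basis. std_normal_density (x \<bullet> b)) =
     (1 / sqrt (2 * pi)) ^ DIM('a) * exp (\<Sum>b\<in>Basis. - (x \<bullet> b)\<^sup>2 / 2)"
    by (simp only: std_normal_density_def prod.distrib prod_constant exp_sum[OF finite_Basis])
  also have "(\<Sum>b\<in>Basis. - (x \<bullet> b)\<^sup>2 / 2) = - (x \<bullet> x) / 2"
    by (subst euclidean_inner[of x x])
       (simp add: sum_negf sum_divide_distrib[symmetric] power2_eq_square)
  finally show ?thesis .
qed

lemma std_gauss_eq:
  "(std_gauss :: 'a::euclidean_space measure) =
    density lborel (\<lambda>x. ennreal ((1 / sqrt (2 * pi)) ^ DIM('a) * exp (- (x \<bullet> x) / 2)))"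
  by (simp add: std_gauss_def std_gauss_density_eq)

section \<open>Product Gaussians, the Mehler kernel, and mixing of independent copies\<close>

interpretation std_gauss: prob_space "std_gauss :: 'a::euclidean_space measure"
  by (rule prob_space_std_gauss)

interpretation std_gauss_pair: pair_prob_space
  "std_gauss :: 'a::euclidean_space measure" "std_gauss :: 'b::euclidean_space measure" ..

interpretation gauss_pair: prob_space "gauss_pair \<rho> :: ('a::euclidean_space \<times> 'a) measure"
  by (rule prob_space_gauss_pair)

interpretation gauss_pair_pair: pair_prob_space
  "gauss_pair \<rho> :: ('a::euclidean_space \<times> 'a) measure"
  "gauss_pair \<rho>' :: ('b::euclidean_space \<times> 'b) measure" ..

lemma space_gauss_pair [simp]: "space (gauss_pair \<rho>) = UNIV"
  by (simp add: gauss_pair_def)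

lemma emeasure_UNIV_gauss [simp]:
  "emeasure (std_gauss :: 'a::euclidean_space measure) UNIV = 1"
  "measure (std_gauss :: 'a::euclidean_space measure) UNIV = 1"
  "emeasure (gauss_pair \<rho> :: ('a \<times> 'a) measure) UNIV = 1"
  "measure (gauss_pair \<rho> :: ('a \<times> 'a) measure) UNIV = 1"
  using std_gauss.emeasure_space_1[where 'a='a] gauss_pair.emeasure_space_1[of \<rho>, where 'a='a]
  by (simp_all add: measure_def)

text \<open>The exponent is the inner product, which is additive over the factors of a product
  space. Thus the correlated pair becomes a linear image of a single standard Gaussian, and facts
  about \<open>std_gauss\<close> in any dimension apply to it.\<close>

lemma std_gauss_pair_measure:
  "(std_gauss \<Otimes>\<^sub>M std_gauss :: ('a::euclidean_space \<times> 'b::euclidean_space) measure) = std_gauss"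
proof -
  have "(std_gauss \<Otimes>\<^sub>M std_gauss :: ('a \<times> 'b) measure) = density (lborel \<Otimes>\<^sub>M lborel)
     (\<lambda>(x,y). ennreal ((1 / sqrt (2 * pi)) ^ DIM('a) * exp (- (x \<bullet> x) / 2)) *
        ennreal ((1 / sqrt (2 * pi)) ^ DIM('b) * exp (- (y \<bullet> y) / 2)))"
    unfolding std_gauss_eq
    by (rule pair_measure_density)
       (use std_gauss.sigma_finite_measure_axioms in \<open>auto simp: std_gauss_eq sigma_finite_lborel\<close>)
  also have "\<dots> = std_gauss"
    unfolding std_gauss_eq lborel_prod
    by (intro density_cong)
       (auto simp: ennreal_mult[symmetric] power_add exp_add[symmetric] inner_prod_def field_simps
          borel_prod[symmetric] intro!: AE_I2)
  finally show ?thesis .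
qed

text \<open>The Lebesgue density at w of c x + s Z with Z standard Gaussian. The absolute value of s
  admits s = -1, which yields the reflection symmetry.\<close>

definition mehler :: "real \<Rightarrow> real \<Rightarrow> 'a::euclidean_space \<Rightarrow> 'a \<Rightarrow> real" where
  "mehler c s x w = (1 / sqrt (2 * pi)) ^ DIM('a) / \<bar>s\<bar> ^ DIM('a) *
     exp (- ((w - c *\<^sub>R x) \<bullet> (w - c *\<^sub>R x)) / (2 * s\<^sup>2))"

lemma mehler_nonneg: "mehler c s x w \<ge> 0"
  by (simp add: mehler_def)

lemma mehler_measurable [measurable]:
  "(\<lambda>(x, w). mehler c s x w) \<in> borel_measurable (borel \<Otimes>\<^sub>M borel)"
  "mehler c s x \<in> borel_measurable borel"
  unfolding mehler_def by measurable

text \<open>The substitution w = c x + s z. Its instances with (c, s) = (1, 1), (0, -1) and (0, sqrt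
  2) give the shift formula, the symmetry and the integrability of exp (z.z / 4).\<close>

lemma nn_integral_std_gauss_affine:
  fixes F :: "'a::euclidean_space \<Rightarrow> ennreal"
  assumes [measurable]: "F \<in> borel_measurable borel" and s: "s \<noteq> 0"
  shows "(\<integral>\<^sup>+z. F (c *\<^sub>R x + s *\<^sub>R z) \<partial>std_gauss) = (\<integral>\<^sup>+w. mehler c s x w * F w \<partial>lborel)"
proof -
  let ?N = "(1 / sqrt (2 * pi)) ^ DIM('a)"
  have "(\<integral>\<^sup>+w. mehler c s x w * F w \<partial>lborel) =
     (\<integral>\<^sup>+w. mehler c s x w * F w \<partial>density (distr lborel borel (\<lambda>z. c *\<^sub>R x + s *\<^sub>R z)) (\<lambda>_. \<bar>s\<bar>^DIM('a)))"
    using lborel_affine[OF s, of "c *\<^sub>R x"] by simp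
  also have "\<dots> = (\<integral>\<^sup>+z. ennreal (\<bar>s\<bar>^DIM('a)) * (mehler c s x (c *\<^sub>R x + s *\<^sub>R z) * F (c *\<^sub>R x + s *\<^sub>R z)) \<partial>lborel)"
    by (subst nn_integral_density; (measurable; fail)?) (subst nn_integral_distr; simp)
  also have "\<dots> = (\<integral>\<^sup>+z. ennreal (?N * exp (- (z \<bullet> z) / 2)) * F (c *\<^sub>R x + s *\<^sub>R z) \<partial>lborel)"
  proof (intro nn_integral_cong)
    fix z :: 'a
    have "\<bar>s\<bar>^DIM('a) * mehler c s x (c *\<^sub>R x + s *\<^sub>R z) = ?N * exp (- (z \<bullet> z) / 2)"
      using s by (simp add: mehler_def power2_eq_square)
    then show "ennreal (\<bar>s\<bar>^DIM('a)) * (mehler c s x (c *\<^sub>R x + s *\<^sub>R z) * F (c *\<^sub>R x + s *\<^sub>R z)) =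
      ennreal (?N * exp (- (z \<bullet> z) / 2)) * F (c *\<^sub>R x + s *\<^sub>R z)"
      by (metis ennreal_mult mehler_nonneg mult.assoc zero_le_power abs_ge_zero)
  qed
  also have "\<dots> = (\<integral>\<^sup>+z. F (c *\<^sub>R x + s *\<^sub>R z) \<partial>std_gauss)"
    by (simp add: std_gauss_eq nn_integral_density)
  finally show ?thesis by simp
qed

text \<open>The pair \<open>(x, c x + s z)\<close> is exchangeable because the Mehler kernel is reversible.\<close>

lemma std_gauss_exchange:
  fixes F :: "'a::euclidean_space \<times> 'a \<Rightarrow> ennreal"
  assumes [measurable]: "F \<in> borel_measurable borel" and s: "s \<noteq> 0" and cs: "c\<^sup>2 + s\<^sup>2 = 1"
  shows "(\<integral>\<^sup>+x. \<integral>\<^sup>+z. F (x, c *\<^sub>R x + s *\<^sub>R z) \<partial>std_gauss \<partial>std_gauss) =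
    (\<integral>\<^sup>+x. \<integral>\<^sup>+z. F (c *\<^sub>R x + s *\<^sub>R z, x) \<partial>std_gauss \<partial>std_gauss)"
proof -
  let ?N = "(1 / sqrt (2 * pi)) ^ DIM('a)"
  define K where "K = (\<lambda>x w::'a. ?N * exp (- (x \<bullet> x) / 2) * mehler c s x w)"
  have [measurable]: "F \<in> borel_measurable (borel \<Otimes>\<^sub>M borel)"
    using assms(1) by (simp add: borel_prod)
  have [measurable]: "(\<lambda>(x, w). K x w) \<in> borel_measurable (borel \<Otimes>\<^sub>M borel)"
    unfolding K_def by measurable
  \<comment> \<open>Because c^2 + s^2 = 1, the total exponent is -(x.x - 2 c x.w + w.w) / (2 s^2),
    which is symmetric in x and w.\<close>
  have sym: "K x w = K w x" for x w
  proof -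
    have "- (x \<bullet> x) / 2 + - ((w - c *\<^sub>R x) \<bullet> (w - c *\<^sub>R x)) / (2 * s\<^sup>2) =
        - (w \<bullet> w) / 2 + - ((x - c *\<^sub>R w) \<bullet> (x - c *\<^sub>R w)) / (2 * s\<^sup>2)"
    proof -
      have s2: "s\<^sup>2 = 1 - c * c" using cs by (simp add: power2_eq_square)
      have nz: "1 - c * c \<noteq> 0" using s s2 by auto
      show ?thesis unfolding s2 using nz
        by (simp add: inner_diff inner_commute divide_simps) (simp add: algebra_simps inner_commute)
    qed
    then show ?thesis
      unfolding K_def mehler_def by (simp add: mult.left_commute mult.assoc exp_add[symmetric])
  qed
  have Kn: "ennreal (K x w) = ennreal (?N * exp (- (x \<bullet> x) / 2)) * ennreal (mehler c s x w)" for x w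
    unfolding K_def by (rule ennreal_mult) (simp_all add: mehler_nonneg)
  have L: "(\<integral>\<^sup>+x. \<integral>\<^sup>+z. H (x, c *\<^sub>R x + s *\<^sub>R z) \<partial>std_gauss \<partial>std_gauss) =
     (\<integral>\<^sup>+x. \<integral>\<^sup>+w. K x w * H (x, w) \<partial>lborel \<partial>lborel)"
    if [measurable]: "H \<in> borel_measurable (borel \<Otimes>\<^sub>M borel)" for H :: "'a \<times> 'a \<Rightarrow> ennreal"
  proof -
    have "(\<integral>\<^sup>+x. \<integral>\<^sup>+z. H (x, c *\<^sub>R x + s *\<^sub>R z) \<partial>std_gauss \<partial>std_gauss) =
      (\<integral>\<^sup>+x. (\<integral>\<^sup>+w. mehler c s x w * H (x, w) \<partial>lborel) \<partial>std_gauss)"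
      by (intro nn_integral_cong nn_integral_std_gauss_affine) (use s in auto)
    also have "\<dots> = (\<integral>\<^sup>+x. ennreal (?N * exp (- (x \<bullet> x) / 2)) *
        (\<integral>\<^sup>+w. mehler c s x w * H (x, w) \<partial>lborel) \<partial>lborel)"
      unfolding std_gauss_eq by (subst nn_integral_density) auto
    also have "\<dots> = (\<integral>\<^sup>+x. \<integral>\<^sup>+w. K x w * H (x, w) \<partial>lborel \<partial>lborel)"
      by (simp add: nn_integral_cmult[symmetric] Kn mult.assoc)
    finally show ?thesis .
  qed
  have "(\<integral>\<^sup>+x. \<integral>\<^sup>+z. F (c *\<^sub>R x + s *\<^sub>R z, x) \<partial>std_gauss \<partial>std_gauss) =
     (\<integral>\<^sup>+x. \<integral>\<^sup>+w. K x w * F (w, x) \<partial>lborel \<partial>lborel)"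
    using L[of "\<lambda>(x, w). F (w, x)"] by simp
  also have "\<dots> = (\<integral>\<^sup>+w. \<integral>\<^sup>+x. K x w * F (w, x) \<partial>lborel \<partial>lborel)"
    by (rule lborel_pair.Fubini') measurable
  also have "\<dots> = (\<integral>\<^sup>+x. \<integral>\<^sup>+z. F (x, c *\<^sub>R x + s *\<^sub>R z) \<partial>std_gauss \<partial>std_gauss)"
    by (subst L) (auto simp: sym)
  finally show ?thesis by simp
qed

text \<open>Exchangeability applied to a function of the second entry alone replaces c x + s z by
  x.\<close>

lemma std_gauss_mix:
  assumes s: "s \<noteq> 0" and cs: "c\<^sup>2 + s\<^sup>2 = 1"
  shows "distr (std_gauss \<Otimes>\<^sub>M std_gauss) borel (\<lambda>(x, z). c *\<^sub>R x + s *\<^sub>R z) =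
    (std_gauss :: 'a::euclidean_space measure)"
proof (rule measure_eqI)
  fix A :: "'a set"
  assume "A \<in> sets (distr (std_gauss \<Otimes>\<^sub>M std_gauss) borel (\<lambda>(x, z). c *\<^sub>R x + s *\<^sub>R z))"
  then have [measurable]: "A \<in> sets borel" by simp
  have "emeasure (distr (std_gauss \<Otimes>\<^sub>M std_gauss) borel (\<lambda>(x, z). c *\<^sub>R x + s *\<^sub>R z)) A =
     (\<integral>\<^sup>+w. indicator A w \<partial>distr (std_gauss \<Otimes>\<^sub>M std_gauss) borel (\<lambda>(x, z). c *\<^sub>R x + s *\<^sub>R z))"
    by (subst nn_integral_indicator) auto
  also have "\<dots> = (\<integral>\<^sup>+p. indicator A (c *\<^sub>R fst p + s *\<^sub>R snd p) \<partial>(std_gauss \<Otimes>\<^sub>M std_gauss))"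
    by (subst nn_integral_distr) (auto simp: split_beta)
  also have "\<dots> = (\<integral>\<^sup>+x. \<integral>\<^sup>+z. indicator A (c *\<^sub>R x + s *\<^sub>R z) \<partial>std_gauss \<partial>std_gauss)"
    by (subst std_gauss.nn_integral_fst[symmetric]) auto
  also have "\<dots> = (\<integral>\<^sup>+x. \<integral>\<^sup>+z. indicator A x \<partial>(std_gauss :: 'a measure) \<partial>std_gauss)"
  proof -
    have "(\<lambda>p::'a\<times>'a. indicator A (snd p) :: ennreal) \<in> borel_measurable borel"
      unfolding borel_prod[symmetric] by measurable
    from std_gauss_exchange[OF this s cs] show ?thesis by simp
  qed
  also have "\<dots> = emeasure std_gauss A" by simp
  finally show "emeasure (distr (std_gauss \<Otimes>\<^sub>M std_gauss) borel (\<lambda>(x, z). c *\<^sub>R x + s *\<^sub>R z)) A = emeasure std_gauss A" .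
qed simp

lemma gauss_pair_eq: "(gauss_pair \<rho> :: ('a::euclidean_space \<times> 'a) measure) =
   distr std_gauss borel (\<lambda>p. (fst p, \<rho> *\<^sub>R fst p + sqrt (1 - \<rho>\<^sup>2) *\<^sub>R snd p))"
  unfolding gauss_pair_def by (simp add: std_gauss_pair_measure split_beta')

text \<open>The pair is the image of a standard Gaussian under a linear map L, and mixing commutes
  with L; so the claim reduces to \<open>std_gauss_mix\<close> on the product space.\<close>

lemma gauss_pair_mix:
  assumes s: "s \<noteq> 0" and cs: "c\<^sup>2 + s\<^sup>2 = 1"
  shows "distr (gauss_pair \<rho> \<Otimes>\<^sub>M gauss_pair \<rho>) borel (\<lambda>(x, z). c *\<^sub>R x + s *\<^sub>R z) =
    (gauss_pair \<rho> :: ('a::euclidean_space \<times> 'a) measure)"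
proof -
  define L where "L = (\<lambda>p::'a\<times>'a. (fst p, \<rho> *\<^sub>R fst p + sqrt (1 - \<rho>\<^sup>2) *\<^sub>R snd p))"
  have [measurable]: "L \<in> borel_measurable borel"
    unfolding L_def by (intro borel_measurable_continuous_onI continuous_intros)
  have G: "gauss_pair \<rho> = distr std_gauss borel L" by (simp add: gauss_pair_eq L_def)
  have lin: "c *\<^sub>R L x + s *\<^sub>R L z = L (c *\<^sub>R x + s *\<^sub>R z)" for x z
    by (simp add: L_def prod_eq_iff algebra_simps)
  have sf: "sigma_finite_measure (distr (std_gauss :: ('a\<times>'a) measure) borel L)"
    by (metis G gauss_pair.sigma_finite_measure_axioms)
  have "distr (gauss_pair \<rho> \<Otimes>\<^sub>M gauss_pair \<rho>) borel (\<lambda>(x, z). c *\<^sub>R x + s *\<^sub>R z) =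
     distr (distr (std_gauss \<Otimes>\<^sub>M std_gauss) (borel \<Otimes>\<^sub>M borel) (\<lambda>(x, z). (L x, L z))) borel
        (\<lambda>(x, z). c *\<^sub>R x + s *\<^sub>R z)"
    unfolding G by (subst pair_measure_distr) (use sf in simp_all)
  also have "\<dots> = distr (std_gauss \<Otimes>\<^sub>M std_gauss) borel (\<lambda>(x, z). L (c *\<^sub>R x + s *\<^sub>R z))"
    by (subst distr_distr) (auto simp: comp_def split_beta' lin)
  also have "\<dots> = distr (distr (std_gauss \<Otimes>\<^sub>M std_gauss) borel (\<lambda>(x, z). c *\<^sub>R x + s *\<^sub>R z)) borel L"
    by (subst distr_distr) (auto simp: comp_def split_beta')
  also have "\<dots> = gauss_pair \<rho>"
    by (simp add: std_gauss_mix[OF s cs] G)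
  finally show ?thesis .
qed

section \<open>Marginals, symmetry and integration for the correlated pair\<close>

lemma gauss_pair_fst: "distr (gauss_pair \<rho>) borel fst = (std_gauss :: 'a::euclidean_space measure)"
proof -
  have "distr (gauss_pair \<rho>) borel fst = distr (std_gauss \<Otimes>\<^sub>M std_gauss :: ('a \<times> 'a) measure) borel fst"
    unfolding gauss_pair_def
    by (subst distr_distr) (auto simp: comp_def split_beta' borel_prod[symmetric])
  also have "\<dots> = distr (std_gauss \<Otimes>\<^sub>M std_gauss :: ('a \<times> 'a) measure) std_gauss fst"
    by (intro distr_cong) auto
  also have "\<dots> = std_gauss" by (rule std_gauss.distr_pair_fst)
  finally show ?thesis .
qed

lemma gauss_pair_snd:
  assumes "-1 < \<rho>" "\<rho> < 1"
  shows "distr (gauss_pair \<rho>) borel snd = (std_gauss :: 'a::euclidean_space measure)"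
proof -
  have r: "\<rho>\<^sup>2 < 1" using assms by (simp add: abs_square_less_1)
  have "distr (gauss_pair \<rho>) borel snd =
      distr (std_gauss \<Otimes>\<^sub>M std_gauss :: ('a \<times> 'a) measure) borel (\<lambda>(x, z). \<rho> *\<^sub>R x + sqrt (1 - \<rho>\<^sup>2) *\<^sub>R z)"
    unfolding gauss_pair_def
    by (subst distr_distr) (auto simp: comp_def split_beta' borel_prod[symmetric])
  also have "\<dots> = std_gauss" by (rule std_gauss_mix) (use r in auto)
  finally show ?thesis .
qed

text \<open>Conditioning on the first entry, this is \<open>std_gauss_exchange\<close> with c =
  \<rho> and s = sqrt (1 - \<rho>^2).\<close>

lemma gauss_pair_swap:
  assumes "-1 < \<rho>" "\<rho> < 1"
  shows "distr (gauss_pair \<rho>) borel (\<lambda>p. (snd p, fst p)) =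
    (gauss_pair \<rho> :: ('a::euclidean_space \<times> 'a) measure)"
proof (rule measure_eqI)
  fix A :: "('a \<times> 'a) set"
  assume "A \<in> sets (distr (gauss_pair \<rho>) borel (\<lambda>p. (snd p, fst p)))"
  then have A [measurable]: "A \<in> sets borel" by simp
  have [measurable]: "A \<in> sets (borel \<Otimes>\<^sub>M borel)" using A by (simp only: borel_prod)
  have r: "\<rho>\<^sup>2 < 1" using assms by (simp add: abs_square_less_1)
  have N: "nn_integral (gauss_pair \<rho>) F =
     (\<integral>\<^sup>+x. \<integral>\<^sup>+z. F (x, \<rho> *\<^sub>R x + sqrt (1 - \<rho>\<^sup>2) *\<^sub>R z) \<partial>std_gauss \<partial>std_gauss)"
    if [measurable]: "F \<in> borel_measurable (borel \<Otimes>\<^sub>M borel)" for F :: "'a \<times> 'a \<Rightarrow> ennreal"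
    unfolding gauss_pair_def
    by (subst nn_integral_distr) (auto simp: split_beta borel_prod[symmetric] std_gauss.nn_integral_fst[symmetric])
  have [measurable]: "(\<lambda>p::'a\<times>'a. (snd p, fst p)) \<in> borel_measurable borel"
    by (intro borel_measurable_continuous_onI continuous_intros)
  have "emeasure (distr (gauss_pair \<rho>) borel (\<lambda>p. (snd p, fst p))) A =
     (\<integral>\<^sup>+w. indicator A w \<partial>distr (gauss_pair \<rho>) borel (\<lambda>p. (snd p, fst p)))"
    by (subst nn_integral_indicator) auto
  also have "\<dots> = (\<integral>\<^sup>+p. indicator A (snd p, fst p) \<partial>gauss_pair \<rho>)"
    by (subst nn_integral_distr) (auto simp: split_beta)
  also have "\<dots> = (\<integral>\<^sup>+p. indicator A p \<partial>gauss_pair \<rho>)"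
    using std_gauss_exchange[of "indicator A" "sqrt (1 - \<rho>\<^sup>2)" \<rho>] r
    by (simp add: N del: nn_integral_indicator)
  also have "\<dots> = emeasure (gauss_pair \<rho>) A" by simp
  finally show "emeasure (distr (gauss_pair \<rho>) borel (\<lambda>p. (snd p, fst p))) A = emeasure (gauss_pair \<rho>) A" .
qed simp

lemma integrable_std_gauss_bounded:
  fixes F :: "'a::euclidean_space \<Rightarrow> real"
  assumes "F \<in> borel_measurable borel" "\<And>x. \<bar>F x\<bar> \<le> B"
  shows "integrable std_gauss F"
  by (rule std_gauss.integrable_const_bound[where B=B]) (use assms in auto)

lemma integral_std_gauss_mix:
  fixes F :: "'a::euclidean_space \<Rightarrow> real"
  assumes [measurable]: "F \<in> borel_measurable borel" and "\<And>x. \<bar>F x\<bar> \<le> B"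
    and "s \<noteq> 0" "c\<^sup>2 + s\<^sup>2 = 1"
  shows "(\<integral>x. F x \<partial>std_gauss) = (\<integral>x. \<integral>z. F (c *\<^sub>R x + s *\<^sub>R z) \<partial>std_gauss \<partial>std_gauss)"
proof -
  have "(\<integral>x. F x \<partial>std_gauss) = (\<integral>x. F x \<partial>distr (std_gauss \<Otimes>\<^sub>M std_gauss) borel (\<lambda>(x, z). c *\<^sub>R x + s *\<^sub>R z))"
    using std_gauss_mix[OF assms(3,4), where 'a='a] by simp
  also have "\<dots> = (\<integral>p. F (c *\<^sub>R fst p + s *\<^sub>R snd p) \<partial>(std_gauss \<Otimes>\<^sub>M std_gauss))"
    by (subst integral_distr) (auto simp: split_beta')
  also have "\<dots> = (\<integral>x. \<integral>z. F (c *\<^sub>R x + s *\<^sub>R z) \<partial>std_gauss \<partial>std_gauss)"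
    by (subst std_gauss_pair.integral_fst'[symmetric])
       (auto intro!: std_gauss_pair.integrable_const_bound[where B=B] assms)
  finally show ?thesis .
qed

lemma integral_gauss_pair_mix:
  fixes F :: "'a::euclidean_space \<times> 'a \<Rightarrow> real"
  assumes [measurable]: "F \<in> borel_measurable borel" and "\<And>x. \<bar>F x\<bar> \<le> B"
    and "s \<noteq> 0" "c\<^sup>2 + s\<^sup>2 = 1"
  shows "(\<integral>x. F x \<partial>gauss_pair \<rho>) =
    (\<integral>x. \<integral>z. F (c *\<^sub>R x + s *\<^sub>R z) \<partial>gauss_pair \<rho> \<partial>gauss_pair \<rho>)"
proof -
  have "(\<integral>x. F x \<partial>gauss_pair \<rho>) =
      (\<integral>x. F x \<partial>distr (gauss_pair \<rho> \<Otimes>\<^sub>M gauss_pair \<rho>) borel (\<lambda>(x, z). c *\<^sub>R x + s *\<^sub>R z))"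
    using gauss_pair_mix[OF assms(3,4), where 'a='a] by simp
  also have "\<dots> = (\<integral>p. F (c *\<^sub>R fst p + s *\<^sub>R snd p) \<partial>(gauss_pair \<rho> \<Otimes>\<^sub>M gauss_pair \<rho>))"
    by (subst integral_distr) (auto simp: split_beta')
  also have "\<dots> = (\<integral>x. \<integral>z. F (c *\<^sub>R x + s *\<^sub>R z) \<partial>gauss_pair \<rho> \<partial>gauss_pair \<rho>)"
    by (subst gauss_pair_pair.integral_fst'[symmetric])
       (auto intro!: gauss_pair_pair.integrable_const_bound[where B=B] assms)
  finally show ?thesis .
qed

lemma measurable_fst_gauss_pair [measurable]:
    "fst \<in> (gauss_pair \<rho> :: ('a::euclidean_space \<times> 'a) measure) \<rightarrow>\<^sub>M borel"
  and measurable_snd_gauss_pair [measurable]: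
    "snd \<in> (gauss_pair \<rho> :: ('a::euclidean_space \<times> 'a) measure) \<rightarrow>\<^sub>M borel"
proof -
  have "fst \<in> borel_measurable (borel :: ('a\<times>'a) measure)" "snd \<in> borel_measurable (borel :: ('a\<times>'a) measure)"
    by (auto intro!: borel_measurable_continuous_onI continuous_intros)
  then show "fst \<in> (gauss_pair \<rho> :: ('a\<times>'a) measure) \<rightarrow>\<^sub>M borel" "snd \<in> (gauss_pair \<rho> :: ('a\<times>'a) measure) \<rightarrow>\<^sub>M borel"
    by (simp_all cong: measurable_cong_sets)
qed

lemma integral_gauss_pair_fst:
  fixes f :: "'a::euclidean_space \<Rightarrow> real"
  assumes "f \<in> borel_measurable borel"
  shows "(\<integral>p. f (fst p) \<partial>gauss_pair \<rho>) = (\<integral>x. f x \<partial>std_gauss)"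
  by (subst gauss_pair_fst[of \<rho>, symmetric], subst integral_distr) (use assms in auto)

lemma integral_gauss_pair_snd:
  fixes f :: "'a::euclidean_space \<Rightarrow> real"
  assumes "-1 < \<rho>" "\<rho> < 1" "f \<in> borel_measurable borel"
  shows "(\<integral>p. f (snd p) \<partial>gauss_pair \<rho>) = (\<integral>x. f x \<partial>std_gauss)"
  by (subst gauss_pair_snd[OF assms(1,2), symmetric], subst integral_distr) (use assms in auto)

lemma integrable_gauss_pair_fst:
  fixes f :: "'a::euclidean_space \<Rightarrow> real"
  assumes "integrable std_gauss f"
  shows "integrable (gauss_pair \<rho>) (\<lambda>p. f (fst p))"
proof -
  have [measurable]: "f \<in> borel_measurable borel"
    using borel_measurable_integrable[OF assms] by (metis measurable_cong_sets sets_std_gauss)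
  show ?thesis
    using assms unfolding gauss_pair_fst[of \<rho>, symmetric] by (subst (asm) integrable_distr_eq) auto
qed

lemma integrable_gauss_pair_snd:
  fixes f :: "'a::euclidean_space \<Rightarrow> real"
  assumes "-1 < \<rho>" "\<rho> < 1" "integrable std_gauss f"
  shows "integrable (gauss_pair \<rho>) (\<lambda>p. f (snd p))"
proof -
  have [measurable]: "f \<in> borel_measurable borel"
    using borel_measurable_integrable[OF assms(3)] by (metis measurable_cong_sets sets_std_gauss)
  show ?thesis
    using assms(3) unfolding gauss_pair_snd[OF assms(1,2), symmetric] by (subst (asm) integrable_distr_eq) auto
qed

section \<open>The Cameron-Martin shift and Gaussian moments\<close>

lemma nn_integral_std_gauss_shift:
  fixes F :: "'a::euclidean_space \<Rightarrow> ennreal"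
  assumes [measurable]: "F \<in> borel_measurable borel"
  shows "(\<integral>\<^sup>+z. F (z + w) \<partial>std_gauss) = (\<integral>\<^sup>+z. exp (w \<bullet> z - w \<bullet> w / 2) * F z \<partial>std_gauss)"
proof -
  let ?N = "(1 / sqrt (2 * pi)) ^ DIM('a)"
  have "(\<integral>\<^sup>+z. F (z + w) \<partial>std_gauss) = (\<integral>\<^sup>+z. F (1 *\<^sub>R w + 1 *\<^sub>R z) \<partial>std_gauss)"
    by (simp add: add.commute)
  also have "\<dots> = (\<integral>\<^sup>+z. mehler 1 1 w z * F z \<partial>lborel)"
    by (rule nn_integral_std_gauss_affine) auto
  also have "\<dots> = (\<integral>\<^sup>+z. ennreal (?N * exp (- (z \<bullet> z) / 2)) * (exp (w \<bullet> z - w \<bullet> w / 2) * F z) \<partial>lborel)"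
  proof (intro nn_integral_cong)
    fix z :: 'a
    have "mehler 1 1 w z = (?N * exp (- (z \<bullet> z) / 2)) * exp (w \<bullet> z - w \<bullet> w / 2)"
      by (simp add: mehler_def exp_add[symmetric] inner_diff inner_commute field_simps)
    then show "mehler 1 1 w z * F z = ennreal (?N * exp (- (z \<bullet> z) / 2)) * (exp (w \<bullet> z - w \<bullet> w / 2) * F z)"
      by (metis ennreal_mult exp_ge_zero mult.assoc mult_nonneg_nonneg zero_le_power
          zero_le_divide_1_iff real_sqrt_ge_0_iff pi_ge_zero zero_le_mult_iff zero_le_numeral)
  qed
  also have "\<dots> = (\<integral>\<^sup>+z. exp (w \<bullet> z - w \<bullet> w / 2) * F z \<partial>std_gauss)"
    unfolding std_gauss_eq by (subst nn_integral_density) auto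
  finally show ?thesis .
qed

lemma std_gauss_minus: "distr std_gauss borel uminus = (std_gauss :: 'a::euclidean_space measure)"
proof (rule measure_eqI)
  fix A :: "'a set" assume "A \<in> sets (distr std_gauss borel uminus)"
  then have [measurable]: "A \<in> sets borel" by simp
  have "emeasure (distr std_gauss borel uminus) A = (\<integral>\<^sup>+w. indicator A w \<partial>distr std_gauss borel uminus)"
    by (subst nn_integral_indicator) auto
  also have "\<dots> = (\<integral>\<^sup>+z. indicator A (- z) \<partial>std_gauss)"
    by (subst nn_integral_distr) auto
  also have "\<dots> = (\<integral>\<^sup>+z. ennreal (mehler 0 (-1) 0 z) * indicator A z \<partial>lborel)"
    using nn_integral_std_gauss_affine[of "\<lambda>z. indicator A z" "-1" 0 "0::'a"]
    by simp
  also have "\<dots> = (\<integral>\<^sup>+z. indicator A z \<partial>std_gauss)"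
    unfolding std_gauss_eq by (subst nn_integral_density) (auto simp: mehler_def)
  also have "\<dots> = emeasure std_gauss A" by simp
  finally show "emeasure (distr std_gauss borel uminus) A = emeasure std_gauss A" .
qed simp

lemma integrable_gauss_exp_inner [simp]:
  "integrable (std_gauss :: 'a::euclidean_space measure) (\<lambda>z. exp (w \<bullet> z))"
  and integral_gauss_exp_inner: "(\<integral>z. exp (w \<bullet> z) \<partial>(std_gauss :: 'a measure)) = exp (w \<bullet> w / 2)"
proof -
  have *: "(\<integral>\<^sup>+z. exp (w \<bullet> z - w \<bullet> w / 2) \<partial>(std_gauss :: 'a measure)) = 1"
    using nn_integral_std_gauss_shift[of "\<lambda>_. 1" w] by simp
  have "integrable (std_gauss :: 'a measure) (\<lambda>z. exp (w \<bullet> z - w \<bullet> w / 2))"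
    by (intro integrableI_nonneg) (auto simp: *)
  from integrable_mult_right[OF this, of "exp (w \<bullet> w / 2)"]
  show "integrable (std_gauss :: 'a measure) (\<lambda>z. exp (w \<bullet> z))" by (simp add: exp_add[symmetric])
  have "(\<integral>z. exp (w \<bullet> z - w \<bullet> w / 2) \<partial>(std_gauss :: 'a measure)) = 1"
    by (subst integral_eq_nn_integral) (auto simp: *)
  then show "(\<integral>z. exp (w \<bullet> z) \<partial>(std_gauss :: 'a measure)) = exp (w \<bullet> w / 2)"
    by (simp add: exp_diff)
qed

text \<open>The translation is moved from F to an exponential weight. This makes averages of a
  merely measurable function differentiable in w.\<close>

lemma integral_std_gauss_shift:
  fixes F :: "'a::euclidean_space \<Rightarrow> real"
  assumes [measurable]: "F \<in> borel_measurable borel" and F: "\<And>x. 0 \<le> F x"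
  shows "(\<integral>z. F (z + w) \<partial>std_gauss) = (\<integral>z. exp (w \<bullet> z - w \<bullet> w / 2) * F z \<partial>std_gauss)"
  using F by (subst (1 2) integral_eq_nn_integral)
    (auto simp: nn_integral_std_gauss_shift ennreal_mult nn_integral_std_gauss_shift[of "\<lambda>z. ennreal (F z)"])

text \<open>Multiplying the density by exp (z.z / 4) turns it, up to the factor (sqrt 2)^n in
  dimension n, into the density of variance 2, so exp (z.z / 4) is integrable and dominates the
  polynomial. The third power is what the cubic Taylor remainders of increments of quadratic growth
  require.\<close>

lemma integrable_gauss_weight:
  "integrable (std_gauss :: 'a::euclidean_space measure) (\<lambda>z. (1 + z \<bullet> z) ^ 3)"
proof -
  let ?N = "(1 / sqrt (2 * pi)) ^ DIM('a)"
  have "(\<integral>\<^sup>+z. ennreal (exp (z \<bullet> z / 4)) \<partial>(std_gauss :: 'a measure)) =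
      (\<integral>\<^sup>+z. ennreal (?N * exp (- (z \<bullet> z) / 2)) * ennreal (exp (z \<bullet> z / 4)) \<partial>(lborel :: 'a measure))"
    unfolding std_gauss_eq by (subst nn_integral_density) auto
  also have "\<dots> = (\<integral>\<^sup>+z. ennreal (sqrt 2 ^ DIM('a)) * (ennreal (mehler 0 (sqrt 2) 0 z) * 1) \<partial>(lborel :: 'a measure))"
    by (intro nn_integral_cong)
       (simp add: ennreal_mult[symmetric] mehler_nonneg, simp add: mehler_def exp_add[symmetric])
  also have "\<dots> = ennreal (sqrt 2 ^ DIM('a)) * (\<integral>\<^sup>+z. ennreal (mehler 0 (sqrt 2) 0 z) * 1 \<partial>(lborel :: 'a measure))"
    by (rule nn_integral_cmult) auto
  also have "(\<integral>\<^sup>+z. ennreal (mehler 0 (sqrt 2) 0 z) * 1 \<partial>(lborel :: 'a measure)) = 1"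
    using nn_integral_std_gauss_affine[of "\<lambda>_::'a. 1" "sqrt 2" 0 0] by simp
  finally have "integrable (std_gauss :: 'a measure) (\<lambda>z. exp (z \<bullet> z / 4))"
    by (intro integrableI_nonneg) auto
  then have "integrable (std_gauss :: 'a measure) (\<lambda>z. 12 ^ 3 * exp (z \<bullet> z / 4))"
    by simp
  then show ?thesis
  proof (rule Bochner_Integration.integrable_bound)
    have "(1 + z \<bullet> z) ^ 3 \<le> 12 ^ 3 * exp (z \<bullet> z / 4)" for z :: 'a
    proof -
      \<comment> \<open>The 12 is chosen so that cubing exp (z.z / 12) gives exp (z.z / 4).\<close>
      have "1 + z \<bullet> z \<le> 12 * exp (z \<bullet> z / 12)"
        using exp_ge_add_one_self[of "z \<bullet> z / 12"] inner_ge_zero[of z] by linarith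
      then have "(1 + z \<bullet> z) ^ 3 \<le> (12 * exp (z \<bullet> z / 12)) ^ 3"
        by (intro power_mono) auto
      also have "\<dots> = 12 ^ 3 * exp (z \<bullet> z / 4)"
        by (simp add: power_mult_distrib exp_of_nat_mult[symmetric])
      finally show ?thesis .
    qed
    then show "AE z in (std_gauss :: 'a measure). norm ((1 + z \<bullet> z) ^ 3) \<le> norm (12 ^ 3 * exp (z \<bullet> z / 4))"
      by (intro AE_I2) auto
  qed auto
qed

lemma integrable_gauss_dominated:
  fixes F :: "'a::euclidean_space \<Rightarrow> real"
  assumes [measurable]: "F \<in> borel_measurable borel" and "\<And>z. \<bar>F z\<bar> \<le> B * (1 + z \<bullet> z) ^ 3"
  shows "integrable std_gauss F"
proof (rule Bochner_Integration.integrable_bound)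
  show "integrable std_gauss (\<lambda>z::'a. B * (1 + z \<bullet> z) ^ 3)" by (intro integrable_mult_right integrable_gauss_weight)
  show "AE z in std_gauss. norm (F z) \<le> norm (B * (1 + z \<bullet> z) ^ 3)"
    using assms(2) by (intro AE_I2) (metis abs_ge_self order_trans real_norm_def)
qed simp

lemma norm_le_weight: "norm z \<le> 1 + z \<bullet> z" for z :: "'a::euclidean_space"
  using zero_le_power2[of "norm z - 1/2"] unfolding power2_diff power2_norm_eq_inner
  by (simp add: power2_eq_square)

lemma abs_le_weight: "\<bar>w \<bullet> z\<bar> \<le> norm w * (1 + z \<bullet> z)" for w z :: "'a::euclidean_space"
proof -
  have "norm w * norm z \<le> norm w * (1 + z \<bullet> z)" by (intro mult_left_mono norm_le_weight) auto
  with Cauchy_Schwarz_ineq2[of w z] show ?thesis by linarith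
qed

lemma weight_mono: "1 \<le> k \<Longrightarrow> k \<le> 3 \<Longrightarrow> 1 + z \<bullet> z \<le> (1 + z \<bullet> z) ^ k"
  "1 \<le> k \<Longrightarrow> k \<le> 3 \<Longrightarrow> (1 + z \<bullet> z) ^ k \<le> (1 + z \<bullet> z) ^ 3" for z :: "'a::euclidean_space"
  by (auto intro: self_le_power power_increasing)

lemma integrable_gauss_inner [simp]: "integrable (std_gauss :: 'a::euclidean_space measure) (\<lambda>z. w \<bullet> z)"
  by (rule integrable_gauss_dominated[where B="norm w"])
     (auto intro!: order_trans[OF abs_le_weight] mult_left_mono weight_mono)

lemma integrable_gauss_inner_mult [simp]:
  "integrable (std_gauss :: 'a::euclidean_space measure) (\<lambda>z. (v \<bullet> z) * (w \<bullet> z))"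
proof (rule integrable_gauss_dominated[where B="norm v * norm w"])
  fix z :: 'a
  have "\<bar>(v \<bullet> z) * (w \<bullet> z)\<bar> \<le> (norm v * (1 + z \<bullet> z)) * (norm w * (1 + z \<bullet> z))"
    unfolding abs_mult by (intro mult_mono abs_le_weight) auto
  also have "\<dots> = norm v * norm w * (1 + z \<bullet> z) ^ 2" by (simp add: power2_eq_square)
  also have "\<dots> \<le> norm v * norm w * (1 + z \<bullet> z) ^ 3"
    by (intro mult_left_mono weight_mono) auto
  finally show "\<bar>(v \<bullet> z) * (w \<bullet> z)\<bar> \<le> norm v * norm w * (1 + z \<bullet> z) ^ 3" .
qed auto

lemma integral_gauss_inner [simp]: "(\<integral>z. w \<bullet> z \<partial>(std_gauss :: 'a::euclidean_space measure)) = 0"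
proof -
  have "(\<integral>z. w \<bullet> z \<partial>(std_gauss :: 'a measure)) = (\<integral>z. w \<bullet> z \<partial>distr std_gauss borel (uminus :: 'a \<Rightarrow> 'a))"
    by (simp add: std_gauss_minus)
  also have "\<dots> = - (\<integral>z. w \<bullet> z \<partial>(std_gauss :: 'a measure))"
    by (subst integral_distr) auto
  finally show ?thesis by simp
qed

lemma integral_gauss_basis_square:
  fixes b :: "'a::euclidean_space"
  assumes b: "b \<in> Basis"
  shows "(\<integral>z. (b \<bullet> z) * (b \<bullet> z) \<partial>std_gauss) = 1"
proof -
  have m: "has_bochner_integral lborel (\<lambda>t. std_normal_density t * t\<^sup>2) 1"
    using std_normal_moment_even[of 1] by simp
  have "(\<integral>\<^sup>+z. ennreal ((b \<bullet> z)\<^sup>2) \<partial>std_gauss) =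
     (\<integral>\<^sup>+z. ennreal (\<Prod>b'\<in>Basis. std_normal_density (z \<bullet> b')) * ennreal ((b \<bullet> z)\<^sup>2) \<partial>lborel)"
    unfolding std_gauss_def by (subst nn_integral_density) auto
  also have "\<dots> = (\<integral>\<^sup>+z. (\<Prod>b'\<in>Basis. ennreal (std_normal_density (z \<bullet> b') * (if b' = b then (z \<bullet> b')\<^sup>2 else 1))) \<partial>lborel)"
    using b by (intro nn_integral_cong)
      (simp add: prod_ennreal ennreal_mult[symmetric] prod_nonneg prod.distrib inner_commute)
  also have "\<dots> = (\<Prod>b'\<in>(Basis::'a set). \<integral>\<^sup>+t. ennreal (std_normal_density t * (if b' = b then t\<^sup>2 else 1)) \<partial>lborel)"
    by (rule nn_integral_lborel_prod) auto
  also have "\<dots> = (\<Prod>b'\<in>(Basis::'a set). 1)"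
  proof (intro prod.cong refl)
    fix b' :: 'a
    interpret N: prob_space std_normal_distribution
      by (rule prob_space_normal_density) simp
    have 1: "(\<integral>\<^sup>+t. ennreal (std_normal_density t) \<partial>lborel) = 1"
      using N.emeasure_space_1 by (simp add: emeasure_density)
    have 2: "(\<integral>\<^sup>+t. ennreal (std_normal_density t * t\<^sup>2) \<partial>lborel) = 1"
      using m by (subst nn_integral_eq_integral) (auto simp: has_bochner_integral_iff)
    show "(\<integral>\<^sup>+t. ennreal (std_normal_density t * (if b' = b then t\<^sup>2 else 1)) \<partial>lborel) = 1"
      using 1 2 by (cases "b' = b") auto
  qed
  finally have "(\<integral>\<^sup>+z. ennreal ((b \<bullet> z)\<^sup>2) \<partial>std_gauss) = 1" by simp
  then show ?thesis
    by (subst integral_eq_nn_integral) (auto simp: power2_eq_square)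
qed

text \<open>Reflecting the coordinate b preserves Lebesgue measure and the density but flips the
  sign of the integrand.\<close>

lemma integral_gauss_basis_mult:
  fixes b b' :: "'a::euclidean_space"
  assumes b: "b \<in> Basis" "b' \<in> Basis" "b \<noteq> b'"
  shows "(\<integral>z. (b \<bullet> z) * (b' \<bullet> z) \<partial>std_gauss) = 0"
proof -
  define T where "T = (\<lambda>x::'a. (0::'a) + (\<Sum>j\<in>Basis. ((if j = b then -1 else 1) * (x \<bullet> j)) *\<^sub>R j))"
  have Tb: "i \<in> Basis \<Longrightarrow> T x \<bullet> i = (if i = b then -1 else 1) * (x \<bullet> i)" for x i
    by (simp add: T_def)
  have Tb': "i \<in> Basis \<Longrightarrow> i \<bullet> T x = (if i = b then -1 else 1) * (i \<bullet> x)" for x i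
    using Tb by (simp add: inner_commute)
  have "lborel = density (distr lborel borel T) (\<lambda>_. (\<Prod>j\<in>(Basis::'a set). \<bar>if j = b then -1 else 1::real\<bar>))"
    unfolding T_def
    by (rule lborel_affine_euclidean[where c="\<lambda>j. if j = b then -1 else 1" and t=0]) auto
  then have lb: "distr lborel borel T = lborel"
    by (simp add: density_1 if_distrib[of abs] cong: if_cong)
  have [measurable]: "T \<in> borel_measurable borel"
    unfolding T_def by (intro borel_measurable_continuous_onI continuous_intros)
  have nT: "T x \<bullet> T x = x \<bullet> x" for x
    by (subst (1 2) euclidean_inner) (auto simp: Tb intro!: sum.cong)
  let ?N = "(1 / sqrt (2 * pi)) ^ DIM('a)"
  let ?d = "\<lambda>x::'a. ?N * exp (- (x \<bullet> x) / 2)"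
  have "(\<integral>z. (b \<bullet> z) * (b' \<bullet> z) \<partial>std_gauss) = (\<integral>z. ?d z * ((b \<bullet> z) * (b' \<bullet> z)) \<partial>lborel)"
    unfolding std_gauss_eq by (subst integral_density) auto
  also have "\<dots> = (\<integral>z. ?d z * ((b \<bullet> z) * (b' \<bullet> z)) \<partial>distr lborel borel T)"
    by (simp add: lb)
  also have "\<dots> = (\<integral>z. ?d (T z) * ((T z \<bullet> b) * (T z \<bullet> b')) \<partial>lborel)"
    by (subst integral_distr) (auto simp: inner_commute)
  also have "\<dots> = - (\<integral>z. ?d z * ((b \<bullet> z) * (b' \<bullet> z)) \<partial>lborel)"
    using b by (subst integral_minus[symmetric]) (simp add: nT inner_commute[of _ b] inner_commute[of _ b'] Tb')
  also have "(\<integral>z. ?d z * ((b \<bullet> z) * (b' \<bullet> z)) \<partial>lborel) = (\<integral>z. (b \<bullet> z) * (b' \<bullet> z) \<partial>std_gauss)"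
    unfolding std_gauss_eq by (subst integral_density) auto
  finally show ?thesis by simp
qed

lemma integral_gauss_inner_mult:
  "(\<integral>z. (v \<bullet> z) * (w \<bullet> z) \<partial>(std_gauss :: 'a::euclidean_space measure)) = v \<bullet> w"
proof -
  have "(\<integral>z. (v \<bullet> z) * (w \<bullet> z) \<partial>(std_gauss :: 'a measure)) =
     (\<integral>z. (\<Sum>i\<in>Basis. \<Sum>j\<in>Basis. ((v \<bullet> i) * (w \<bullet> j)) * ((i \<bullet> z) * (j \<bullet> z))) \<partial>(std_gauss :: 'a measure))"
  proof (rule Bochner_Integration.integral_cong[OF refl])
    fix z :: 'a
    show "(v \<bullet> z) * (w \<bullet> z) = (\<Sum>i\<in>Basis. \<Sum>j\<in>Basis. ((v \<bullet> i) * (w \<bullet> j)) * ((i \<bullet> z) * (j \<bullet> z)))"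
      by (subst euclidean_inner[of v], subst euclidean_inner[of w])
         (simp add: sum_product inner_commute mult.assoc mult.left_commute)
  qed
  also have "\<dots> = (\<Sum>i\<in>Basis. \<Sum>j\<in>Basis. ((v \<bullet> i) * (w \<bullet> j)) * (\<integral>z. (i \<bullet> z) * (j \<bullet> z) \<partial>(std_gauss :: 'a measure)))"
    by simp
  also have "\<dots> = (\<Sum>i\<in>Basis. \<Sum>j\<in>Basis. if j = i then (v \<bullet> i) * (w \<bullet> j) else 0)"
    by (intro sum.cong refl) (auto simp: integral_gauss_basis_square integral_gauss_basis_mult)
  also have "\<dots> = v \<bullet> w"
    by (subst euclidean_inner[of v w]) simp
  finally show ?thesis .
qed

text \<open>In the product space this is the covariance formula for the vectors (v,0), (w,0) and
  (0,w), where (v,0) and (0,w) are orthogonal.\<close>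

lemma integral_gauss_pair_inner_mult:
  fixes v w :: "'a::euclidean_space"
  assumes r: "-1 < \<rho>" "\<rho> < 1"
  shows "(\<integral>p. (v \<bullet> fst p) * (w \<bullet> snd p) \<partial>gauss_pair \<rho>) = \<rho> * (v \<bullet> w)"
proof -
  let ?t = "sqrt (1 - \<rho>\<^sup>2)"
  have "(\<integral>p. (v \<bullet> fst p) * (w \<bullet> snd p) \<partial>gauss_pair \<rho>) =
     (\<integral>p. (v \<bullet> fst p) * (w \<bullet> (\<rho> *\<^sub>R fst p + ?t *\<^sub>R snd p)) \<partial>(std_gauss \<Otimes>\<^sub>M std_gauss))"
    unfolding gauss_pair_def by (subst integral_distr) (auto simp: split_beta' borel_prod[symmetric])
  also have "\<dots> = (\<integral>p. \<rho> * ((v, 0) \<bullet> p * ((w, 0) \<bullet> p)) + ?t * ((v, 0) \<bullet> p * ((0, w) \<bullet> p)) \<partial>std_gauss)"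
    unfolding std_gauss_pair_measure
    by (intro Bochner_Integration.integral_cong) (auto simp: inner_prod_def algebra_simps)
  also have "\<dots> = \<rho> * (v \<bullet> w)"
    by (simp add: integral_gauss_inner_mult)
  finally show ?thesis .
qed

section \<open>Calculus of J\<close>

lemma std_gauss_real: "(std_gauss :: real measure) = std_normal_distribution"
  by (simp add: std_gauss_def)

text \<open>Near s the half-line is a fixed ray together with a compact interval, and only the
  interval depends on the endpoint.\<close>

lemma DERIV_integral_atMost:
  fixes f :: "real \<Rightarrow> real"
  assumes cont: "continuous_on UNIV f" and int: "integrable lborel f"
  shows "((\<lambda>s. LINT u:{..s}|lborel. f u) has_real_derivative f s) (at s)"
proof -
  define a b where "a = s - 1" and "b = s + 1"
  have si: "set_integrable lborel S f" if "S \<in> sets borel" for S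
    using int that unfolding set_integrable_def
    by (intro integrable_mult_indicator) auto
  have "((\<lambda>t. integral {a..t} f) has_real_derivative f s) (at s within {a..b})"
    by (rule integral_has_real_derivative) (auto intro: continuous_on_subset[OF cont] simp: a_def b_def)
  then have "((\<lambda>t. integral {a..t} f) has_real_derivative f s) (at s)"
    by (subst (asm) at_within_Icc_at) (auto simp: a_def b_def)
  then have "((\<lambda>t. (LINT u:{..<a}|lborel. f u) + integral {a..t} f) has_real_derivative f s) (at s)"
    by (auto intro!: derivative_eq_intros)
  then show ?thesis
  proof (rule has_field_derivative_transform_within_open)
    show "open {a<..<b}" "s \<in> {a<..<b}" by (auto simp: a_def b_def)
    fix t assume "t \<in> {a<..<b}"
    then have *: "{..t} = {..<a} \<union> {a..t}" by auto
    have "(LINT u:{..t}|lborel. f u) = (LINT u:{..<a}|lborel. f u) + (LINT u:{a..t}|lborel. f u)"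
      unfolding * by (rule set_integral_Un) (auto intro: si)
    then show "(LINT u:{..<a}|lborel. f u) + integral {a..t} f = (LINT u:{..t}|lborel. f u)"
      by (simp add: set_borel_integral_eq_integral(2)[OF si])
  qed
qed

lemma continuous_std_normal_density: "continuous_on S std_normal_density"
  unfolding normal_density_def by (intro continuous_intros) auto

lemma Phi_eq: "Phi t = measure (std_gauss :: real measure) {..t}"
  by (simp add: Phi_def cdf_def std_gauss_real)

lemma measure_std_gauss_real:
  assumes "S \<in> sets borel"
  shows "measure (std_gauss :: real measure) S = (LINT u:S|lborel. std_normal_density u)"
proof -
  have "measure (std_gauss :: real measure) S = (\<integral>x. indicator S x \<partial>(std_gauss :: real measure))"
    using assms by simp
  also have "\<dots> = (LINT u:S|lborel. std_normal_density u)"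
    unfolding std_gauss_real set_lebesgue_integral_def using assms
    by (subst integral_density) (auto simp: mult.commute)
  finally show ?thesis .
qed

lemma DERIV_Phi: "(Phi has_real_derivative std_normal_density t) (at t)"
proof -
  have "Phi = (\<lambda>t. LINT u:{..t}|lborel. std_normal_density u)"
    by (rule ext) (simp add: Phi_eq measure_std_gauss_real)
  then show ?thesis
    using DERIV_integral_atMost[OF continuous_std_normal_density, of t] by simp
qed

lemma DERIV_Phi_chain [derivative_intros]:
  "(f has_real_derivative f') (at x within S) \<Longrightarrow>
   ((\<lambda>x. Phi (f x)) has_real_derivative std_normal_density (f x) * f') (at x within S)"
  by (rule DERIV_chain2[OF DERIV_Phi])

lemma continuous_Phi: "continuous_on S Phi"
  by (meson DERIV_Phi DERIV_continuous_on has_field_derivative_at_within)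

lemma continuous_on_Phi [continuous_intros]:
  "continuous_on S f \<Longrightarrow> continuous_on S (\<lambda>x. Phi (f x))"
  by (rule continuous_on_compose2[OF continuous_Phi, where t=UNIV]) auto

lemma continuous_on_std_normal_density [continuous_intros]:
  "continuous_on S f \<Longrightarrow> continuous_on S (\<lambda>x. std_normal_density (f x))"
  by (rule continuous_on_compose2[OF continuous_std_normal_density, where t=UNIV]) auto

lemma std_normal_density_pos' [simp]: "std_normal_density t > 0"
  by (rule normal_density_pos) simp

lemma density_nz [simp]: "std_normal_density t \<noteq> 0"
  using std_normal_density_pos'[of t] by linarith

lemma Phi_strict_mono: "s < t \<Longrightarrow> Phi s < Phi t"
  by (rule DERIV_pos_imp_increasing) (auto intro: DERIV_Phi std_normal_density_pos')

lemma Phi_less_iff [simp]: "Phi s < Phi t \<longleftrightarrow> s < t"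
  by (metis Phi_strict_mono not_less_iff_gr_or_eq)

lemma Phi_le_iff [simp]: "Phi s \<le> Phi t \<longleftrightarrow> s \<le> t"
  using Phi_less_iff not_less by metis

lemma Phi_eq_iff [simp]: "Phi s = Phi t \<longleftrightarrow> s = t"
  by (metis Phi_less_iff less_irrefl not_less_iff_gr_or_eq)

interpretation normal_distr: real_distribution std_normal_distribution
  by (intro real_distribution.intro prob_space_normal_density real_distribution_axioms.intro) auto

lemma Phi_bounds: "0 < Phi t" "Phi t < 1"
proof -
  have "0 \<le> Phi (t - 1)" "Phi (t + 1) \<le> 1"
    by (auto simp: Phi_eq)
  then show "0 < Phi t" "Phi t < 1"
    using Phi_strict_mono[of "t - 1" t] Phi_strict_mono[of t "t + 1"] by linarith+
qed

lemma Phi_at_top: "(Phi \<longlongrightarrow> 1) at_top"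
  unfolding Phi_def by (rule normal_distr.cdf_lim_at_top_prob)

lemma Phi_at_bot: "(Phi \<longlongrightarrow> 0) at_bot"
  unfolding Phi_def by (rule normal_distr.cdf_lim_at_bot)

text \<open>The real-valued form of \<open>Phi_inv\<close>, suited to differentiation; its values
  carry meaning only for arguments strictly between 0 and 1.\<close>

definition quantile :: "real \<Rightarrow> real" where
  "quantile x = (THE t. Phi t = x)"

lemma Phi_surj: assumes "0 < x" "x < 1" obtains t where "Phi t = x"
proof -
  have "eventually (\<lambda>t. Phi t < x) at_bot" by (rule order_tendstoD(2)[OF Phi_at_bot assms(1)])
  then obtain a where a: "Phi a < x" by (auto simp: eventually_at_bot_linorder)
  have "eventually (\<lambda>t. Phi t > x) at_top" by (rule order_tendstoD(1)[OF Phi_at_top assms(2)])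
  then obtain b where b: "Phi b > x" by (auto simp: eventually_at_top_linorder)
  have "a < b" using a b Phi_less_iff[of a b] by linarith
  then have "\<exists>t\<ge>a. t \<le> b \<and> Phi t = x"
    using a b by (intro IVT') (auto intro: continuous_Phi)
  with that show ?thesis by blast
qed

lemma quantile_Phi [simp]: "quantile (Phi t) = t"
  unfolding quantile_def by (rule the_equality) auto

lemma Phi_quantile [simp]: "0 < x \<Longrightarrow> x < 1 \<Longrightarrow> Phi (quantile x) = x"
  by (erule Phi_surj) auto

lemma isCont_quantile:
  assumes "0 < x" "x < 1" shows "isCont quantile x"
proof -
  obtain t where t: "Phi t = x" using Phi_surj assms by blast
  have "isCont quantile (Phi t)"
    by (rule isCont_inverse_function[where d=1]) (auto intro: DERIV_isCont[OF DERIV_Phi])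
  then show ?thesis by (simp add: t)
qed

lemma DERIV_quantile:
  assumes "0 < x" "x < 1"
  shows "(quantile has_real_derivative 1 / std_normal_density (quantile x)) (at x)"
proof -
  have "(quantile has_real_derivative inverse (std_normal_density (quantile x))) (at x)"
    by (rule DERIV_inverse_function[where f=Phi and a=0 and b=1])
       (use assms in \<open>auto intro: DERIV_Phi isCont_quantile simp: less_imp_neq[OF std_normal_density_pos', symmetric]\<close>)
  then show ?thesis by (simp add: inverse_eq_divide)
qed

lemma DERIV_quantile_chain [derivative_intros]:
  "0 < x \<Longrightarrow> x < 1 \<Longrightarrow> (quantile has_real_derivative 1 / std_normal_density (quantile x)) (at x within S)"
  by (rule has_field_derivative_at_within[OF DERIV_quantile])

lemma Phi_inv_eq: "0 < x \<Longrightarrow> x < 1 \<Longrightarrow> Phi_inv x = ereal (quantile x)"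
  by (simp add: Phi_inv_def quantile_def)

lemma measure_Phi_inv:
  "measure (std_gauss :: real measure) {u. ereal u \<le> Phi_inv x} = max 0 (min 1 x)"
proof -
  consider "x \<le> 0" | "x \<ge> 1" | "0 < x" "x < 1" by linarith
  then show ?thesis
  proof cases
    case 3
    then have "{u. ereal u \<le> Phi_inv x} = {..quantile x}" by (auto simp: Phi_inv_eq)
    then show ?thesis using 3 by (simp add: Phi_eq[symmetric])
  qed (auto simp: Phi_inv_def)
qed

lemma Phi_inv_mono: "x \<le> x' \<Longrightarrow> Phi_inv x \<le> Phi_inv x'"
proof (cases "0 < x \<and> x' < 1")
  case True
  assume "x \<le> x'"
  then have "Phi (quantile x) \<le> Phi (quantile x')" using True by simp
  then show ?thesis using True \<open>x \<le> x'\<close> by (simp add: Phi_inv_eq del: Phi_quantile)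
qed (auto simp: Phi_inv_def)

lemma Phi_inv_sets [measurable]: "{u. ereal u \<le> Phi_inv x} \<in> sets borel"
  by measurable

lemma J_eq: "J x y \<rho> = measure (gauss_pair \<rho>) ({u. ereal u \<le> Phi_inv x} \<times> {v. ereal v \<le> Phi_inv y})"
  unfolding J_def by (rule arg_cong[where f="measure _"]) auto

lemma J_bounds: "0 \<le> J x y \<rho>" "J x y \<rho> \<le> 1"
  by (auto simp: J_def)

lemma Times_borel: "A \<in> sets borel \<Longrightarrow> B \<in> sets borel \<Longrightarrow>
   A \<times> B \<in> sets (borel :: ('a::second_countable_topology \<times> 'b::second_countable_topology) measure)"
  by (metis borel_prod pair_measureI)

section \<open>Lipschitz continuity and derivatives of \<open>J\<close>\<close>

context
  fixes \<rho> :: real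
  assumes r: "-1 < \<rho>" "\<rho> < 1"
begin

lemma J_sym: "J x y \<rho> = J y x \<rho>"
proof -
  let ?A = "{u. ereal u \<le> Phi_inv x}" and ?B = "{u. ereal u \<le> Phi_inv y}"
  have [measurable]: "(\<lambda>p. (snd p, fst p)) \<in> borel_measurable (borel :: (real \<times> real) measure)"
    by (intro borel_measurable_continuous_onI continuous_intros)
  have "J x y \<rho> = measure (distr (gauss_pair \<rho>) borel (\<lambda>p. (snd p, fst p))) (?A \<times> ?B)"
    by (simp add: J_eq gauss_pair_swap[OF r])
  also have "\<dots> = measure (gauss_pair \<rho>) ((\<lambda>p. (snd p, fst p)) -` (?A \<times> ?B))"
    by (subst measure_distr) (auto intro!: Times_borel simp del: vimage_Times)
  also have "(\<lambda>p. (snd p, fst p)) -` (?A \<times> ?B) = ?B \<times> ?A" by auto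
  finally show ?thesis by (simp add: J_eq)
qed

text \<open>The difference is the probability of part of a vertical strip. The whole strip has, by
  the standard Gaussian marginal, the mass of the interval from x to x' clamped to [0,1]. Thus the
  bound holds up to the edges of the square, where the derivatives are of no use.\<close>

lemma J_lipschitz_left: "\<bar>J x y \<rho> - J x' y \<rho>\<bar> \<le> \<bar>x - x'\<bar>"
proof -
  have main: "\<bar>J x y \<rho> - J x' y \<rho>\<bar> \<le> \<bar>x - x'\<bar>" if "x \<le> x'" for x x'
  proof -
    let ?A = "{u. ereal u \<le> Phi_inv x}" and ?A' = "{u. ereal u \<le> Phi_inv x'}" and ?B = "{u. ereal u \<le> Phi_inv y}"
    have sub: "?A \<subseteq> ?A'" using Phi_inv_mono[OF that] by (auto intro: order_trans)
    have "J x' y \<rho> - J x y \<rho> = measure (gauss_pair \<rho>) (?A' \<times> ?B - ?A \<times> ?B)"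
      unfolding J_eq by (rule gauss_pair.finite_measure_Diff[symmetric]) (use sub in \<open>auto intro: Times_borel\<close>)
    also have "\<dots> \<le> measure (gauss_pair \<rho>) (fst -` (?A' - ?A))"
      by (rule gauss_pair.finite_measure_mono)
         (auto intro!: measurable_sets_borel[OF _ sets.Diff[OF Phi_inv_sets Phi_inv_sets]] borel_measurable_continuous_onI continuous_intros)
    also have "\<dots> = measure (distr (gauss_pair \<rho>) borel fst) (?A' - ?A)"
      by (subst measure_distr) auto
    also have "\<dots> = measure std_gauss ?A' - measure std_gauss ?A"
      unfolding gauss_pair_fst by (rule std_gauss.finite_measure_Diff) (use sub in auto)
    also have "\<dots> \<le> x' - x" using that by (simp add: measure_Phi_inv)
    finally have "J x' y \<rho> - J x y \<rho> \<le> x' - x" .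
    moreover have "J x y \<rho> \<le> J x' y \<rho>"
      unfolding J_eq by (rule gauss_pair.finite_measure_mono) (use sub in \<open>auto intro: Times_borel\<close>)
    ultimately show ?thesis using that by linarith
  qed
  show ?thesis using main[of x x'] main[of x' x] by linarith
qed

lemma J_lipschitz: "\<bar>J x y \<rho> - J x' y' \<rho>\<bar> \<le> \<bar>x - x'\<bar> + \<bar>y - y'\<bar>"
  using J_lipschitz_left[of x y x'] J_lipschitz_left[of y x' y'] J_sym[of x' y] J_sym[of x' y'] by linarith

lemma continuous_J: "continuous_on S (\<lambda>p. J (fst p) (snd p) \<rho>)"
proof (rule continuous_on_subset[of UNIV])
  show "continuous_on UNIV (\<lambda>p. J (fst p) (snd p) \<rho>)"
  proof (subst continuous_on_iff, intro ballI allI impI)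
    fix p :: "real \<times> real" and e :: real assume "e > 0"
    have "dist (J (fst p') (snd p') \<rho>) (J (fst p) (snd p) \<rho>) < e" if "dist p' p < e / 2" for p'
      using J_lipschitz[of "fst p'" "snd p'" "fst p" "snd p"] dist_fst_le[of p' p] dist_snd_le[of p' p] that
      by (auto simp: dist_real_def)
    with \<open>e > 0\<close> show "\<exists>d>0. \<forall>p'\<in>UNIV. dist p' p < d \<longrightarrow> dist (J (fst p') (snd p') \<rho>) (J (fst p) (snd p) \<rho>) < e"
      by (intro exI[of _ "e/2"]) auto
  qed
qed auto

lemma borel_measurable_J [measurable (raw)]:
  assumes [measurable]: "f \<in> borel_measurable M" "g \<in> borel_measurable M"
  shows "(\<lambda>x. J (f x) (g x) \<rho>) \<in> borel_measurable M"
proof -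
  have "(\<lambda>p. J (fst p) (snd p) \<rho>) \<in> borel_measurable borel"
    by (intro borel_measurable_continuous_onI continuous_J)
  from measurable_compose[OF _ this, of "\<lambda>x. (f x, g x)" M] show ?thesis
    by simp
qed

text \<open>The standard deviation of one coordinate of the pair when the other is given.\<close>

definition tau where "tau = sqrt (1 - \<rho>\<^sup>2)"

lemma tau: "tau > 0" "tau\<^sup>2 = 1 - \<rho>\<^sup>2"
proof -
  have "\<rho>\<^sup>2 < 1" using r by (simp add: abs_square_less_1)
  then show "tau > 0" "tau\<^sup>2 = 1 - \<rho>\<^sup>2" by (auto simp: tau_def)
qed

text \<open>\<open>J\<close> in threshold coordinates: the bivariate normal distribution
  function.\<close>

definition bvn :: "real \<Rightarrow> real \<Rightarrow> real" where
  "bvn s t = measure (gauss_pair \<rho>) ({..s} \<times> {..t})"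

lemma J_bvn: "0 < x \<Longrightarrow> x < 1 \<Longrightarrow> 0 < y \<Longrightarrow> y < 1 \<Longrightarrow> J x y \<rho> = bvn (quantile x) (quantile y)"
  unfolding J_eq bvn_def by (rule arg_cong[where f="measure _"]) (auto simp: Phi_inv_eq)

text \<open>Conditioning on the first coordinate u: the second is \<rho> u + tau z, so it is at most
  t exactly when z is at most (t - \<rho> u) / tau.\<close>

lemma bvn_integral:
  "bvn s t = (LINT u:{..s}|lborel. std_normal_density u * Phi ((t - \<rho> * u) / tau))"
proof -
  have [measurable]: "Phi \<in> borel_measurable borel"
    by (intro borel_measurable_continuous_onI continuous_Phi)
  have "bvn s t = (\<integral>p. indicator ({..s} \<times> {..t}) p \<partial>(gauss_pair \<rho> :: (real \<times> real) measure))"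
    by (simp add: bvn_def Times_borel)
  also have "\<dots> = (\<integral>p. indicator {..s} (fst p) * indicator {..(t - \<rho> * fst p) / tau} (snd p)
       \<partial>(std_gauss \<Otimes>\<^sub>M std_gauss :: (real \<times> real) measure))"
    unfolding gauss_pair_def
    using tau by (subst integral_distr)
       (auto simp: split_beta' borel_prod[symmetric] indicator_def tau_def[symmetric] field_simps
         intro!: Bochner_Integration.integral_cong)
  also have "\<dots> = (\<integral>x. \<integral>z. indicator {..s} x * indicator {..(t - \<rho> * x) / tau} z \<partial>std_gauss \<partial>std_gauss)"
    by (subst std_gauss_pair.integral_fst'[symmetric])
       (auto intro!: std_gauss_pair.integrable_const_bound[where B=1] simp: indicator_def)
  also have "\<dots> = (\<integral>x. indicator {..s} x * Phi ((t - \<rho> * x) / tau) \<partial>std_gauss)"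
    by (simp add: Phi_eq)
  also have "\<dots> = (LINT u:{..s}|lborel. std_normal_density u * Phi ((t - \<rho> * u) / tau))"
    unfolding std_gauss_real set_lebesgue_integral_def
    by (subst integral_density) (auto simp: mult_ac)
  finally show ?thesis .
qed

lemma DERIV_bvn: "((\<lambda>s. bvn s t) has_real_derivative std_normal_density s * Phi ((t - \<rho> * s) / tau)) (at s)"
  unfolding bvn_integral
proof (rule DERIV_integral_atMost)
  show c: "continuous_on UNIV (\<lambda>u. std_normal_density u * Phi ((t - \<rho> * u) / tau))"
    using tau by (intro continuous_intros) auto
  show "integrable lborel (\<lambda>u. std_normal_density u * Phi ((t - \<rho> * u) / tau))"
  proof (rule Bochner_Integration.integrable_bound)
    show "integrable lborel std_normal_density" by simp
    show "(\<lambda>u. std_normal_density u * Phi ((t - \<rho> * u) / tau)) \<in> borel_measurable lborel"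
      using borel_measurable_continuous_onI[OF c] by simp
  qed (use Phi_bounds in \<open>auto intro!: AE_I2 mult_left_le simp: abs_mult less_imp_le\<close>)
qed

text \<open>The conditional probability that Y stays below its threshold when X sits at its own.
  Since \<open>J\<close> is symmetric, derivatives in the second argument are these functions with
  the arguments exchanged, such as \<open>Jx y x\<close> and \<open>Jxx y x\<close>.\<close>

definition Jx :: "real \<Rightarrow> real \<Rightarrow> real" where
  "Jx x y = Phi ((quantile y - \<rho> * quantile x) / tau)"
definition Jxx :: "real \<Rightarrow> real \<Rightarrow> real" where
  "Jxx x y = - (\<rho> / tau) * std_normal_density ((quantile y - \<rho> * quantile x) / tau) / std_normal_density (quantile x)"
definition Jxy :: "real \<Rightarrow> real \<Rightarrow> real" where
  "Jxy x y = 1 / tau * std_normal_density ((quantile y - \<rho> * quantile x) / tau) / std_normal_density (quantile y)"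

context
  fixes x y :: real
  assumes xy: "0 < x" "x < 1" "0 < y" "y < 1"
begin

lemma DERIV_J_left: "((\<lambda>x. J x y \<rho>) has_real_derivative Jx x y) (at x)"
proof (rule has_field_derivative_transform_within_open[where S="{0<..<1}"])
  show "((\<lambda>x. bvn (quantile x) (quantile y)) has_real_derivative Jx x y) (at x)"
    using DERIV_chain2[OF DERIV_bvn DERIV_quantile[OF xy(1,2)], of "quantile y"]
    by (simp add: Jx_def)
qed (use xy in \<open>auto simp: J_bvn\<close>)

lemma DERIV_Jx_left: "((\<lambda>x. Jx x y) has_real_derivative Jxx x y) (at x)"
  unfolding Jx_def Jxx_def using xy tau
  by (auto intro!: derivative_eq_intros simp: field_simps)

lemma DERIV_Jx_right: "((\<lambda>y. Jx x y) has_real_derivative Jxy x y) (at y)"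
  unfolding Jx_def Jxy_def using xy tau
  by (auto intro!: derivative_eq_intros simp: field_simps)

end

lemma DERIV_J_right:
  assumes xy: "0 < x" "x < 1" "0 < y" "y < 1"
  shows "((\<lambda>y. J x y \<rho>) has_real_derivative Jx y x) (at y)"
  using DERIV_J_left[of y x] xy by (simp add: J_sym[of x])

text \<open>The Hessian of \<open>J\<close> with off-diagonal terms scaled by \<open>\<rho>\<close> is degenerate, hence a signed square.\<close>

definition Jquad :: "real \<Rightarrow> real \<Rightarrow> 'a::euclidean_space \<Rightarrow> 'a \<Rightarrow> real" where
  "Jquad x y p r = Jxx x y * (p \<bullet> p) + 2 * \<rho> * Jxy x y * (p \<bullet> r) + Jxx y x * (r \<bullet> r)"

text \<open>Up to the factor 1 / tau, both sides are the joint density at (s, t), factored as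
  marginal times conditional density in the two possible orders.\<close>

lemma density_exchange:
  "std_normal_density ((t - \<rho> * s) / tau) * std_normal_density s =
   std_normal_density ((s - \<rho> * t) / tau) * std_normal_density t"
proof -
  have nz: "1 - \<rho> * \<rho> \<noteq> 0" using tau by (auto simp: power2_eq_square)
  have "- ((t - \<rho> * s) / tau)\<^sup>2 / 2 + - s\<^sup>2 / 2 = - ((s - \<rho> * t) / tau)\<^sup>2 / 2 + - t\<^sup>2 / 2"
    unfolding power_divide tau(2) using nz
    by (simp add: power2_eq_square divide_simps) (simp add: algebra_simps)
  then show ?thesis
    unfolding std_normal_density_def by (simp add: exp_add[symmetric])
qed

text \<open>The factor \<rho> in the mixed term is the covariance of X and Y. With a, b the
  densities at the two quantiles and k the conditional density, the coefficients of p.p and p.r are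
  -(\<rho> / tau) k / a and 2 (\<rho> / tau) k / b; \<open>density_exchange\<close> turns the
  coefficient of r.r into -(\<rho> / tau) k a / b^2, which completes the square.\<close>

lemma Jquad_eq:
  "Jquad x y p r = - (\<rho> / tau) *
     (std_normal_density ((quantile y - \<rho> * quantile x) / tau) * std_normal_density (quantile x)) *
     (norm (p /\<^sub>R std_normal_density (quantile x) - r /\<^sub>R std_normal_density (quantile y)))\<^sup>2"
proof -
  define a b k where "a = std_normal_density (quantile x)" and "b = std_normal_density (quantile y)"
    and "k = std_normal_density ((quantile y - \<rho> * quantile x) / tau)"
  define k' where "k' = std_normal_density ((quantile x - \<rho> * quantile y) / tau)"
  have nz: "a \<noteq> 0" "b \<noteq> 0" by (simp_all add: a_def b_def)
  have kk: "k' = k * a / b"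
    using density_exchange[of "quantile y" "quantile x"] nz by (simp add: a_def b_def k_def k'_def field_simps)
  show ?thesis
    unfolding Jquad_def Jxx_def Jxy_def a_def[symmetric] b_def[symmetric] k_def[symmetric] k'_def[symmetric] kk
      power2_norm_eq_inner
    using nz tau by (simp add: inner_diff inner_commute field_simps)
qed

end

section \<open>Taylor expansion of \<open>J\<close>, uniform away from the edges of the
  square\<close>

lemma taylor2:
  fixes f f' f'' :: "real \<Rightarrow> real"
  assumes "\<And>t. a \<le> t \<Longrightarrow> t \<le> b \<Longrightarrow> (f has_real_derivative f' t) (at t)"
    and "\<And>t. a \<le> t \<Longrightarrow> t \<le> b \<Longrightarrow> (f' has_real_derivative f'' t) (at t)"
    and "a \<le> c" "c \<le> b" "a \<le> x" "x \<le> b"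
  shows "\<exists>t. \<bar>t - c\<bar> \<le> \<bar>x - c\<bar> \<and> f x = f c + f' c * (x - c) + f'' t / 2 * (x - c)\<^sup>2"
proof (cases "x = c")
  case False
  have "\<exists>t. (if x < c then x < t \<and> t < c else c < t \<and> t < x) \<and>
    f x = (\<Sum>m<2. (\<lambda>n. if n = 0 then f else if n = 1 then f' else f'') m c / fact m * (x - c) ^ m) +
      (\<lambda>n::nat. if n = 0 then f else if n = 1 then f' else f'') 2 t / fact 2 * (x - c) ^ 2"
    by (rule Taylor[where a=a and b=b]) (use assms False in \<open>auto simp: less_2_cases_iff\<close>)
  then obtain t where "if x < c then x < t \<and> t < c else c < t \<and> t < x"
    "f x = f c + f' c * (x - c) + f'' t / 2 * (x - c)\<^sup>2"
    by (auto simp: numeral_2_eq_2)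
  then show ?thesis by (intro exI[of _ t]) (auto split: if_splits)
qed (intro exI[of _ c], simp)

lemma taylor1:
  fixes f f' :: "real \<Rightarrow> real"
  assumes "\<And>t. a \<le> t \<Longrightarrow> t \<le> b \<Longrightarrow> (f has_real_derivative f' t) (at t)"
    and "a \<le> c" "c \<le> b" "a \<le> x" "x \<le> b"
  shows "\<exists>t. \<bar>t - c\<bar> \<le> \<bar>x - c\<bar> \<and> f x = f c + f' t * (x - c)"
proof -
  consider "x = c" | "x < c" | "c < x" by linarith
  then show ?thesis
  proof cases
    case 2
    then obtain z where "x < z" "z < c" "f c - f x = (c - x) * f' z"
      using MVT2[of x c f f'] assms by (metis less_le_trans less_imp_le order_trans)
    then show ?thesis by (intro exI[of _ z]) (auto simp: algebra_simps)
  next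
    case 3
    then obtain z where "c < z" "z < x" "f x - f c = (x - c) * f' z"
      using MVT2[of c x f f'] assms by (metis less_le_trans less_imp_le order_trans)
    then show ?thesis by (intro exI[of _ z]) (auto simp: algebra_simps)
  qed auto
qed

lemma uniformly_continuous_square:
  fixes F :: "real \<Rightarrow> real \<Rightarrow> real"
  assumes "continuous_on ({a..b} \<times> {a..b}) (\<lambda>p. F (fst p) (snd p))" "\<eta> > 0"
  shows "\<exists>d>0. \<forall>x\<in>{a..b}. \<forall>y\<in>{a..b}. \<forall>x'\<in>{a..b}. \<forall>y'\<in>{a..b}.
    \<bar>x' - x\<bar> < d \<longrightarrow> \<bar>y' - y\<bar> < d \<longrightarrow> \<bar>F x' y' - F x y\<bar> \<le> \<eta>"
proof -
  have "uniformly_continuous_on ({a..b} \<times> {a..b}) (\<lambda>p. F (fst p) (snd p))"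
    by (rule compact_uniformly_continuous) (use assms in \<open>auto intro: compact_Times\<close>)
  then obtain d where d: "d > 0" "\<And>p p'. p \<in> {a..b} \<times> {a..b} \<Longrightarrow> p' \<in> {a..b} \<times> {a..b} \<Longrightarrow>
      dist p' p < d \<Longrightarrow> dist (F (fst p') (snd p')) (F (fst p) (snd p)) < \<eta>"
    unfolding uniformly_continuous_on_def using assms(2) by metis
  have "\<bar>F x' y' - F x y\<bar> \<le> \<eta>"
    if "x\<in>{a..b}" "y\<in>{a..b}" "x'\<in>{a..b}" "y'\<in>{a..b}" "\<bar>x' - x\<bar> < d / 2" "\<bar>y' - y\<bar> < d / 2" for x y x' y'
  proof -
    have "dist (x', y') (x, y) \<le> \<bar>x' - x\<bar> + \<bar>y' - y\<bar>"
      unfolding dist_Pair_Pair dist_real_def by (rule sqrt_sum_squares_le_sum_abs[THEN order_trans]) simp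
    then have "dist (x', y') (x, y) < d" using that by linarith
    from d(2)[OF _ _ this] that show ?thesis by (auto simp: dist_real_def)
  qed
  then show ?thesis using d(1) by (intro exI[of _ "d/2"]) auto
qed

context
  fixes \<rho> :: real
  assumes r: "-1 < \<rho>" "\<rho> < 1"
begin

lemma continuous_on_quantile: "S \<subseteq> {0<..<1} \<Longrightarrow> continuous_on S quantile"
  by (intro continuous_at_imp_continuous_on ballI isCont_quantile) auto

lemma continuous_on_quantile_comp [continuous_intros]:
  "continuous_on S f \<Longrightarrow> (\<And>x. x \<in> S \<Longrightarrow> 0 < f x \<and> f x < 1) \<Longrightarrow> continuous_on S (\<lambda>x. quantile (f x))"
  by (rule continuous_on_compose2[OF continuous_on_quantile[OF order_refl]]) auto

lemma continuous_Jxx: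
  assumes "a > 0" "b < 1"
  shows "continuous_on ({a..b} \<times> {a..b}) (\<lambda>p. Jxx \<rho> (fst p) (snd p))"
    and "continuous_on ({a..b} \<times> {a..b}) (\<lambda>p. Jxy \<rho> (fst p) (snd p))"
  unfolding Jxx_def[OF r] Jxy_def[OF r] using assms tau[OF r]
  by (auto intro!: continuous_intros)

lemma Jxx_bounded:
  assumes "e > 0" obtains M where "M \<ge> 0"
    "\<And>x y. x \<in> {e..1-e} \<Longrightarrow> y \<in> {e..1-e} \<Longrightarrow> \<bar>Jxx \<rho> x y\<bar> \<le> M \<and> \<bar>Jxy \<rho> x y\<bar> \<le> M"
proof -
  have "compact ({e..1-e} \<times> {e..1-e})" by (intro compact_Times) auto
  then have "bounded ((\<lambda>p. Jxx \<rho> (fst p) (snd p)) ` ({e..1-e} \<times> {e..1-e}))"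
    "bounded ((\<lambda>p. Jxy \<rho> (fst p) (snd p)) ` ({e..1-e} \<times> {e..1-e}))"
    using assms by (auto intro!: compact_imp_bounded compact_continuous_image continuous_Jxx)
  then obtain M1 M2 where "\<forall>z\<in>(\<lambda>p. Jxx \<rho> (fst p) (snd p)) ` ({e..1-e} \<times> {e..1-e}). norm z \<le> M1"
     "\<forall>z\<in>(\<lambda>p. Jxy \<rho> (fst p) (snd p)) ` ({e..1-e} \<times> {e..1-e}). norm z \<le> M2"
    unfolding bounded_iff by blast
  then show ?thesis
    by (intro that[of "max 0 (max M1 M2)"]) (auto simp: le_max_iff_disj)
qed

lemma Jx_bounds: "\<bar>Jx \<rho> x y\<bar> \<le> 1"
  using Phi_bounds[of "(quantile y - \<rho> * quantile x) / tau \<rho>"] by (simp add: Jx_def[OF r])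

definition Jrem :: "real \<Rightarrow> real \<Rightarrow> real \<Rightarrow> real \<Rightarrow> real" where
  "Jrem x y u v = J (x + u) (y + v) \<rho> - J x y \<rho> - Jx \<rho> x y * u - Jx \<rho> y x * v -
     (Jxx \<rho> x y * u\<^sup>2 + 2 * Jxy \<rho> x y * (u * v) + Jxx \<rho> y x * v\<^sup>2) / 2"

text \<open>One bound for all increments that stay in the unit square. Small increments are governed
  by the uniform continuity of the second derivatives on a slightly larger square, which needs no
  third derivatives; for large ones a crude bound on the remainder is absorbed by the cubic term, so
  nothing has to be known about derivatives near the edges.\<close>

lemma J_taylor:
  assumes e: "0 < e" and eta: "\<eta> > 0"
  obtains C where "C \<ge> 0"
    "\<And>x y u v. x \<in> {e..1-e} \<Longrightarrow> y \<in> {e..1-e} \<Longrightarrow> x + u \<in> {0..1} \<Longrightarrow> y + v \<in> {0..1} \<Longrightarrow>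
      \<bar>Jrem x y u v\<bar> \<le> \<eta> * (u\<^sup>2 + v\<^sup>2) + C * (\<bar>u\<bar> ^ 3 + \<bar>v\<bar> ^ 3)"
proof -
  let ?I = "{e/2..1-e/2}"
  obtain d1 where d1: "d1 > 0" "\<forall>x\<in>?I. \<forall>y\<in>?I. \<forall>x'\<in>?I. \<forall>y'\<in>?I.
    \<bar>x' - x\<bar> < d1 \<longrightarrow> \<bar>y' - y\<bar> < d1 \<longrightarrow> \<bar>Jxx \<rho> x' y' - Jxx \<rho> x y\<bar> \<le> \<eta>"
    using uniformly_continuous_square[OF continuous_Jxx(1) eta, of "e/2" "1-e/2"] e by auto
  obtain d2 where d2: "d2 > 0" "\<forall>x\<in>?I. \<forall>y\<in>?I. \<forall>x'\<in>?I. \<forall>y'\<in>?I.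
    \<bar>x' - x\<bar> < d2 \<longrightarrow> \<bar>y' - y\<bar> < d2 \<longrightarrow> \<bar>Jxy \<rho> x' y' - Jxy \<rho> x y\<bar> \<le> \<eta>"
    using uniformly_continuous_square[OF continuous_Jxx(2) eta, of "e/2" "1-e/2"] e by auto
  obtain M where M: "M \<ge> 0" "\<And>x y. x \<in> {e..1-e} \<Longrightarrow> y \<in> {e..1-e} \<Longrightarrow> \<bar>Jxx \<rho> x y\<bar> \<le> M \<and> \<bar>Jxy \<rho> x y\<bar> \<le> M"
    using Jxx_bounded e by blast
  \<comment> \<open>The bound e/2 keeps points within d of [e, 1-e] inside [e/2, 1-e/2].\<close>
  define d where "d = min (min d1 d2) (e/2)"
  have d: "d > 0" "d \<le> d1" "d \<le> d2" "d \<le> e/2" using d1(1) d2(1) e by (auto simp: d_def)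
  \<comment> \<open>The remainder is at most 3 + 2 M in absolute value: 1 for the difference of
    \<open>J\<close>, 1 for each linear term, and (M + 2 M + M) / 2 for the quadratic part. If an
    increment reaches d, this is at most C times its cube.\<close>
  define C where "C = (3 + 2 * M) / d ^ 3"
  show ?thesis
  proof (rule that[of C])
    show "C \<ge> 0" using M d by (simp add: C_def)
    fix x y u v
    assume x: "x \<in> {e..1-e}" and y: "y \<in> {e..1-e}" and xu: "x + u \<in> {0..1}" and yv: "y + v \<in> {0..1}"
    show "\<bar>Jrem x y u v\<bar> \<le> \<eta> * (u\<^sup>2 + v\<^sup>2) + C * (\<bar>u\<bar> ^ 3 + \<bar>v\<bar> ^ 3)"
    proof (cases "\<bar>u\<bar> < d \<and> \<bar>v\<bar> < d")
      case True
      have I: "x + s \<in> ?I" "y + s \<in> ?I" if "\<bar>s\<bar> < d" for s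
        using x y d that by auto
      have I01: "0 < z \<and> z < 1" if "z \<in> ?I" for z using that e by auto
      have xI: "x \<in> ?I" and yI: "y \<in> ?I" using I[of 0] d by auto
      \<comment> \<open>The path goes from (x, y) to (x, y + v) to (x + u, y + v). Each leg is
        expanded to second order in one variable, and the coefficient \<open>Jx x (y + v)\<close> is
        then carried back to (x, y) by the mean value theorem, which produces the mixed
        term.\<close>
      have "\<exists>t. \<bar>t - x\<bar> \<le> \<bar>(x + u) - x\<bar> \<and> J (x + u) (y + v) \<rho> = J x (y + v) \<rho> + Jx \<rho> x (y + v) * ((x + u) - x) + Jxx \<rho> t (y + v) / 2 * ((x + u) - x)\<^sup>2"
        by (rule taylor2[where a="e/2" and b="1-e/2" and f="\<lambda>x. J x (y+v) \<rho>"])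
           (use I[of u] I[of v] I01 xI True e in \<open>auto intro!: DERIV_J_left[OF r] DERIV_Jx_left[OF r]\<close>)
      then obtain t1 where t1: "\<bar>t1 - x\<bar> \<le> \<bar>u\<bar>"
        "J (x + u) (y + v) \<rho> = J x (y + v) \<rho> + Jx \<rho> x (y + v) * u + Jxx \<rho> t1 (y + v) / 2 * u\<^sup>2" by auto
      have "\<exists>t. \<bar>t - y\<bar> \<le> \<bar>(y + v) - y\<bar> \<and> J x (y + v) \<rho> = J x y \<rho> + Jx \<rho> y x * ((y + v) - y) + Jxx \<rho> t x / 2 * ((y + v) - y)\<^sup>2"
        by (rule taylor2[where a="e/2" and b="1-e/2" and f="\<lambda>y. J x y \<rho>"])
           (use I[of u] I[of v] I01 xI yI True e in \<open>auto intro!: DERIV_J_right[OF r] DERIV_Jx_left[OF r]\<close>)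
      then obtain t2 where t2: "\<bar>t2 - y\<bar> \<le> \<bar>v\<bar>"
        "J x (y + v) \<rho> = J x y \<rho> + Jx \<rho> y x * v + Jxx \<rho> t2 x / 2 * v\<^sup>2" by auto
      have "\<exists>t. \<bar>t - y\<bar> \<le> \<bar>(y + v) - y\<bar> \<and> Jx \<rho> x (y + v) = Jx \<rho> x y + Jxy \<rho> x t * ((y + v) - y)"
        by (rule taylor1[where a="e/2" and b="1-e/2" and f="\<lambda>y. Jx \<rho> x y"])
           (use I[of u] I[of v] I01 xI yI True e in \<open>auto intro!: DERIV_Jx_right[OF r]\<close>)
      then obtain t3 where t3: "\<bar>t3 - y\<bar> \<le> \<bar>v\<bar>"
        "Jx \<rho> x (y + v) = Jx \<rho> x y + Jxy \<rho> x t3 * v" by auto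
      have tI: "t1 \<in> ?I" "t2 \<in> ?I" "t3 \<in> ?I"
        using I(1)[of "t1 - x"] I(2)[of "t2 - y"] I(2)[of "t3 - y"] t1(1) t2(1) t3(1) True by auto
      define a where "a = Jxx \<rho> t1 (y + v) - Jxx \<rho> x y"
      define b where "b = Jxy \<rho> x t3 - Jxy \<rho> x y"
      define c where "c = Jxx \<rho> t2 x - Jxx \<rho> y x"
      have a: "\<bar>a\<bar> \<le> \<eta>" unfolding a_def
        using d1(2) tI(1) xI yI I(2)[of v] True t1(1) d by auto
      have b: "\<bar>b\<bar> \<le> \<eta>" unfolding b_def
        using d2(2) tI(3) xI yI True t3(1) d by auto
      have c: "\<bar>c\<bar> \<le> \<eta>" unfolding c_def
        using d1(2) tI(2) xI yI True t2(1) d by auto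
      have "Jrem x y u v = a / 2 * u\<^sup>2 + b * (u * v) + c / 2 * v\<^sup>2"
        unfolding Jrem_def t1(2) t2(2) t3(2) a_def b_def c_def
        by (simp add: field_simps power2_eq_square)
      also have "\<bar>\<dots>\<bar> \<le> \<bar>a / 2 * u\<^sup>2\<bar> + \<bar>b * (u * v)\<bar> + \<bar>c / 2 * v\<^sup>2\<bar>" by linarith
      also have "\<dots> = \<bar>a\<bar> * (u\<^sup>2 / 2) + \<bar>b\<bar> * \<bar>u * v\<bar> + \<bar>c\<bar> * (v\<^sup>2 / 2)"
        by (simp add: abs_mult)
      also have "\<dots> \<le> \<eta> * (u\<^sup>2 / 2) + \<eta> * \<bar>u * v\<bar> + \<eta> * (v\<^sup>2 / 2)"
        using a b c by (intro add_mono mult_right_mono) auto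
      also have "\<dots> = \<eta> * (u\<^sup>2 / 2 + \<bar>u * v\<bar> + v\<^sup>2 / 2)" by (simp add: algebra_simps)
      also have "\<dots> \<le> \<eta> * (u\<^sup>2 + v\<^sup>2)"
      proof (rule mult_left_mono)
        have "0 \<le> (\<bar>u\<bar> - \<bar>v\<bar>)\<^sup>2" by simp
        then show "u\<^sup>2 / 2 + \<bar>u * v\<bar> + v\<^sup>2 / 2 \<le> u\<^sup>2 + v\<^sup>2"
          by (simp add: power2_diff abs_mult)
      qed (use eta in simp)
      also have "\<dots> \<le> \<eta> * (u\<^sup>2 + v\<^sup>2) + C * (\<bar>u\<bar> ^ 3 + \<bar>v\<bar> ^ 3)"
        using \<open>C \<ge> 0\<close> by simp
      finally show ?thesis .
    next
      case False
      have u1: "\<bar>u\<bar> \<le> 1" and v1: "\<bar>v\<bar> \<le> 1" using x y xu yv e by auto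
      have sq: "u\<^sup>2 \<le> 1" "v\<^sup>2 \<le> 1" "\<bar>u * v\<bar> \<le> 1"
        using u1 v1 by (auto simp: abs_square_le_1 abs_mult mult_le_one)
      have aux: "\<bar>k * w\<bar> \<le> M" if "\<bar>k\<bar> \<le> M" "\<bar>w\<bar> \<le> 1" for k w
        using mult_mono[of "\<bar>k\<bar>" M "\<bar>w\<bar>" 1] that M(1) by (simp add: abs_mult)
      have "\<bar>Jxx \<rho> x y * u\<^sup>2\<bar> \<le> M * 1" "\<bar>Jxy \<rho> x y * (u * v)\<bar> \<le> M * 1" "\<bar>Jxx \<rho> y x * v\<^sup>2\<bar> \<le> M * 1"
        using M(2)[OF x y] M(2)[OF y x] sq aux by auto
      moreover have "\<bar>Jx \<rho> x y * u\<bar> \<le> 1 * 1" "\<bar>Jx \<rho> y x * v\<bar> \<le> 1 * 1"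
        unfolding abs_mult using u1 v1 Jx_bounds by (auto intro: mult_le_one)
      moreover have "\<bar>J (x + u) (y + v) \<rho> - J x y \<rho>\<bar> \<le> 1"
        using J_bounds[of "x+u" "y+v" \<rho>] J_bounds[of x y \<rho>] by linarith
      moreover have "\<bar>j - a - b - (c + 2 * d + f) / 2\<bar> \<le> 3 + 2 * M"
        if "\<bar>c\<bar> \<le> M * 1" "\<bar>d\<bar> \<le> M * 1" "\<bar>f\<bar> \<le> M * 1" "\<bar>a\<bar> \<le> 1 * 1" "\<bar>b\<bar> \<le> 1 * 1" "\<bar>j\<bar> \<le> 1"
        for j a b c d f :: real using that by (auto simp: abs_le_iff add_divide_distrib)
      ultimately have "\<bar>Jrem x y u v\<bar> \<le> 3 + 2 * M"
        unfolding Jrem_def mult.assoc by blast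
      also have "\<dots> = C * d ^ 3" using d by (simp add: C_def)
      also have "\<dots> \<le> C * (\<bar>u\<bar> ^ 3 + \<bar>v\<bar> ^ 3)"
      proof (rule mult_left_mono)
        from False have "d \<le> \<bar>u\<bar> \<or> d \<le> \<bar>v\<bar>" by linarith
        then have "d ^ 3 \<le> \<bar>u\<bar> ^ 3 \<or> d ^ 3 \<le> \<bar>v\<bar> ^ 3" using d power_mono[of d] by auto
        then show "d ^ 3 \<le> \<bar>u\<bar> ^ 3 + \<bar>v\<bar> ^ 3"
          using zero_le_power[of "\<bar>u\<bar>" 3] zero_le_power[of "\<bar>v\<bar>" 3] by linarith
      qed fact
      also have "\<dots> \<le> \<eta> * (u\<^sup>2 + v\<^sup>2) + C * (\<bar>u\<bar> ^ 3 + \<bar>v\<bar> ^ 3)"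
        using eta by simp
      finally show ?thesis .
    qed
  qed
qed

end

section \<open>Second-order expansion of the deficit\<close>

definition deficit :: "real \<Rightarrow> ('a::euclidean_space \<Rightarrow> real) \<Rightarrow> ('a \<Rightarrow> real) \<Rightarrow> real" where
  "deficit \<rho> f g = sgn \<rho> * (J (\<integral>x. f x \<partial>std_gauss) (\<integral>x. g x \<partial>std_gauss) \<rho> -
     (\<integral>p. J (f (fst p)) (g (snd p)) \<rho> \<partial>gauss_pair \<rho>))"

text \<open>
  The gradient is normalised as \<open>l p\<close> so that passing from \<open>f\<close> to \<open>f (c \<cdot>)\<close> changes \<open>l\<close> to \<open>c l\<close> and keeps \<open>P\<close>.
\<close>

definition C11 :: "real \<Rightarrow> real \<Rightarrow> ('a::euclidean_space \<Rightarrow> real) \<Rightarrow> ('a \<Rightarrow> 'a) \<Rightarrow> bool" where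
  "C11 l P f p \<longleftrightarrow> f \<in> borel_measurable borel \<and> p \<in> borel_measurable borel \<and>
     (\<forall>x. f x \<in> {0..1}) \<and> (\<forall>x. norm (p x) \<le> P) \<and>
     (\<forall>x u. \<bar>f (x + u) - f x - l * (p x \<bullet> u)\<bar> \<le> l\<^sup>2 * P * (u \<bullet> u))"

lemma C11_D:
  assumes "C11 l P f p"
  shows "f \<in> borel_measurable borel" "p \<in> borel_measurable borel" "0 \<le> f x" "f x \<le> 1"
    "norm (p x) \<le> P" "\<bar>f (x + u) - f x - l * (p x \<bullet> u)\<bar> \<le> l\<^sup>2 * P * (u \<bullet> u)"
  using assms by (auto simp: C11_def)

lemma C11_shift:
  assumes "C11 l P f p"
  shows "C11 (c * l) P (\<lambda>z. f (x + c *\<^sub>R z)) (\<lambda>z. p (x + c *\<^sub>R z))"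
proof -
  note [measurable] = C11_D(1,2)[OF assms]
  have "\<bar>f (x + c *\<^sub>R (z + u)) - f (x + c *\<^sub>R z) - c * l * (p (x + c *\<^sub>R z) \<bullet> u)\<bar> \<le> (c * l)\<^sup>2 * P * (u \<bullet> u)" for z u
    using C11_D(6)[OF assms, of "x + c *\<^sub>R z" "c *\<^sub>R u"]
    by (simp add: algebra_simps power2_eq_square)
  then show ?thesis
    using C11_D(3-5)[OF assms] by (simp add: C11_def)
qed

text \<open>Like \<open>C11_shift\<close>, averaging keeps P and changes only the scale. Both terms
  of a splitting therefore satisfy the same bounds, and the splitting can be iterated with one
  constant.\<close>

lemma C11_average:
  assumes "C11 l P f p"
  shows "C11 (c * l) P (\<lambda>x. \<integral>z. f (c *\<^sub>R x + s *\<^sub>R z) \<partial>std_gauss) (\<lambda>x. \<integral>z. p (c *\<^sub>R x + s *\<^sub>R z) \<partial>std_gauss)"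
proof -
  note [measurable] = C11_D(1,2)[OF assms]
  note b = C11_D(3-5)[OF assms]
  have if': "integrable std_gauss (\<lambda>z. f (w + s *\<^sub>R z))" for w
    by (rule integrable_std_gauss_bounded[where B=1]) (use b in \<open>simp_all add: abs_of_nonneg\<close>)
  have ip: "integrable std_gauss (\<lambda>z. p (w + s *\<^sub>R z))" for w
    by (rule std_gauss.integrable_const_bound[where B=P]) (use b in auto)
  show ?thesis
    unfolding C11_def
  proof (intro conjI allI)
    fix x u
    show "(\<integral>z. f (c *\<^sub>R x + s *\<^sub>R z) \<partial>std_gauss) \<in> {0..1}"
      using b std_gauss.integral_le_const[OF if', of "c *\<^sub>R x" 1] by (auto intro!: Bochner_Integration.integral_nonneg)
    show "norm (\<integral>z. p (c *\<^sub>R x + s *\<^sub>R z) \<partial>std_gauss) \<le> P"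
      by (rule order_trans[OF integral_norm_bound])
         (rule std_gauss.integral_le_const, use b ip in auto)
    have eq: "(\<integral>z. f (c *\<^sub>R (x + u) + s *\<^sub>R z) \<partial>std_gauss) - (\<integral>z. f (c *\<^sub>R x + s *\<^sub>R z) \<partial>std_gauss) -
       c * l * ((\<integral>z. p (c *\<^sub>R x + s *\<^sub>R z) \<partial>std_gauss) \<bullet> u) =
      (\<integral>z. f (c *\<^sub>R (x + u) + s *\<^sub>R z) - f (c *\<^sub>R x + s *\<^sub>R z) - c * l * (p (c *\<^sub>R x + s *\<^sub>R z) \<bullet> u) \<partial>std_gauss)"
      by (simp add: if' ip integral_inner_left)
    have "\<bar>\<integral>z. f (c *\<^sub>R (x + u) + s *\<^sub>R z) - f (c *\<^sub>R x + s *\<^sub>R z) - c * l * (p (c *\<^sub>R x + s *\<^sub>R z) \<bullet> u) \<partial>std_gauss\<bar>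
        \<le> (\<integral>z. \<bar>f (c *\<^sub>R (x + u) + s *\<^sub>R z) - f (c *\<^sub>R x + s *\<^sub>R z) - c * l * (p (c *\<^sub>R x + s *\<^sub>R z) \<bullet> u)\<bar> \<partial>std_gauss)"
      by (rule integral_abs_bound)
    also have "\<dots> \<le> (c * l)\<^sup>2 * P * (u \<bullet> u)"
    proof (rule std_gauss.integral_le_const)
      show "integrable std_gauss (\<lambda>z. \<bar>f (c *\<^sub>R (x + u) + s *\<^sub>R z) - f (c *\<^sub>R x + s *\<^sub>R z) - c * l * (p (c *\<^sub>R x + s *\<^sub>R z) \<bullet> u)\<bar>)"
        by (intro Bochner_Integration.integrable_abs Bochner_Integration.integrable_diff if' integrable_mult_right integrable_inner_left ip)
      show "AE z in std_gauss. \<bar>f (c *\<^sub>R (x + u) + s *\<^sub>R z) - f (c *\<^sub>R x + s *\<^sub>R z) - c * l * (p (c *\<^sub>R x + s *\<^sub>R z) \<bullet> u)\<bar> \<le> (c * l)\<^sup>2 * P * (u \<bullet> u)"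
      proof (rule AE_I2)
        fix z
        show "\<bar>f (c *\<^sub>R (x + u) + s *\<^sub>R z) - f (c *\<^sub>R x + s *\<^sub>R z) - c * l * (p (c *\<^sub>R x + s *\<^sub>R z) \<bullet> u)\<bar> \<le> (c * l)\<^sup>2 * P * (u \<bullet> u)"
          using C11_D(6)[OF assms, of "c *\<^sub>R x + s *\<^sub>R z" "c *\<^sub>R u"]
          by (simp add: algebra_simps power2_eq_square)
      qed
    qed
    finally show "\<bar>(\<integral>z. f (c *\<^sub>R (x + u) + s *\<^sub>R z) \<partial>std_gauss) - (\<integral>z. f (c *\<^sub>R x + s *\<^sub>R z) \<partial>std_gauss) -
       c * l * ((\<integral>z. p (c *\<^sub>R x + s *\<^sub>R z) \<partial>std_gauss) \<bullet> u)\<bar> \<le> (c * l)\<^sup>2 * P * (u \<bullet> u)"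
      unfolding eq .
  qed measurable
qed

context
  fixes \<rho> :: real
  assumes r: "-1 < \<rho>" "\<rho> < 1"
begin

text \<open>\<open>J\<close> is expanded about the means of F and G rather than about F0 and G0, so
  the linear terms integrate to zero. Replacing the increments by their linear parts l p.x and l q.y
  in the quadratic terms costs order l^3, and the covariances of these parts give
  \<open>Jquad\<close>. The constant C depends only on e, \<eta>, P, \<rho> and the
  dimension.\<close>

lemma J_step:
  assumes e: "0 < e" and eta: "\<eta> > 0" and P: "P \<ge> 0"
  obtains C where "C \<ge> 0"
    "\<And>l F G F0 G0 (p :: 'a::euclidean_space) q. 0 \<le> l \<Longrightarrow> l \<le> 1 \<Longrightarrow>
      F \<in> borel_measurable borel \<Longrightarrow> G \<in> borel_measurable borel \<Longrightarrow>
      (\<And>x. F x \<in> {0..1}) \<Longrightarrow> (\<And>x. G x \<in> {0..1}) \<Longrightarrow> norm p \<le> P \<Longrightarrow> norm q \<le> P \<Longrightarrow>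
      (\<And>x. \<bar>F x - F0 - l * (p \<bullet> x)\<bar> \<le> l\<^sup>2 * P * (x \<bullet> x)) \<Longrightarrow>
      (\<And>x. \<bar>G x - G0 - l * (q \<bullet> x)\<bar> \<le> l\<^sup>2 * P * (x \<bullet> x)) \<Longrightarrow>
      (\<integral>x. F x \<partial>std_gauss) \<in> {e..1-e} \<Longrightarrow> (\<integral>x. G x \<partial>std_gauss) \<in> {e..1-e} \<Longrightarrow>
      \<bar>(\<integral>z. J (F (fst z)) (G (snd z)) \<rho> \<partial>gauss_pair \<rho>) - J (\<integral>x. F x \<partial>std_gauss) (\<integral>x. G x \<partial>std_gauss) \<rho>
         - l\<^sup>2 / 2 * Jquad \<rho> (\<integral>x. F x \<partial>std_gauss) (\<integral>x. G x \<partial>std_gauss) p q\<bar> \<le> l\<^sup>2 * \<eta> + l ^ 3 * C"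
proof -
  define W :: "'a \<Rightarrow> real" where "W = (\<lambda>x. 1 + x \<bullet> x)"
  define w1 where "w1 = (\<integral>x. W x \<partial>std_gauss)"
  define w3 where "w3 = (\<integral>x. W x ^ 3 \<partial>std_gauss)"
  have W1: "W x \<ge> 1" for x by (simp add: W_def)
  have W0: "W x \<ge> 0" for x by (simp add: W_def)
  have W3: "W x \<le> W x ^ 3" "W x ^ 2 \<le> W x ^ 3" for x
    using W1[of x] by (auto intro: self_le_power power_increasing)
  have [measurable]: "W \<in> borel_measurable borel" unfolding W_def by measurable
  have iW3: "integrable std_gauss (\<lambda>x. W x ^ 3)"
    unfolding W_def by (rule integrable_gauss_weight)
  have iW: "integrable std_gauss W"
    by (rule integrable_gauss_dominated[where B=1]) (use W0 W3 in \<open>simp_all add: W_def abs_of_nonneg\<close>)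
  have w1: "w1 \<ge> 0" unfolding w1_def using W0 by (intro Bochner_Integration.integral_nonneg) simp
  have w3: "w3 \<ge> 0" unfolding w3_def using W0 by (intro Bochner_Integration.integral_nonneg) simp
  \<comment> \<open>One P comes from the hypothesis on F - F0, \<open>P * w1\<close> from the
    distance of F0 to the mean, and the second P from the size of the linear part; B then serves all
    three estimates of \<open>step\<close>.\<close>
  define B where "B = P * (2 + w1)"
  have B: "B \<ge> 0" using P w1 by (simp add: B_def)
  \<comment> \<open>The integrated quadratic Taylor error is \<eta>' times l^2 B^2 (2 w3), so this
    choice leaves l^2 \<eta>; the +1 keeps the denominator positive.\<close>
  define \<eta>' where "\<eta>' = \<eta> / (2 * B\<^sup>2 * w3 + 1)"
  have den: "2 * B\<^sup>2 * w3 + 1 > 0" using w3 by (smt (verit) mult_nonneg_nonneg zero_le_power2)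
  have eta': "\<eta>' > 0" using eta den by (simp add: \<eta>'_def)
  have eta'': "\<eta>' * B\<^sup>2 * (2 * w3) \<le> \<eta>"
  proof -
    have "\<eta>' * B\<^sup>2 * (2 * w3) \<le> \<eta>' * (2 * B\<^sup>2 * w3 + 1)"
      using eta' by (simp add: algebra_simps)
    also have "\<dots> = \<eta>" using den by (simp add: \<eta>'_def)
    finally show ?thesis .
  qed
  obtain C0 where C0: "C0 \<ge> 0" and tay:
    "\<And>x y u v. x \<in> {e..1-e} \<Longrightarrow> y \<in> {e..1-e} \<Longrightarrow> x + u \<in> {0..1} \<Longrightarrow> y + v \<in> {0..1} \<Longrightarrow>
      \<bar>Jrem \<rho> x y u v\<bar> \<le> \<eta>' * (u\<^sup>2 + v\<^sup>2) + C0 * (\<bar>u\<bar> ^ 3 + \<bar>v\<bar> ^ 3)"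
    using J_taylor[OF r e eta'] by blast
  obtain M where M: "M \<ge> 0" "\<And>x y. x \<in> {e..1-e} \<Longrightarrow> y \<in> {e..1-e} \<Longrightarrow> \<bar>Jxx \<rho> x y\<bar> \<le> M \<and> \<bar>Jxy \<rho> x y\<bar> \<le> M"
    using Jxx_bounded[OF r e] by blast
  define C where "C = (2 * M * B\<^sup>2 + C0 * B ^ 3) * (2 * w3)"
  show ?thesis
  proof (rule that[of C])
    show "C \<ge> 0" using M C0 B w3 by (simp add: C_def)
    fix l F G F0 G0 and p q :: 'a
    assume l: "0 \<le> l" "l \<le> 1" and [measurable]: "F \<in> borel_measurable borel" "G \<in> borel_measurable borel"
      and F01: "\<And>x. F x \<in> {0..1}" and G01: "\<And>x. G x \<in> {0..1}" and pq: "norm p \<le> P" "norm q \<le> P"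
      and F: "\<And>x. \<bar>F x - F0 - l * (p \<bullet> x)\<bar> \<le> l\<^sup>2 * P * (x \<bullet> x)"
      and G: "\<And>x. \<bar>G x - G0 - l * (q \<bullet> x)\<bar> \<le> l\<^sup>2 * P * (x \<bullet> x)"
      and mF: "(\<integral>x. F x \<partial>std_gauss) \<in> {e..1-e}" and mG: "(\<integral>x. G x \<partial>std_gauss) \<in> {e..1-e}"
    define x0 where "x0 = (\<integral>x. F x \<partial>std_gauss)"
    define y0 where "y0 = (\<integral>x. G x \<partial>std_gauss)"
    have xy: "x0 \<in> {e..1-e}" "y0 \<in> {e..1-e}" using mF mG by (simp_all add: x0_def y0_def)
    have i01: "integrable std_gauss H" if "H \<in> borel_measurable borel" "\<And>x. H x \<in> {0..1}" for H :: "'a \<Rightarrow> real"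
      by (rule integrable_std_gauss_bounded[where B=1]) (use that in \<open>simp_all add: abs_of_nonneg\<close>)
    have l2: "l\<^sup>2 \<le> l" using l by (simp add: power2_eq_square mult_left_le)
    have step: "\<bar>H x - (\<integral>x. H x \<partial>std_gauss) - l * (p \<bullet> x)\<bar> \<le> l\<^sup>2 * B * W x \<and>
        \<bar>H x - (\<integral>x. H x \<partial>std_gauss)\<bar> \<le> l * B * W x \<and> \<bar>l * (p \<bullet> x)\<bar> \<le> l * B * W x"
      if H[measurable]: "H \<in> borel_measurable borel" and H01: "\<And>x. H x \<in> {0..1}" and p: "norm p \<le> P"
        and HH: "\<And>x. \<bar>H x - H0 - l * (p \<bullet> x)\<bar> \<le> l\<^sup>2 * P * (x \<bullet> x)" for H H0 and p x :: 'a
    proof -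
      have HW: "\<bar>H x - H0 - l * (p \<bullet> x)\<bar> \<le> l\<^sup>2 * P * W x" for x
        using HH[of x] P by (simp add: W_def algebra_simps) (smt (verit) mult_nonneg_nonneg zero_le_power2)
      have iH: "integrable std_gauss H" using i01 H H01 by blast
      have "(\<integral>x. H x \<partial>std_gauss) - H0 = (\<integral>x. H x - H0 - l * (p \<bullet> x) \<partial>std_gauss)"
        by (simp add: iH)
      also have "\<bar>\<dots>\<bar> \<le> (\<integral>x. \<bar>H x - H0 - l * (p \<bullet> x)\<bar> \<partial>std_gauss)"
        by (rule integral_abs_bound)
      also have "\<dots> \<le> (\<integral>x. l\<^sup>2 * P * W x \<partial>std_gauss)"
        by (rule integral_mono) (use HW iH iW in auto)
      also have "\<dots> = l\<^sup>2 * P * w1" by (simp add: w1_def)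
      finally have m: "\<bar>(\<integral>x. H x \<partial>std_gauss) - H0\<bar> \<le> l\<^sup>2 * P * w1" .
      have mW: "l\<^sup>2 * P * w1 \<le> l\<^sup>2 * P * w1 * W x"
        using mult_left_mono[OF W1[of x], of "l\<^sup>2 * P * w1"] P w1 by simp
      have a: "\<bar>H x - (\<integral>x. H x \<partial>std_gauss) - l * (p \<bullet> x)\<bar> \<le> l\<^sup>2 * P * W x + l\<^sup>2 * P * w1 * W x"
        using HW[of x] m mW by linarith
      have "l * \<bar>p \<bullet> x\<bar> \<le> l * (norm p * W x)"
        using abs_le_weight[of p x] l by (auto simp: W_def intro: mult_left_mono)
      also have "\<dots> \<le> l * (P * W x)"
        using p l W1[of x] by (intro mult_left_mono mult_right_mono) auto
      finally have b: "\<bar>l * (p \<bullet> x)\<bar> \<le> l * P * W x" using l by (simp add: abs_mult mult.assoc)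
      have c: "l\<^sup>2 * P * W x + l\<^sup>2 * P * w1 * W x \<le> l * P * W x + l * P * w1 * W x"
        using l2 P w1 W1[of x] by (intro add_mono mult_right_mono) auto
      have BW: "k * B * W x = 2 * (k * P * W x) + k * P * w1 * W x" for k
        by (simp add: B_def algebra_simps)
      have nn: "0 \<le> k * P * W x" "0 \<le> k * P * w1 * W x" if "0 \<le> k" for k
        using that P w1 W1[of x] by auto
      show ?thesis
        unfolding BW using a b c nn[of "l\<^sup>2"] nn[of l] l by auto
    qed
    define u where "u = (\<lambda>x. F x - x0)"
    define v where "v = (\<lambda>x. G x - y0)"
    define p' where "p' = (\<lambda>x. l * (p \<bullet> x))"
    define q' where "q' = (\<lambda>x. l * (q \<bullet> x))"
    have u: "\<bar>u x - p' x\<bar> \<le> l\<^sup>2 * B * W x" "\<bar>u x\<bar> \<le> l * B * W x" "\<bar>p' x\<bar> \<le> l * B * W x" for x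
      using step[OF _ F01 pq(1) F] by (simp_all add: u_def p'_def x0_def)
    have v: "\<bar>v x - q' x\<bar> \<le> l\<^sup>2 * B * W x" "\<bar>v x\<bar> \<le> l * B * W x" "\<bar>q' x\<bar> \<le> l * B * W x" for x
      using step[OF _ G01 pq(2) G] by (simp_all add: v_def q'_def y0_def)
    \<comment> \<open>In each product one factor is of order l and the error of the other is of
      order l^2, whence the cube of l.\<close>
    have prod: "\<bar>a * b - a' * b'\<bar> \<le> l ^ 3 * B\<^sup>2 * (W x ^ 2 + W y ^ 2)"
      if "\<bar>a - a'\<bar> \<le> l\<^sup>2 * B * W x" "\<bar>b\<bar> \<le> l * B * W y" "\<bar>a'\<bar> \<le> l * B * W x" "\<bar>b - b'\<bar> \<le> l\<^sup>2 * B * W y" for a b a' b' x y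
    proof -
      have "\<bar>a * b - a' * b'\<bar> = \<bar>(a - a') * b + a' * (b - b')\<bar>" by (simp add: algebra_simps)
      also have "\<dots> \<le> \<bar>a - a'\<bar> * \<bar>b\<bar> + \<bar>a'\<bar> * \<bar>b - b'\<bar>" by (metis abs_mult abs_triangle_ineq)
      also have "\<dots> \<le> (l\<^sup>2 * B * W x) * (l * B * W y) + (l * B * W x) * (l\<^sup>2 * B * W y)"
        using that by (intro add_mono mult_mono) auto
      also have "\<dots> = l ^ 3 * B\<^sup>2 * (2 * W x * W y)" by (simp add: algebra_simps power2_eq_square power3_eq_cube)
      also have "\<dots> \<le> l ^ 3 * B\<^sup>2 * (W x ^ 2 + W y ^ 2)"
        using sum_squares_bound[of "W x" "W y"] l by (intro mult_left_mono) auto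
      finally show ?thesis .
    qed
    have sq: "\<bar>u x\<bar>\<^sup>2 \<le> l\<^sup>2 * B\<^sup>2 * W x ^ 3" "\<bar>u x\<bar> ^ 3 \<le> l ^ 3 * B ^ 3 * W x ^ 3"
      if "\<bar>u x\<bar> \<le> l * B * W x" for u :: "'a \<Rightarrow> real" and x
    proof -
      have "\<bar>u x\<bar>\<^sup>2 \<le> (l * B * W x)\<^sup>2" using that by (intro power_mono) auto
      also have "\<dots> = l\<^sup>2 * B\<^sup>2 * (W x)\<^sup>2" by (simp add: power_mult_distrib)
      also have "\<dots> \<le> l\<^sup>2 * B\<^sup>2 * W x ^ 3" using W3[of x] by (intro mult_left_mono) auto
      finally show "\<bar>u x\<bar>\<^sup>2 \<le> l\<^sup>2 * B\<^sup>2 * W x ^ 3" .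
      have "\<bar>u x\<bar> ^ 3 \<le> (l * B * W x) ^ 3" using that by (intro power_mono) auto
      then show "\<bar>u x\<bar> ^ 3 \<le> l ^ 3 * B ^ 3 * W x ^ 3" by (simp add: power_mult_distrib)
    qed
    let ?A = "Jxx \<rho> x0 y0" and ?B = "Jxy \<rho> x0 y0" and ?D = "Jxx \<rho> y0 x0"
    \<comment> \<open>The remainder with the quadratic form already evaluated at the linear parts;
      its mean is exactly the expression to be estimated.\<close>
    define D where "D = (\<lambda>z. J (F (fst z)) (G (snd z)) \<rho> - J x0 y0 \<rho> - Jx \<rho> x0 y0 * u (fst z) - Jx \<rho> y0 x0 * v (snd z)
       - (?A * (p' (fst z) * p' (fst z)) + 2 * ?B * (p' (fst z) * q' (snd z)) + ?D * (q' (snd z) * q' (snd z))) / 2)"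
    define K where "K = l\<^sup>2 * (\<eta>' * B\<^sup>2) + l ^ 3 * (2 * M * B\<^sup>2 + C0 * B ^ 3)"
    have Dbound: "\<bar>D z\<bar> \<le> K * (W (fst z) ^ 3 + W (snd z) ^ 3)" for z
    proof -
      obtain x y where z: "z = (x, y)" by fastforce
      have D: "D z = Jrem \<rho> x0 y0 (u x) (v y) + (?A * (u x * u x - p' x * p' x) +
          2 * (?B * (u x * v y - p' x * q' y)) + ?D * (v y * v y - q' y * q' y)) / 2"
        unfolding Jrem_def[OF r] D_def z by (simp add: u_def v_def algebra_simps power2_eq_square diff_divide_distrib add_divide_distrib)
      have J1: "\<bar>Jrem \<rho> x0 y0 (u x) (v y)\<bar> \<le> \<eta>' * (\<bar>u x\<bar>\<^sup>2 + \<bar>v y\<bar>\<^sup>2) + C0 * (\<bar>u x\<bar> ^ 3 + \<bar>v y\<bar> ^ 3)"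
        using tay[OF xy, of "u x" "v y"] F01[of x] G01[of y] by (simp add: u_def v_def)
      also have "\<dots> \<le> \<eta>' * (l\<^sup>2 * B\<^sup>2 * W x ^ 3 + l\<^sup>2 * B\<^sup>2 * W y ^ 3) + C0 * (l ^ 3 * B ^ 3 * W x ^ 3 + l ^ 3 * B ^ 3 * W y ^ 3)"
        using sq[of u, OF u(2)[of x]] sq[of v, OF v(2)[of y]] eta' C0 by (intro add_mono mult_left_mono) auto
      finally have J1: "\<bar>Jrem \<rho> x0 y0 (u x) (v y)\<bar> \<le> (l\<^sup>2 * (\<eta>' * B\<^sup>2) + l ^ 3 * (C0 * B ^ 3)) * (W x ^ 3 + W y ^ 3)"
        by (simp add: algebra_simps)
      have P1: "\<bar>u x * u x - p' x * p' x\<bar> \<le> l ^ 3 * B\<^sup>2 * (W x ^ 2 + W x ^ 2)"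
        by (rule prod) (use u[of x] in auto)
      have P2: "\<bar>u x * v y - p' x * q' y\<bar> \<le> l ^ 3 * B\<^sup>2 * (W x ^ 2 + W y ^ 2)"
        by (rule prod) (use u[of x] v[of y] in auto)
      have P3: "\<bar>v y * v y - q' y * q' y\<bar> \<le> l ^ 3 * B\<^sup>2 * (W y ^ 2 + W y ^ 2)"
        by (rule prod) (use v[of y] in auto)
      have mm: "\<bar>k * a\<bar> \<le> M * b" if "\<bar>k\<bar> \<le> M" "\<bar>a\<bar> \<le> b" for k a b
        unfolding abs_mult using that M(1) by (intro mult_mono) auto
      have Q: "\<bar>(?A * (u x * u x - p' x * p' x) + 2 * (?B * (u x * v y - p' x * q' y)) + ?D * (v y * v y - q' y * q' y)) / 2\<bar>
         \<le> l ^ 3 * (2 * M * B\<^sup>2) * (W x ^ 3 + W y ^ 3)"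
      proof -
        have tri: "\<bar>(a + 2 * b + c) / 2\<bar> \<le> (\<bar>a\<bar> + 2 * \<bar>b\<bar> + \<bar>c\<bar>) / 2" for a b c :: real
        proof -
          have "\<bar>a + 2 * b + c\<bar> \<le> \<bar>a\<bar> + 2 * \<bar>b\<bar> + \<bar>c\<bar>" by linarith
          then show ?thesis by simp
        qed
        have "\<bar>(?A * (u x * u x - p' x * p' x) + 2 * (?B * (u x * v y - p' x * q' y)) + ?D * (v y * v y - q' y * q' y)) / 2\<bar>
          \<le> (\<bar>?A * (u x * u x - p' x * p' x)\<bar> + 2 * \<bar>?B * (u x * v y - p' x * q' y)\<bar> + \<bar>?D * (v y * v y - q' y * q' y)\<bar>) / 2"
          by (rule tri)
        also have "\<dots> \<le> (M * (l ^ 3 * B\<^sup>2 * (W x ^ 2 + W x ^ 2)) + 2 * (M * (l ^ 3 * B\<^sup>2 * (W x ^ 2 + W y ^ 2))) + M * (l ^ 3 * B\<^sup>2 * (W y ^ 2 + W y ^ 2))) / 2"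
          using M(2)[OF xy] M(2)[OF xy(2,1)] P1 P2 P3 by (intro divide_right_mono add_mono mult_left_mono mm) auto
        also have "\<dots> = l ^ 3 * (2 * M * B\<^sup>2) * (W x ^ 2 + W y ^ 2)" by (simp add: algebra_simps)
        also have "\<dots> \<le> l ^ 3 * (2 * M * B\<^sup>2) * (W x ^ 3 + W y ^ 3)"
          using W3 l M by (intro mult_left_mono add_mono) auto
        finally show ?thesis .
      qed
      have "\<bar>D z\<bar> \<le> (l\<^sup>2 * (\<eta>' * B\<^sup>2) + l ^ 3 * (C0 * B ^ 3)) * (W x ^ 3 + W y ^ 3) + l ^ 3 * (2 * M * B\<^sup>2) * (W x ^ 3 + W y ^ 3)"
        unfolding D using J1 Q by linarith
      then show ?thesis by (simp add: K_def z algebra_simps)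
    qed
    have ib: "integrable (gauss_pair \<rho>) (\<lambda>z. J (F (fst z)) (G (snd z)) \<rho>)"
    proof (rule gauss_pair.integrable_const_bound[where B=1])
      show "(\<lambda>z. J (F (fst z)) (G (snd z)) \<rho>) \<in> borel_measurable (gauss_pair \<rho>)"
        by (rule borel_measurable_J[OF r]) measurable
    qed (simp add: J_bounds)
    note ifst = integrable_gauss_pair_fst[of _ \<rho>] and isnd = integrable_gauss_pair_snd[OF r]
    have iF: "integrable std_gauss F" and iG: "integrable std_gauss G" 
      by (rule i01; fact)+
    have iu: "integrable (gauss_pair \<rho>) (\<lambda>z. u (fst z))" "integrable (gauss_pair \<rho>) (\<lambda>z. v (snd z))"
      unfolding u_def v_def using ifst[OF iF] isnd[OF iG] by simp_all
    have iu0: "(\<integral>z. u (fst z) \<partial>gauss_pair \<rho>) = 0" "(\<integral>z. v (snd z) \<partial>gauss_pair \<rho>) = 0"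
      using integral_gauss_pair_fst[of F \<rho>] integral_gauss_pair_snd[OF r, of G] ifst[OF iF] isnd[OF iG]
      by (simp_all add: u_def v_def x0_def y0_def)
    have pm: "p' x * p' x = l\<^sup>2 * ((p \<bullet> x) * (p \<bullet> x))" "q' y * q' y = l\<^sup>2 * ((q \<bullet> y) * (q \<bullet> y))"
      "p' x * q' y = l\<^sup>2 * ((p \<bullet> x) * (q \<bullet> y))" for x y
      by (simp_all add: p'_def q'_def power2_eq_square)
    have ip: "integrable (gauss_pair \<rho>) (\<lambda>z. p' (fst z) * p' (fst z))" "integrable (gauss_pair \<rho>) (\<lambda>z. q' (snd z) * q' (snd z))"
      unfolding pm
      using ifst[of "\<lambda>x. (p \<bullet> x) * (p \<bullet> x)"] isnd[of "\<lambda>x. (q \<bullet> x) * (q \<bullet> x)"]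
      by simp_all
    have ip2: "integrable (gauss_pair \<rho>) (\<lambda>z. p' (fst z) * q' (snd z))"
    proof (rule Bochner_Integration.integrable_bound)
      show "integrable (gauss_pair \<rho>) (\<lambda>z. p' (fst z) * p' (fst z) + q' (snd z) * q' (snd z))" using ip by simp
      have "\<bar>a * b\<bar> \<le> \<bar>a * a + b * b\<bar>" for a b :: real
        using sum_squares_bound[of a b] sum_squares_bound[of a "-b"] by (simp add: power2_eq_square abs_le_iff)
      then show "AE z in gauss_pair \<rho>. norm (p' (fst z) * q' (snd z)) \<le> norm (p' (fst z) * p' (fst z) + q' (snd z) * q' (snd z))"
        by (intro AE_I2) auto
    qed (simp add: p'_def q'_def)
    have iq: "(\<integral>z. p' (fst z) * p' (fst z) \<partial>gauss_pair \<rho>) = l\<^sup>2 * (p \<bullet> p)"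
      "(\<integral>z. q' (snd z) * q' (snd z) \<partial>gauss_pair \<rho>) = l\<^sup>2 * (q \<bullet> q)"
      "(\<integral>z. p' (fst z) * q' (snd z) \<partial>gauss_pair \<rho>) = l\<^sup>2 * (\<rho> * (p \<bullet> q))"
      unfolding pm
      using integral_gauss_pair_fst[of "\<lambda>x. (p \<bullet> x) * (p \<bullet> x)" \<rho>] integral_gauss_pair_snd[OF r, of "\<lambda>x. (q \<bullet> x) * (q \<bullet> x)"]
      by (simp_all add: integral_gauss_inner_mult integral_gauss_pair_inner_mult[OF r])
    have iD: "integrable (gauss_pair \<rho>) D"
      unfolding D_def using ib iu ip ip2
      by (intro Bochner_Integration.integrable_diff integrable_divide Bochner_Integration.integrable_add integrable_mult_right) auto
    have "(\<integral>z. D z \<partial>gauss_pair \<rho>) = (\<integral>z. J (F (fst z)) (G (snd z)) \<rho> \<partial>gauss_pair \<rho>) - J x0 y0 \<rho>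
         - l\<^sup>2 / 2 * Jquad \<rho> x0 y0 p q"
      unfolding D_def Jquad_def[OF r] using ib iu ip ip2
      by (simp add: iu0 iq) (simp add: field_simps)
    moreover have "\<bar>\<integral>z. D z \<partial>gauss_pair \<rho>\<bar> \<le> l\<^sup>2 * \<eta> + l ^ 3 * C"
    proof -
      have iW': "integrable (gauss_pair \<rho>) (\<lambda>z. W (fst z) ^ 3)" "integrable (gauss_pair \<rho>) (\<lambda>z. W (snd z) ^ 3)"
        using ifst[OF iW3] isnd[OF iW3] by auto
      have "\<bar>\<integral>z. D z \<partial>gauss_pair \<rho>\<bar> \<le> (\<integral>z. \<bar>D z\<bar> \<partial>gauss_pair \<rho>)" by (rule integral_abs_bound)
      also have "\<dots> \<le> (\<integral>z. K * (W (fst z) ^ 3 + W (snd z) ^ 3) \<partial>gauss_pair \<rho>)"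
        by (rule integral_mono) (use iD iW' Dbound in auto)
      also have "\<dots> = K * (2 * w3)"
        using iW' integral_gauss_pair_fst[of "\<lambda>x. W x ^ 3" \<rho>] integral_gauss_pair_snd[OF r, of "\<lambda>x. W x ^ 3"]
        by (simp add: w3_def)
      also have "\<dots> = l\<^sup>2 * (\<eta>' * B\<^sup>2 * (2 * w3)) + l ^ 3 * C" by (simp add: K_def C_def algebra_simps)
      also have "\<dots> \<le> l\<^sup>2 * \<eta> + l ^ 3 * C" using eta'' l by (intro add_mono mult_left_mono) auto
      finally show ?thesis .
    qed
    ultimately show "\<bar>(\<integral>z. J (F (fst z)) (G (snd z)) \<rho> \<partial>gauss_pair \<rho>) - J (\<integral>x. F x \<partial>std_gauss) (\<integral>x. G x \<partial>std_gauss) \<rho>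
         - l\<^sup>2 / 2 * Jquad \<rho> (\<integral>x. F x \<partial>std_gauss) (\<integral>x. G x \<partial>std_gauss) p q\<bar> \<le> l\<^sup>2 * \<eta> + l ^ 3 * C"
      by (simp add: x0_def y0_def)
  qed
qed

end

section \<open>Nonnegativity of the deficit\<close>

lemma integrable_std_gauss_unit:
  fixes f :: "'a::euclidean_space \<Rightarrow> real"
  assumes "f \<in> borel_measurable borel" "\<And>x. f x \<in> {0..1}"
  shows "integrable std_gauss f"
  by (rule integrable_std_gauss_bounded[where B=1]) (use assms in \<open>simp_all add: abs_of_nonneg\<close>)

lemma integral_std_gauss_Icc:
  fixes f :: "'a::euclidean_space \<Rightarrow> real"
  assumes "f \<in> borel_measurable borel" "\<And>x. f x \<in> {a..b}"
  shows "(\<integral>x. f x \<partial>std_gauss) \<in> {a..b}"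
proof -
  have "\<bar>f x\<bar> \<le> max \<bar>a\<bar> \<bar>b\<bar>" for x using assms(2)[of x] by auto
  then have "integrable std_gauss f" using assms(1) by (rule integrable_std_gauss_bounded[rotated])
  then show ?thesis
    using std_gauss.integral_le_const[of f b] std_gauss.integral_ge_const[of f a] assms(2) by auto
qed

context
  fixes \<rho> :: real
  assumes r: "-1 < \<rho>" "\<rho> < 1"
begin

lemma Jquad_sign: "sgn \<rho> * Jquad \<rho> x y p q \<le> 0"
proof -
  have "sgn \<rho> * \<rho> \<ge> 0" by (simp add: sgn_if)
  then show ?thesis
    unfolding Jquad_eq[OF r] using tau[OF r]
    by (simp add: mult_nonneg_nonneg mult.assoc[symmetric] less_imp_le)
qed

lemma integrable_J:
  fixes f g :: "'a::euclidean_space \<Rightarrow> real"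
  assumes [measurable]: "f \<in> borel_measurable borel" "g \<in> borel_measurable borel"
  shows "integrable (gauss_pair \<rho>) (\<lambda>z. J (f (fst z)) (g (snd z)) \<rho>)"
proof (rule gauss_pair.integrable_const_bound[where B=1])
  show "(\<lambda>z. J (f (fst z)) (g (snd z)) \<rho>) \<in> borel_measurable (gauss_pair \<rho>)"
    by (rule borel_measurable_J[OF r]) measurable
qed (simp add: J_bounds)

text \<open>Insert E J(f'(X), g'(Y)), where f' and g' are the inner averages: J(E f, E g) minus it
  is the deficit of the averaged pair, and it minus E J(f(X), g(Y)) is the mean of the local
  deficits, because the pair splits into two independent copies of itself.\<close>

lemma deficit_split:
  fixes f g :: "'a::euclidean_space \<Rightarrow> real"
  assumes [measurable]: "f \<in> borel_measurable borel" "g \<in> borel_measurable borel"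
    and f: "\<And>x. f x \<in> {0..1}" and g: "\<And>x. g x \<in> {0..1}"
    and cs: "s \<noteq> 0" "c\<^sup>2 + s\<^sup>2 = 1"
  shows "deficit \<rho> f g =
      deficit \<rho> (\<lambda>x. \<integral>z. f (c *\<^sub>R x + s *\<^sub>R z) \<partial>std_gauss) (\<lambda>x. \<integral>z. g (c *\<^sub>R x + s *\<^sub>R z) \<partial>std_gauss) +
      (\<integral>w. deficit \<rho> (\<lambda>z. f (c *\<^sub>R fst w + s *\<^sub>R z)) (\<lambda>z. g (c *\<^sub>R snd w + s *\<^sub>R z)) \<partial>gauss_pair \<rho>)"
    and "integrable (gauss_pair \<rho>) (\<lambda>w. deficit \<rho> (\<lambda>z. f (c *\<^sub>R fst w + s *\<^sub>R z)) (\<lambda>z. g (c *\<^sub>R snd w + s *\<^sub>R z)))"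
proof -
  define f' where "f' = (\<lambda>x. \<integral>z. f (c *\<^sub>R x + s *\<^sub>R z) \<partial>std_gauss)"
  define g' where "g' = (\<lambda>x. \<integral>z. g (c *\<^sub>R x + s *\<^sub>R z) \<partial>std_gauss)"
  have [measurable]: "f' \<in> borel_measurable borel" "g' \<in> borel_measurable borel"
    unfolding f'_def g'_def by measurable
  define K where "K = (\<lambda>w::'a\<times>'a. \<integral>z. J (f (c *\<^sub>R fst w + s *\<^sub>R fst z)) (g (c *\<^sub>R snd w + s *\<^sub>R snd z)) \<rho> \<partial>gauss_pair \<rho>)"
  have mF: "(\<lambda>p. J (f (fst p)) (g (snd p)) \<rho>) \<in> borel_measurable (borel :: ('a \<times> 'a) measure)"
    unfolding borel_prod[symmetric] by (rule borel_measurable_J[OF r]) measurable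
  have EF: "(\<integral>x. f x \<partial>std_gauss) = (\<integral>x. f' x \<partial>std_gauss)" "(\<integral>x. g x \<partial>std_gauss) = (\<integral>x. g' x \<partial>std_gauss)"
    unfolding f'_def g'_def using f g
    by (auto intro!: integral_std_gauss_mix[where B=1] cs simp: abs_of_nonneg)
  have EJ: "(\<integral>p. J (f (fst p)) (g (snd p)) \<rho> \<partial>gauss_pair \<rho>) = (\<integral>w. K w \<partial>gauss_pair \<rho>)"
    using integral_gauss_pair_mix[OF mF, of 1 s c \<rho>] cs J_bounds unfolding K_def by (simp add: abs_of_nonneg)
  have D: "deficit \<rho> (\<lambda>z. f (c *\<^sub>R fst w + s *\<^sub>R z)) (\<lambda>z. g (c *\<^sub>R snd w + s *\<^sub>R z)) =
     sgn \<rho> * (J (f' (fst w)) (g' (snd w)) \<rho> - K w)" for w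
    by (simp add: deficit_def f'_def g'_def K_def)
  have iJ: "integrable (gauss_pair \<rho>) (\<lambda>w. J (f' (fst w)) (g' (snd w)) \<rho>)"
    by (rule integrable_J) measurable
  have iK: "integrable (gauss_pair \<rho>) K"
  proof (rule gauss_pair.integrable_const_bound[where B=1])
    have "\<bar>K w\<bar> \<le> 1" for w
    proof -
      have "integrable (gauss_pair \<rho>) (\<lambda>z. J (f (c *\<^sub>R fst w + s *\<^sub>R fst z)) (g (c *\<^sub>R snd w + s *\<^sub>R snd z)) \<rho>)"
        by (rule integrable_J[of "\<lambda>z. f (c *\<^sub>R fst w + s *\<^sub>R z)" "\<lambda>z. g (c *\<^sub>R snd w + s *\<^sub>R z)"]) measurable
      then have "K w \<le> 1" unfolding K_def by (rule gauss_pair.integral_le_const) (simp add: J_bounds)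
      moreover have "K w \<ge> 0" unfolding K_def by (rule Bochner_Integration.integral_nonneg) (simp add: J_bounds)
      ultimately show ?thesis by simp
    qed
    then show "AE w in gauss_pair \<rho>. norm (K w) \<le> 1" by simp
    have "(\<lambda>p. J (f (c *\<^sub>R fst (fst p) + s *\<^sub>R fst (snd p))) (g (c *\<^sub>R snd (fst p) + s *\<^sub>R snd (snd p))) \<rho>)
        \<in> borel_measurable (gauss_pair \<rho> \<Otimes>\<^sub>M gauss_pair \<rho>)"
      by (rule borel_measurable_J[OF r]) measurable
    then show "K \<in> borel_measurable (gauss_pair \<rho>)"
      unfolding K_def by (intro gauss_pair.borel_measurable_lebesgue_integral) (simp add: split_beta')
  qed
  show "integrable (gauss_pair \<rho>) (\<lambda>w. deficit \<rho> (\<lambda>z. f (c *\<^sub>R fst w + s *\<^sub>R z)) (\<lambda>z. g (c *\<^sub>R snd w + s *\<^sub>R z)))"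
    unfolding D using iJ iK by simp
  show "deficit \<rho> f g =
      deficit \<rho> (\<lambda>x. \<integral>z. f (c *\<^sub>R x + s *\<^sub>R z) \<partial>std_gauss) (\<lambda>x. \<integral>z. g (c *\<^sub>R x + s *\<^sub>R z) \<partial>std_gauss) +
      (\<integral>w. deficit \<rho> (\<lambda>z. f (c *\<^sub>R fst w + s *\<^sub>R z)) (\<lambda>z. g (c *\<^sub>R snd w + s *\<^sub>R z)) \<partial>gauss_pair \<rho>)"
    unfolding D f'_def[symmetric] g'_def[symmetric] using iJ iK
    by (simp add: deficit_def EF EJ algebra_simps)
qed

text \<open>Iterating the splitting at scale \<open>1 / sqrt 2\<close> reduces the sign of the deficit to its second-order expansion.\<close>

lemma deficit_nonneg_C11:
  fixes f g :: "'a::euclidean_space \<Rightarrow> real"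
  assumes e: "0 < e" and fp: "C11 1 P f p" and gq: "C11 1 P g q"
    and f: "\<And>x. f x \<in> {e..1-e}" and g: "\<And>x. g x \<in> {e..1-e}"
  shows "deficit \<rho> f g \<ge> 0"
proof (rule field_le_epsilon)
  fix \<eta> :: real assume eta: "\<eta> > 0"
  have P: "P \<ge> 0" using C11_D(5)[OF fp] norm_ge_zero order_trans by blast
  \<comment> \<open>With c = s the averages and the translates have the same scale, so one induction
    hypothesis serves both.\<close>
  define c :: real where "c = 1 / sqrt 2"
  have c: "0 < c" "c \<noteq> 0" "c \<le> 1" "c\<^sup>2 = 1 / 2" "c < 1" by (auto simp: c_def power_divide)
  have half: "\<eta> / 2 > 0" using eta by simp
  obtain C where C: "C \<ge> 0" and step:
    "\<And>l F G F0 G0 (p::'a) q. 0 \<le> l \<Longrightarrow> l \<le> 1 \<Longrightarrow> F \<in> borel_measurable borel \<Longrightarrow> G \<in> borel_measurable borel \<Longrightarrow>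
      (\<And>x. F x \<in> {0..1}) \<Longrightarrow> (\<And>x. G x \<in> {0..1}) \<Longrightarrow> norm p \<le> P \<Longrightarrow> norm q \<le> P \<Longrightarrow>
      (\<And>x. \<bar>F x - F0 - l * (p \<bullet> x)\<bar> \<le> l\<^sup>2 * P * (x \<bullet> x)) \<Longrightarrow>
      (\<And>x. \<bar>G x - G0 - l * (q \<bullet> x)\<bar> \<le> l\<^sup>2 * P * (x \<bullet> x)) \<Longrightarrow>
      (\<integral>x. F x \<partial>std_gauss) \<in> {e..1-e} \<Longrightarrow> (\<integral>x. G x \<partial>std_gauss) \<in> {e..1-e} \<Longrightarrow>
      \<bar>(\<integral>z. J (F (fst z)) (G (snd z)) \<rho> \<partial>gauss_pair \<rho>) - J (\<integral>x. F x \<partial>std_gauss) (\<integral>x. G x \<partial>std_gauss) \<rho>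
         - l\<^sup>2 / 2 * Jquad \<rho> (\<integral>x. F x \<partial>std_gauss) (\<integral>x. G x \<partial>std_gauss) p q\<bar> \<le> l\<^sup>2 * (\<eta> / 2) + l ^ 3 * C"
    using J_step[OF r e half P, where 'a='a] by blast
  \<comment> \<open>Both functions and the scale l must vary, as the induction passes to averages
    and translates at scale c l. Since 2^k (c^k)^2 = 1, for l = 1 the total error is \<eta>/2 + c^k
    C, and the second summand vanishes as k grows.\<close>
  have main: "deficit \<rho> f g \<ge> - (2 ^ k * ((c ^ k * l)\<^sup>2 * (\<eta> / 2) + (c ^ k * l) ^ 3 * C))"
    if "0 \<le> l" "l \<le> 1" "C11 l P f p" "C11 l P g q" "\<And>x. f x \<in> {e..1-e}" "\<And>x. g x \<in> {e..1-e}"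
    for k l and f g :: "'a \<Rightarrow> real" and p q
    using that
  proof (induction k arbitrary: l f g p q)
    case 0
    let ?x = "\<integral>x. f x \<partial>std_gauss" and ?y = "\<integral>x. g x \<partial>std_gauss"
    have A: "\<bar>(\<integral>z. J (f (fst z)) (g (snd z)) \<rho> \<partial>gauss_pair \<rho>) - J ?x ?y \<rho>
         - l\<^sup>2 / 2 * Jquad \<rho> ?x ?y (p 0) (q 0)\<bar> \<le> l\<^sup>2 * (\<eta> / 2) + l ^ 3 * C"
      by (rule step[where ?F0.0="f 0" and ?G0.0="g 0"])
         (use 0 C11_D[OF 0(3)] C11_D[OF 0(4)] C11_D(6)[OF 0(3), of 0] C11_D(6)[OF 0(4), of 0] in
           \<open>auto intro!: integral_std_gauss_Icc simp del: atLeastAtMost_iff\<close>, auto)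
    have B: "l\<^sup>2 / 2 * (sgn \<rho> * Jquad \<rho> ?x ?y (p 0) (q 0)) \<le> 0"
      by (intro mult_nonneg_nonpos Jquad_sign) auto
    have gen: "s * (E - D) \<ge> - B" if "\<bar>D - E - F * Q\<bar> \<le> B" "F * (s * Q) \<le> 0" "s = 1 \<or> s = -1 \<or> s = 0" for B D E F s Q :: real
      using that by auto
    have "sgn \<rho> = 1 \<or> sgn \<rho> = -1 \<or> sgn \<rho> = 0" by (simp add: sgn_if)
    from gen[OF A B this] show ?case unfolding deficit_def by simp
  next
    case (Suc k)
    note [measurable] = C11_D(1)[OF Suc.prems(3)] C11_D(1)[OF Suc.prems(4)]
    have cl: "0 \<le> c * l" "c * l \<le> 1" using c Suc.prems by (auto intro: mult_le_one)
    have cc: "c \<noteq> 0" "c\<^sup>2 + c\<^sup>2 = 1" using c by auto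
    define b where "b = - (2 ^ k * ((c ^ k * (c * l))\<^sup>2 * (\<eta> / 2) + (c ^ k * (c * l)) ^ 3 * C))"
    have f01: "\<And>x. f x \<in> {0..1}" "\<And>x. g x \<in> {0..1}"
      using C11_D(3,4)[OF Suc.prems(3)] C11_D(3,4)[OF Suc.prems(4)] by auto
    have "b \<le> deficit \<rho> (\<lambda>x. \<integral>z. f (c *\<^sub>R x + c *\<^sub>R z) \<partial>std_gauss) (\<lambda>x. \<integral>z. g (c *\<^sub>R x + c *\<^sub>R z) \<partial>std_gauss)"
      unfolding b_def
      by (rule Suc.IH[OF cl C11_average[OF Suc.prems(3)] C11_average[OF Suc.prems(4)]])
         (rule integral_std_gauss_Icc; use Suc.prems(5,6) in simp)+
    moreover have "b \<le> (\<integral>w. deficit \<rho> (\<lambda>z. f (c *\<^sub>R fst w + c *\<^sub>R z)) (\<lambda>z. g (c *\<^sub>R snd w + c *\<^sub>R z)) \<partial>gauss_pair \<rho>)"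
    proof (rule gauss_pair.integral_ge_const)
      show "integrable (gauss_pair \<rho>) (\<lambda>w. deficit \<rho> (\<lambda>z. f (c *\<^sub>R fst w + c *\<^sub>R z)) (\<lambda>z. g (c *\<^sub>R snd w + c *\<^sub>R z)))"
        by (rule deficit_split(2)) (use f01 cc in auto)
      show "AE w in gauss_pair \<rho>. b \<le> deficit \<rho> (\<lambda>z. f (c *\<^sub>R fst w + c *\<^sub>R z)) (\<lambda>z. g (c *\<^sub>R snd w + c *\<^sub>R z))"
        unfolding b_def
        by (intro AE_I2 Suc.IH[OF cl C11_shift[OF Suc.prems(3)] C11_shift[OF Suc.prems(4)]] Suc.prems(5,6))
    qed
    moreover have "deficit \<rho> f g =
      deficit \<rho> (\<lambda>x. \<integral>z. f (c *\<^sub>R x + c *\<^sub>R z) \<partial>std_gauss) (\<lambda>x. \<integral>z. g (c *\<^sub>R x + c *\<^sub>R z) \<partial>std_gauss) +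
      (\<integral>w. deficit \<rho> (\<lambda>z. f (c *\<^sub>R fst w + c *\<^sub>R z)) (\<lambda>z. g (c *\<^sub>R snd w + c *\<^sub>R z)) \<partial>gauss_pair \<rho>)"
      by (rule deficit_split(1)) (use f01 cc in auto)
    ultimately have "deficit \<rho> f g \<ge> 2 * b" by linarith
    also have "2 * b = - (2 ^ Suc k * ((c ^ Suc k * l)\<^sup>2 * (\<eta> / 2) + (c ^ Suc k * l) ^ 3 * C))"
      by (simp add: b_def mult_ac)
    finally show ?case .
  qed
  have "(\<lambda>k. c ^ k * C) \<longlonglongrightarrow> 0 * C"
    using c by (intro tendsto_intros LIMSEQ_realpow_zero) auto
  then have "eventually (\<lambda>k. c ^ k * C < \<eta> / 2) sequentially"
    using eta by (intro order_tendstoD) auto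
  then obtain k where k: "c ^ k * C < \<eta> / 2" by (auto simp: eventually_sequentially)
  have ck: "2 ^ k * (c ^ k)\<^sup>2 = 1"
  proof -
    have "(c ^ k)\<^sup>2 = (c\<^sup>2) ^ k" unfolding power_mult[symmetric] by (simp only: mult.commute)
    then show ?thesis by (simp add: c(4) power_divide)
  qed
  have "2 ^ k * ((c ^ k * 1)\<^sup>2 * (\<eta> / 2) + (c ^ k * 1) ^ 3 * C) = (2 ^ k * (c ^ k)\<^sup>2) * (\<eta> / 2 + c ^ k * C)"
    by (simp add: algebra_simps power2_eq_square power3_eq_cube)
  also have "\<dots> \<le> \<eta>" unfolding ck using k by simp
  finally show "0 \<le> deficit \<rho> f g + \<eta>"
    using main[OF _ _ fp gq f g, of k] by simp
qed

end

section \<open>Ornstein-Uhlenbeck smoothing and its removal in L1\<close>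

lemma AE_std_gauss_iff:
  "(AE x in (std_gauss :: 'a::euclidean_space measure). P x) \<longleftrightarrow> (AE x in lborel. P x)"
  unfolding std_gauss_eq by (subst AE_density) auto

text \<open>The Ornstein-Uhlenbeck operator at time t with c = exp(-t); c tending to 1 removes the
  smoothing.\<close>

definition ou :: "real \<Rightarrow> ('a::euclidean_space \<Rightarrow> real) \<Rightarrow> 'a \<Rightarrow> real" where
  "ou c f x = (\<integral>z. f (c *\<^sub>R x + sqrt (1 - c\<^sup>2) *\<^sub>R z) \<partial>std_gauss)"

lemma ou_measurable [measurable]:
  assumes [measurable]: "f \<in> borel_measurable borel"
  shows "ou c f \<in> borel_measurable borel"
  unfolding ou_def[abs_def] by measurable

lemma ou_Icc:
  assumes [measurable]: "f \<in> borel_measurable borel" and "\<And>x. f x \<in> {a..b}"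
  shows "ou c f x \<in> {a..b}"
  unfolding ou_def by (rule integral_std_gauss_Icc) (use assms in auto)

lemma integrable_gauss_norm [simp]: "integrable (std_gauss :: 'a::euclidean_space measure) (\<lambda>z. norm z)"
proof (rule integrable_gauss_dominated[where B=1])
  fix z :: 'a
  note norm_le_weight[of z]
  also have "1 + z \<bullet> z \<le> (1 + z \<bullet> z) ^ 3" by (rule weight_mono) auto
  finally show "\<bar>norm z\<bar> \<le> 1 * (1 + z \<bullet> z) ^ 3" by simp
qed auto

lemma integrable_gauss_exp_affine [simp]:
  "integrable (std_gauss :: 'a::euclidean_space measure) (\<lambda>z. exp (w \<bullet> z - a))"
  using integrable_mult_right[OF integrable_gauss_exp_inner[of w], of "exp (- a)"]
  by (simp add: exp_add[symmetric])

text \<open>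
  With \<open>v = w \<bullet> z - w \<bullet> w / 2\<close> the nonnegative function \<open>exp v - 1 - v\<close> has mean \<open>w \<bullet> w / 2\<close>.
\<close>

lemma gauss_exp_remainder:
  "(\<integral>z. \<bar>exp (w \<bullet> z - w \<bullet> w / 2) - 1 - w \<bullet> z\<bar> \<partial>(std_gauss :: 'a::euclidean_space measure)) \<le> w \<bullet> w"
proof -
  have E: "(\<integral>z. exp (w \<bullet> z - w \<bullet> w / 2) \<partial>(std_gauss :: 'a measure)) = 1"
    by (simp add: exp_diff integral_gauss_exp_inner)
  have "(\<integral>z. \<bar>exp (w \<bullet> z - w \<bullet> w / 2) - 1 - w \<bullet> z\<bar> \<partial>(std_gauss :: 'a measure)) \<le>
    (\<integral>z. exp (w \<bullet> z - w \<bullet> w / 2) - 1 - w \<bullet> z + w \<bullet> w \<partial>(std_gauss :: 'a measure))"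
  proof (rule integral_mono)
    fix z :: 'a
    \<comment> \<open>From exp v >= 1 + v the expression inside is at least -w.w / 2, so its
      absolute value is at most itself plus w.w.\<close>
    show "\<bar>exp (w \<bullet> z - w \<bullet> w / 2) - 1 - w \<bullet> z\<bar> \<le> exp (w \<bullet> z - w \<bullet> w / 2) - 1 - w \<bullet> z + w \<bullet> w"
      using exp_ge_add_one_self[of "w \<bullet> z - w \<bullet> w / 2"] inner_ge_zero[of w] by linarith
  qed auto
  also have "\<dots> = w \<bullet> w" by (simp add: E)
  finally show ?thesis .
qed

text \<open>By the Cameron-Martin formula the increment of the smoothed function is an integral of f
  against an exponential weight. Linearising that weight gives the gradient and, by
  \<open>gauss_exp_remainder\<close>, a quadratic error; no regularity of f enters.\<close>

lemma ou_C11: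
  fixes f :: "'a::euclidean_space \<Rightarrow> real"
  assumes [measurable]: "f \<in> borel_measurable borel" and f: "\<And>x. f x \<in> {0..1}" and c: "0 < c" "c < 1"
  obtains P p where "C11 1 P (ou c f) p"
proof -
  define s where "s = sqrt (1 - c\<^sup>2)"
  have s: "s > 0" using c by (simp add: s_def abs_square_less_1)
  \<comment> \<open>Moving x by u in c x + s z amounts to moving z by (c / s) u.\<close>
  define k where "k = c / s"
  have k: "k > 0" using c s by (simp add: k_def)
  define m where "m = (\<integral>z. norm z \<partial>(std_gauss :: 'a measure))"
  have m: "m \<ge> 0" unfolding m_def by simp
  define p where "p = (\<lambda>x. k *\<^sub>R (\<integral>z. f (c *\<^sub>R x + s *\<^sub>R z) *\<^sub>R z \<partial>std_gauss))"
  have iz: "integrable std_gauss (\<lambda>z. f (y + s *\<^sub>R z) *\<^sub>R z)" for y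
    by (rule Bochner_Integration.integrable_bound[OF integrable_gauss_norm])
       (use f in \<open>auto intro!: AE_I2 mult_left_le_one_le\<close>)
  have ih: "integrable std_gauss (\<lambda>z. f (y + s *\<^sub>R z))" for y
    by (rule integrable_std_gauss_unit) (use f in auto)
  show ?thesis
  \<comment> \<open>\<open>k * m\<close> bounds the gradient and the square of k bounds the
    quadratic error; the sum serves for both.\<close>
  proof (rule that[of "k * m + k\<^sup>2" p], unfold C11_def, intro conjI allI)
    show "ou c f x \<in> {0..1}" for x by (rule ou_Icc) (use f in auto)
    show "norm (p x) \<le> k * m + k\<^sup>2" for x
    proof -
      have "norm (\<integral>z. f (c *\<^sub>R x + s *\<^sub>R z) *\<^sub>R z \<partial>std_gauss) \<le> (\<integral>z. norm (f (c *\<^sub>R x + s *\<^sub>R z) *\<^sub>R z) \<partial>std_gauss)"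
        by (rule integral_norm_bound)
      also have "\<dots> \<le> m" unfolding m_def
      proof (rule integral_mono)
        show "integrable std_gauss (\<lambda>z. norm (f (c *\<^sub>R x + s *\<^sub>R z) *\<^sub>R z))" by (rule integrable_norm[OF iz])
      qed (use f in \<open>auto intro!: mult_left_le_one_le\<close>)
      finally have "norm (p x) \<le> k * m" using k by (simp add: p_def)
      then show ?thesis using zero_le_power2[of k] by linarith
    qed
    fix x u :: 'a
    define w where "w = k *\<^sub>R u"
    define h where "h = (\<lambda>z. f (c *\<^sub>R x + s *\<^sub>R z))"
    have [measurable]: "h \<in> borel_measurable borel" unfolding h_def by measurable
    have h: "0 \<le> h z" "h z \<le> 1" for z using f by (auto simp: h_def)
    have sw: "s *\<^sub>R w = c *\<^sub>R u" using s by (simp add: w_def k_def)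
    have "ou c f (x + u) = (\<integral>z. h (z + w) \<partial>std_gauss)"
      unfolding ou_def h_def s_def[symmetric] scaleR_add_right sw by (simp add: algebra_simps)
    also have "\<dots> = (\<integral>z. exp (w \<bullet> z - w \<bullet> w / 2) * h z \<partial>std_gauss)"
      by (rule integral_std_gauss_shift) (use h in auto)
    finally have o1: "ou c f (x + u) = (\<integral>z. exp (w \<bullet> z - w \<bullet> w / 2) * h z \<partial>std_gauss)" .
    have o2: "ou c f x = (\<integral>z. h z \<partial>std_gauss)" by (simp add: ou_def h_def s_def)
    have "p x \<bullet> u = (\<integral>z. h z *\<^sub>R z \<partial>std_gauss) \<bullet> w" by (simp add: p_def h_def w_def)
    also have "\<dots> = (\<integral>z. h z * (w \<bullet> z) \<partial>std_gauss)"
      using iz[of "c *\<^sub>R x"] by (subst integral_inner_left[symmetric]) (auto simp: h_def inner_commute)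
    finally have o3: "p x \<bullet> u = (\<integral>z. h z * (w \<bullet> z) \<partial>std_gauss)" .
    have hb: "integrable std_gauss (\<lambda>z. exp (w \<bullet> z - w \<bullet> w / 2) * h z)"
      by (rule Bochner_Integration.integrable_bound[OF integrable_gauss_exp_affine[of w "w \<bullet> w / 2"]])
         (use h in \<open>auto intro!: AE_I2 mult_left_le simp: abs_mult\<close>)
    have hc: "integrable std_gauss (\<lambda>z. h z * (w \<bullet> z))"
      using integrable_inner_left[OF iz[of "c *\<^sub>R x"], of w] by (simp add: h_def inner_commute)
    have hh: "integrable std_gauss h" using ih[of "c *\<^sub>R x"] by (simp add: h_def)
    have eq: "ou c f (x + u) - ou c f x - 1 * (p x \<bullet> u) = (\<integral>z. h z * (exp (w \<bullet> z - w \<bullet> w / 2) - 1 - w \<bullet> z) \<partial>std_gauss)"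
      unfolding o1 o2 o3 using hb hc hh by (simp add: algebra_simps)
    have "\<bar>\<integral>z. h z * (exp (w \<bullet> z - w \<bullet> w / 2) - 1 - w \<bullet> z) \<partial>std_gauss\<bar> \<le>
        (\<integral>z. \<bar>h z * (exp (w \<bullet> z - w \<bullet> w / 2) - 1 - w \<bullet> z)\<bar> \<partial>std_gauss)"
      by (rule integral_abs_bound)
    also have "\<dots> \<le> (\<integral>z. \<bar>exp (w \<bullet> z - w \<bullet> w / 2) - 1 - w \<bullet> z\<bar> \<partial>std_gauss)"
    proof (rule integral_mono)
      show "integrable std_gauss (\<lambda>z. \<bar>h z * (exp (w \<bullet> z - w \<bullet> w / 2) - 1 - w \<bullet> z)\<bar>)"
        using hb hc hh by (intro Bochner_Integration.integrable_abs) (simp add: algebra_simps)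
      fix z
      show "\<bar>h z * (exp (w \<bullet> z - w \<bullet> w / 2) - 1 - w \<bullet> z)\<bar> \<le> \<bar>exp (w \<bullet> z - w \<bullet> w / 2) - 1 - w \<bullet> z\<bar>"
        using h[of z] by (simp add: abs_mult mult_left_le_one_le)
    qed auto
    also have "\<dots> \<le> w \<bullet> w" by (rule gauss_exp_remainder)
    also have "\<dots> = k\<^sup>2 * (u \<bullet> u)" by (simp add: w_def power2_eq_square)
    also have "\<dots> \<le> 1\<^sup>2 * (k * m + k\<^sup>2) * (u \<bullet> u)"
      using k m by (simp add: algebra_simps)
    finally show "\<bar>ou c f (x + u) - ou c f x - 1 * (p x \<bullet> u)\<bar> \<le> 1\<^sup>2 * (k * m + k\<^sup>2) * (u \<bullet> u)"
      unfolding eq .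
  qed (unfold p_def, measurable)
qed

text \<open>A measurable function is an a.e. limit of continuous ones; clamping these to [0,1] keeps
  the limit and supplies the dominating constant 1.\<close>

lemma continuous_approx_L1:
  fixes f :: "'a::euclidean_space \<Rightarrow> real"
  assumes [measurable]: "f \<in> borel_measurable borel" and f: "\<And>x. f x \<in> {0..1}" and e: "e > 0"
  obtains h where "continuous_on UNIV h" "\<And>x. h x \<in> {0..1}" "(\<integral>x. \<bar>f x - h x\<bar> \<partial>std_gauss) < e"
proof -
  have "f \<in> borel_measurable lebesgue" using assms(1) by (simp add: measurable_completion)
  then have "f measurable_on UNIV"
    by (rule lebesgue_measurable_imp_measurable_on) (rule sets_completionI_sets, simp)
  then obtain N G where N: "negligible N" and G: "\<And>n. continuous_on UNIV (G n)"
    and lim: "\<And>x. x \<notin> N \<Longrightarrow> (\<lambda>n. G n x) \<longlonglongrightarrow> f x"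
    by (auto simp: measurable_on_def)
  define h where "h = (\<lambda>n x. max 0 (min 1 (G n x)))"
  have hc: "continuous_on UNIV (h n)" for n unfolding h_def by (intro continuous_intros G)
  have h01: "h n x \<in> {0..1}" for n x by (simp add: h_def)
  have [measurable]: "h n \<in> borel_measurable borel" for n
    by (rule borel_measurable_continuous_onI[OF hc])
  have "N \<in> null_sets lebesgue" using N by (simp add: negligible_iff_null_sets)
  then obtain N' where N': "N' \<in> null_sets lborel" "N \<subseteq> N'"
    by (auto simp: null_sets_completion_iff2)
  have ae: "AE x in std_gauss. (\<lambda>n. \<bar>f x - h n x\<bar>) \<longlonglongrightarrow> 0"
    unfolding AE_std_gauss_iff
  proof (rule AE_I'[OF N'(1)])
    have "(\<lambda>n. \<bar>f x - h n x\<bar>) \<longlonglongrightarrow> 0" if "x \<notin> N'" for x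
    proof -
      have "(\<lambda>n. \<bar>f x - h n x\<bar>) \<longlonglongrightarrow> \<bar>f x - max 0 (min 1 (f x))\<bar>"
        unfolding h_def using that N'(2) by (intro tendsto_intros lim) auto
      then show ?thesis using f[of x] by simp
    qed
    then show "{x \<in> space lborel. \<not> (\<lambda>n. \<bar>f x - h n x\<bar>) \<longlonglongrightarrow> 0} \<subseteq> N'" by auto
  qed
  have "(\<lambda>n. \<integral>x. \<bar>f x - h n x\<bar> \<partial>std_gauss) \<longlonglongrightarrow> (\<integral>x. 0 \<partial>(std_gauss :: 'a measure))"
  proof (rule integral_dominated_convergence[where w="\<lambda>_. 1"])
    show "AE x in std_gauss. norm \<bar>f x - h n x\<bar> \<le> 1" for n
    proof (rule AE_I2)
      fix x show "norm \<bar>f x - h n x\<bar> \<le> 1" using f[of x] h01[of n x] by auto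
    qed
  qed (use ae in auto)
  then have "eventually (\<lambda>n. (\<integral>x. \<bar>f x - h n x\<bar> \<partial>std_gauss) < e) sequentially"
    using e by (intro order_tendstoD) auto
  then obtain n where "(\<integral>x. \<bar>f x - h n x\<bar> \<partial>std_gauss) < e" by (auto simp: eventually_sequentially)
  with hc h01 that show ?thesis by blast
qed

text \<open>The absolute value moves inside the average, and averaging at scale (c, s) leaves
  Gaussian integrals unchanged.\<close>

lemma ou_L1_contraction:
  fixes f h :: "'a::euclidean_space \<Rightarrow> real"
  assumes [measurable]: "f \<in> borel_measurable borel" "h \<in> borel_measurable borel"
    and f: "\<And>x. f x \<in> {0..1}" and h: "\<And>x. h x \<in> {0..1}" and c: "0 < c" "c < 1"
  shows "(\<integral>x. \<bar>ou c f x - ou c h x\<bar> \<partial>std_gauss) \<le> (\<integral>x. \<bar>f x - h x\<bar> \<partial>std_gauss)"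
proof -
  let ?s = "sqrt (1 - c\<^sup>2)"
  have s: "?s \<noteq> 0" "c\<^sup>2 + ?s\<^sup>2 = 1" using c abs_square_less_1[of c] by auto
  have b: "\<bar>f x - h y\<bar> \<le> 1" for x y using f[of x] h[of y] by auto
  have i: "integrable std_gauss (\<lambda>z. f (y + ?s *\<^sub>R z))" "integrable std_gauss (\<lambda>z. h (y + ?s *\<^sub>R z))" for y
    by (rule integrable_std_gauss_unit; use f h in auto)+
  have "(\<integral>x. \<bar>ou c f x - ou c h x\<bar> \<partial>std_gauss) \<le>
     (\<integral>x. \<integral>z. \<bar>f (c *\<^sub>R x + ?s *\<^sub>R z) - h (c *\<^sub>R x + ?s *\<^sub>R z)\<bar> \<partial>std_gauss \<partial>std_gauss)"
  proof (rule integral_mono)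
    show "integrable std_gauss (\<lambda>x. \<bar>ou c f x - ou c h x\<bar>)"
    proof (rule integrable_std_gauss_bounded[where B=1])
      fix x
      have "ou c f x \<in> {0..1}" "ou c h x \<in> {0..1}" by (rule ou_Icc; use f h in simp)+
      then show "\<bar>\<bar>ou c f x - ou c h x\<bar>\<bar> \<le> 1" by auto
    qed measurable
    show "integrable std_gauss (\<lambda>x. \<integral>z. \<bar>f (c *\<^sub>R x + ?s *\<^sub>R z) - h (c *\<^sub>R x + ?s *\<^sub>R z)\<bar> \<partial>std_gauss)"
    proof (rule integrable_std_gauss_bounded[where B=1])
      fix x
      have "(\<integral>z. \<bar>f (c *\<^sub>R x + ?s *\<^sub>R z) - h (c *\<^sub>R x + ?s *\<^sub>R z)\<bar> \<partial>std_gauss) \<in> {0..1}"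
        by (rule integral_std_gauss_Icc) (use b in auto)
      then show "\<bar>\<integral>z. \<bar>f (c *\<^sub>R x + ?s *\<^sub>R z) - h (c *\<^sub>R x + ?s *\<^sub>R z)\<bar> \<partial>std_gauss\<bar> \<le> 1" by auto
    qed measurable
    fix x
    have "ou c f x - ou c h x = (\<integral>z. f (c *\<^sub>R x + ?s *\<^sub>R z) - h (c *\<^sub>R x + ?s *\<^sub>R z) \<partial>std_gauss)"
      unfolding ou_def using i by simp
    then show "\<bar>ou c f x - ou c h x\<bar> \<le> (\<integral>z. \<bar>f (c *\<^sub>R x + ?s *\<^sub>R z) - h (c *\<^sub>R x + ?s *\<^sub>R z)\<bar> \<partial>std_gauss)"
      using integral_abs_bound by metis
  qed
  also have "\<dots> = (\<integral>x. \<bar>f x - h x\<bar> \<partial>std_gauss)"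
    by (rule integral_std_gauss_mix[symmetric, where B=1]) (use b s in auto)
  finally show ?thesis .
qed

text \<open>For continuous h the integrand of the smoothing tends to h x at every (x, z), and
  dominated convergence applies on the product space.\<close>

lemma ou_tendsto_L1_continuous:
  fixes h :: "'a::euclidean_space \<Rightarrow> real"
  assumes hc: "continuous_on UNIV h" and h: "\<And>x. h x \<in> {0..1}"
    and c: "\<And>n. 0 < c n" "\<And>n. c n < 1" "c \<longlonglongrightarrow> 1"
  shows "(\<lambda>n. \<integral>x. \<bar>ou (c n) h x - h x\<bar> \<partial>std_gauss) \<longlonglongrightarrow> 0"
proof -
  have [measurable]: "h \<in> borel_measurable borel" by (rule borel_measurable_continuous_onI[OF hc])
  define s where "s = (\<lambda>n. sqrt (1 - (c n)\<^sup>2))"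
  have b: "\<bar>h x - h y\<bar> \<le> 1" for x y using h[of x] h[of y] by auto
  have ib: "integrable (std_gauss \<Otimes>\<^sub>M std_gauss) (\<lambda>p. \<bar>h (c n *\<^sub>R fst p + s n *\<^sub>R snd p) - h (fst p)\<bar>)" for n
    by (rule std_gauss_pair.integrable_const_bound[where B=1]) (use b in auto)
  have le: "(\<integral>x. \<bar>ou (c n) h x - h x\<bar> \<partial>std_gauss) \<le>
      (\<integral>p. \<bar>h (c n *\<^sub>R fst p + s n *\<^sub>R snd p) - h (fst p)\<bar> \<partial>(std_gauss \<Otimes>\<^sub>M std_gauss))" for n
  proof -
    have "(\<integral>x. \<bar>ou (c n) h x - h x\<bar> \<partial>std_gauss) \<le>
        (\<integral>x. \<integral>z. \<bar>h (c n *\<^sub>R x + s n *\<^sub>R z) - h x\<bar> \<partial>std_gauss \<partial>std_gauss)"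
    proof (rule integral_mono)
      show "integrable std_gauss (\<lambda>x. \<bar>ou (c n) h x - h x\<bar>)"
      proof (rule integrable_std_gauss_bounded[where B=1])
        fix x
        have "ou (c n) h x \<in> {0..1}" by (rule ou_Icc) (use h in simp_all)
        then show "\<bar>\<bar>ou (c n) h x - h x\<bar>\<bar> \<le> 1" using h[of x] by auto
      qed measurable
      show "integrable std_gauss (\<lambda>x. \<integral>z. \<bar>h (c n *\<^sub>R x + s n *\<^sub>R z) - h x\<bar> \<partial>std_gauss)"
        using std_gauss_pair.integrable_fst'[OF ib[of n]] by simp
      fix x
      have "integrable std_gauss (\<lambda>z. h (c n *\<^sub>R x + s n *\<^sub>R z))"
        by (rule integrable_std_gauss_unit) (use h in auto)
      then have "ou (c n) h x - h x = (\<integral>z. h (c n *\<^sub>R x + s n *\<^sub>R z) - h x \<partial>std_gauss)"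
        by (simp add: ou_def s_def)
      then show "\<bar>ou (c n) h x - h x\<bar> \<le> (\<integral>z. \<bar>h (c n *\<^sub>R x + s n *\<^sub>R z) - h x\<bar> \<partial>std_gauss)"
        using integral_abs_bound by metis
    qed
    also have "\<dots> = (\<integral>p. \<bar>h (c n *\<^sub>R fst p + s n *\<^sub>R snd p) - h (fst p)\<bar> \<partial>(std_gauss \<Otimes>\<^sub>M std_gauss))"
      using std_gauss_pair.integral_fst'[OF ib[of n]] by simp
    finally show ?thesis .
  qed
  have "s \<longlonglongrightarrow> sqrt (1 - 1\<^sup>2)" unfolding s_def by (intro tendsto_intros c)
  then have s: "s \<longlonglongrightarrow> 0" by simp
  have "(\<lambda>n. \<integral>p. \<bar>h (c n *\<^sub>R fst p + s n *\<^sub>R snd p) - h (fst p)\<bar> \<partial>(std_gauss \<Otimes>\<^sub>M std_gauss)) \<longlonglongrightarrow>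
      (\<integral>p. 0 \<partial>(std_gauss \<Otimes>\<^sub>M std_gauss :: ('a \<times> 'a) measure))"
  proof (rule integral_dominated_convergence[where w="\<lambda>_. 1"])
    have "(\<lambda>n. \<bar>h (c n *\<^sub>R fst p + s n *\<^sub>R snd p) - h (fst p)\<bar>) \<longlonglongrightarrow> 0" for p
    proof -
      have "(\<lambda>n. c n *\<^sub>R fst p + s n *\<^sub>R snd p) \<longlonglongrightarrow> 1 *\<^sub>R fst p + 0 *\<^sub>R snd p"
        by (intro tendsto_intros c s)
      then have "(\<lambda>n. h (c n *\<^sub>R fst p + s n *\<^sub>R snd p)) \<longlonglongrightarrow> h (fst p)"
        using continuous_on_tendsto_compose[OF hc] by simp
      then show ?thesis by (intro tendsto_rabs_zero) (simp add: LIM_zero)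
    qed
    then show "AE p in std_gauss \<Otimes>\<^sub>M std_gauss. (\<lambda>n. \<bar>h (c n *\<^sub>R fst p + s n *\<^sub>R snd p) - h (fst p)\<bar>) \<longlonglongrightarrow> 0"
      by simp
    show "AE p in std_gauss \<Otimes>\<^sub>M std_gauss. norm \<bar>h (c n *\<^sub>R fst p + s n *\<^sub>R snd p) - h (fst p)\<bar> \<le> 1" for n
      using b by simp
    have "prob_space (std_gauss \<Otimes>\<^sub>M std_gauss :: ('a \<times> 'a) measure)" by unfold_locales
    then show "integrable (std_gauss \<Otimes>\<^sub>M std_gauss) (\<lambda>_ :: 'a \<times> 'a. 1 :: real)"
      by (simp add: finite_measure.integrable_const prob_space.finite_measure)
  qed auto
  then have lim: "(\<lambda>n. \<integral>p. \<bar>h (c n *\<^sub>R fst p + s n *\<^sub>R snd p) - h (fst p)\<bar> \<partial>(std_gauss \<Otimes>\<^sub>M std_gauss)) \<longlonglongrightarrow> 0"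
    by simp
  show ?thesis
  proof (rule tendsto_sandwich[OF _ _ tendsto_const lim])
    show "\<forall>\<^sub>F n in sequentially. 0 \<le> (\<integral>x. \<bar>ou (c n) h x - h x\<bar> \<partial>std_gauss)" by simp
  qed (intro always_eventually allI le)
qed

text \<open>A three-epsilon argument through a continuous approximation; contraction makes the
  approximation error uniform in n.\<close>

lemma ou_tendsto_L1:
  fixes f :: "'a::euclidean_space \<Rightarrow> real"
  assumes [measurable]: "f \<in> borel_measurable borel" and f: "\<And>x. f x \<in> {0..1}"
    and c: "\<And>n. 0 < c n" "\<And>n. c n < 1" "c \<longlonglongrightarrow> 1"
  shows "(\<lambda>n. \<integral>x. \<bar>ou (c n) f x - f x\<bar> \<partial>std_gauss) \<longlonglongrightarrow> 0"
proof (rule LIMSEQ_I)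
  fix e :: real assume e: "e > 0"
  obtain h where hc: "continuous_on UNIV h" and h: "\<And>x. h x \<in> {0..1}" and fh: "(\<integral>x. \<bar>f x - h x\<bar> \<partial>std_gauss) < e / 3"
    using continuous_approx_L1[OF assms(1) f, of "e/3"] e by auto
  have [measurable]: "h \<in> borel_measurable borel" by (rule borel_measurable_continuous_onI[OF hc])
  have "eventually (\<lambda>n. (\<integral>x. \<bar>ou (c n) h x - h x\<bar> \<partial>std_gauss) < e / 3) sequentially"
    using e by (intro order_tendstoD(2)[OF ou_tendsto_L1_continuous[OF hc h c]]) auto
  then obtain N where N: "\<And>n. n \<ge> N \<Longrightarrow> (\<integral>x. \<bar>ou (c n) h x - h x\<bar> \<partial>std_gauss) < e / 3"
    by (auto simp: eventually_sequentially)
  have "norm ((\<integral>x. \<bar>ou (c n) f x - f x\<bar> \<partial>std_gauss) - 0) < e" if "n \<ge> N" for n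
  proof -
    have i: "integrable std_gauss f" "integrable std_gauss h" "integrable std_gauss (ou (c n) f)" "integrable std_gauss (ou (c n) h)"
      by (rule integrable_std_gauss_unit; use f h ou_Icc[of f 0 1 "c n"] ou_Icc[of h 0 1 "c n"] in simp)+
    have "(\<integral>x. \<bar>ou (c n) f x - f x\<bar> \<partial>std_gauss) \<le>
       (\<integral>x. \<bar>ou (c n) f x - ou (c n) h x\<bar> + \<bar>ou (c n) h x - h x\<bar> + \<bar>f x - h x\<bar> \<partial>std_gauss)"
      by (rule integral_mono) (use i in auto)
    also have "\<dots> = (\<integral>x. \<bar>ou (c n) f x - ou (c n) h x\<bar> \<partial>std_gauss) + (\<integral>x. \<bar>ou (c n) h x - h x\<bar> \<partial>std_gauss)
        + (\<integral>x. \<bar>f x - h x\<bar> \<partial>std_gauss)"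
      using i by simp
    also have "\<dots> < e"
      using ou_L1_contraction[of f h "c n"] f h c N[OF that] fh by auto
    finally show ?thesis by simp
  qed
  then show "\<exists>N. \<forall>n\<ge>N. norm ((\<integral>x. \<bar>ou (c n) f x - f x\<bar> \<partial>std_gauss) - 0) < e" by blast
qed

lemma C11_mono: "C11 l P f p \<Longrightarrow> P \<le> P' \<Longrightarrow> C11 l P' f p"
  unfolding C11_def by (meson inner_ge_zero mult_left_mono mult_right_mono order_trans zero_le_power2)

text \<open>This contraction sends [0,1] into [e, 1-e], where the derivatives of \<open>J\<close>
  are bounded, without enlarging P.\<close>

lemma C11_affine:
  assumes "C11 l P f p" "0 \<le> e" "e \<le> 1/2"
  shows "C11 l P (\<lambda>x. (1 - 2 * e) * f x + e) (\<lambda>x. (1 - 2 * e) *\<^sub>R p x)"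
proof -
  note [measurable] = C11_D(1,2)[OF assms(1)]
  have k: "0 \<le> 1 - 2 * e" "1 - 2 * e \<le> 1" using assms by auto
  show ?thesis
    unfolding C11_def
  proof (intro conjI allI)
    fix x u
    have "(1 - 2 * e) * f x \<le> 1 - 2 * e" using C11_D(4)[OF assms(1), of x] k by (simp add: mult_left_le)
    moreover have "0 \<le> (1 - 2 * e) * f x" using C11_D(3)[OF assms(1), of x] k by simp
    ultimately show "(1 - 2 * e) * f x + e \<in> {0..1}" using assms by auto
    have "\<bar>1 - 2 * e\<bar> * norm (p x) \<le> norm (p x)" using k by (intro mult_left_le_one_le) auto
    then show "norm ((1 - 2 * e) *\<^sub>R p x) \<le> P" using C11_D(5)[OF assms(1), of x] by simp
    have "(1 - 2 * e) * f (x + u) + e - ((1 - 2 * e) * f x + e) - l * (((1 - 2 * e) *\<^sub>R p x) \<bullet> u) =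
       (1 - 2 * e) * (f (x + u) - f x - l * (p x \<bullet> u))" by (simp add: algebra_simps)
    moreover have "\<bar>(1 - 2 * e) * (f (x + u) - f x - l * (p x \<bullet> u))\<bar> \<le> \<bar>f (x + u) - f x - l * (p x \<bullet> u)\<bar>"
      using k unfolding abs_mult by (intro mult_left_le_one_le) auto
    ultimately show "\<bar>(1 - 2 * e) * f (x + u) + e - ((1 - 2 * e) * f x + e) - l * (((1 - 2 * e) *\<^sub>R p x) \<bullet> u)\<bar>
        \<le> l\<^sup>2 * P * (u \<bullet> u)"
      using C11_D(6)[OF assms(1), of x u] by linarith
  qed measurable
qed

section \<open>Passage from smooth to measurable functions\<close>

context
  fixes \<rho> :: real
  assumes r: "-1 < \<rho>" "\<rho> < 1"
begin

text \<open>\<open>J\<close> is 1-Lipschitz in each variable and both marginals are standard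
  Gaussian, so each of the two terms of the deficit changes by at most the sum of the L1 distances;
  the factor 2 counts the two terms.\<close>

lemma deficit_lipschitz:
  fixes f g f' g' :: "'a::euclidean_space \<Rightarrow> real"
  assumes [measurable]: "f \<in> borel_measurable borel" "g \<in> borel_measurable borel"
      "f' \<in> borel_measurable borel" "g' \<in> borel_measurable borel"
    and f: "\<And>x. f x \<in> {0..1}" and g: "\<And>x. g x \<in> {0..1}"
    and f': "\<And>x. f' x \<in> {0..1}" and g': "\<And>x. g' x \<in> {0..1}"
  shows "\<bar>deficit \<rho> f g - deficit \<rho> f' g'\<bar> \<le>
    2 * ((\<integral>x. \<bar>f x - f' x\<bar> \<partial>std_gauss) + (\<integral>x. \<bar>g x - g' x\<bar> \<partial>std_gauss))"
proof -
  let ?A = "\<integral>x. \<bar>f x - f' x\<bar> \<partial>std_gauss" and ?B = "\<integral>x. \<bar>g x - g' x\<bar> \<partial>std_gauss"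
  have i: "integrable std_gauss f" "integrable std_gauss g" "integrable std_gauss f'" "integrable std_gauss g'"
    by (rule integrable_std_gauss_unit; use f g f' g' in simp)+
  have m: "\<bar>(\<integral>x. h x \<partial>std_gauss) - (\<integral>x. k x \<partial>std_gauss)\<bar> \<le> (\<integral>x. \<bar>h x - k x\<bar> \<partial>std_gauss)"
    if "integrable std_gauss h" "integrable std_gauss k" for h k :: "'a \<Rightarrow> real"
    using integral_abs_bound[of std_gauss "\<lambda>x. h x - k x"] that by simp
  have 1: "\<bar>J (\<integral>x. f x \<partial>std_gauss) (\<integral>x. g x \<partial>std_gauss) \<rho> - J (\<integral>x. f' x \<partial>std_gauss) (\<integral>x. g' x \<partial>std_gauss) \<rho>\<bar> \<le> ?A + ?B"
    by (rule order_trans[OF J_lipschitz[OF r]]) (intro add_mono m i)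
  have iJ: "integrable (gauss_pair \<rho>) (\<lambda>p. J (f (fst p)) (g (snd p)) \<rho>)" "integrable (gauss_pair \<rho>) (\<lambda>p. J (f' (fst p)) (g' (snd p)) \<rho>)"
    by (rule integrable_J[OF r]; measurable)+
  have ia: "integrable (gauss_pair \<rho>) (\<lambda>p. \<bar>f (fst p) - f' (fst p)\<bar>)" "integrable (gauss_pair \<rho>) (\<lambda>p. \<bar>g (snd p) - g' (snd p)\<bar>)"
    using integrable_gauss_pair_fst[of "\<lambda>x. \<bar>f x - f' x\<bar>"] integrable_gauss_pair_snd[OF r, of "\<lambda>x. \<bar>g x - g' x\<bar>"] i by auto
  have "\<bar>(\<integral>p. J (f (fst p)) (g (snd p)) \<rho> \<partial>gauss_pair \<rho>) - (\<integral>p. J (f' (fst p)) (g' (snd p)) \<rho> \<partial>gauss_pair \<rho>)\<bar>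
     = \<bar>\<integral>p. J (f (fst p)) (g (snd p)) \<rho> - J (f' (fst p)) (g' (snd p)) \<rho> \<partial>gauss_pair \<rho>\<bar>"
    using iJ by simp
  also have "\<dots> \<le> (\<integral>p. \<bar>J (f (fst p)) (g (snd p)) \<rho> - J (f' (fst p)) (g' (snd p)) \<rho>\<bar> \<partial>gauss_pair \<rho>)"
    by (rule integral_abs_bound)
  also have "\<dots> \<le> (\<integral>p. \<bar>f (fst p) - f' (fst p)\<bar> + \<bar>g (snd p) - g' (snd p)\<bar> \<partial>gauss_pair \<rho>)"
    by (rule integral_mono) (use iJ ia J_lipschitz[OF r] in auto)
  also have "\<dots> = ?A + ?B"
    using ia integral_gauss_pair_fst[of "\<lambda>x. \<bar>f x - f' x\<bar>" \<rho>] integral_gauss_pair_snd[OF r, of "\<lambda>x. \<bar>g x - g' x\<bar>"] by simp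
  finally have 2: "\<bar>(\<integral>p. J (f (fst p)) (g (snd p)) \<rho> \<partial>gauss_pair \<rho>) - (\<integral>p. J (f' (fst p)) (g' (snd p)) \<rho> \<partial>gauss_pair \<rho>)\<bar> \<le> ?A + ?B" .
  have 3: "\<bar>deficit \<rho> f g - deficit \<rho> f' g'\<bar> \<le>
    \<bar>(J (\<integral>x. f x \<partial>std_gauss) (\<integral>x. g x \<partial>std_gauss) \<rho> - J (\<integral>x. f' x \<partial>std_gauss) (\<integral>x. g' x \<partial>std_gauss) \<rho>) -
     ((\<integral>p. J (f (fst p)) (g (snd p)) \<rho> \<partial>gauss_pair \<rho>) - (\<integral>p. J (f' (fst p)) (g' (snd p)) \<rho> \<partial>gauss_pair \<rho>))\<bar>"
    unfolding deficit_def right_diff_distrib[symmetric] abs_mult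
    by (rule order_trans[OF mult_left_le_one_le]) (auto simp: sgn_if algebra_simps)
  have "a \<le> 2 * c" if "\<bar>x\<bar> \<le> c" "\<bar>y\<bar> \<le> c" "a \<le> \<bar>x - y\<bar>" for a c x y :: real
    using that by linarith
  from this[OF 1 2 3] show ?thesis .
qed

text \<open>Borell's inequality in functional form.\<close>

lemma deficit_nonneg:
  fixes f g :: "'a::euclidean_space \<Rightarrow> real"
  assumes [measurable]: "f \<in> borel_measurable borel" "g \<in> borel_measurable borel"
    and f: "\<And>x. f x \<in> {0..1}" and g: "\<And>x. g x \<in> {0..1}"
  shows "deficit \<rho> f g \<ge> 0"
proof -
  \<comment> \<open>Starting at 1/3 keeps e n below 1/2, as \<open>C11_affine\<close> requires, and
    c n inside (0,1). The same sequence drives smoothing and contraction.\<close>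
  define e :: "nat \<Rightarrow> real" where "e = (\<lambda>n. 1 / real (n + 3))"
  define c where "c = (\<lambda>n. 1 - e n)"
  have e: "0 < e n" "e n \<le> 1/2" for n by (auto simp: e_def field_simps)
  have e0: "e \<longlonglongrightarrow> 0" unfolding e_def
    using LIMSEQ_ignore_initial_segment[OF lim_1_over_n, of 3] by simp
  have c: "0 < c n" "c n < 1" for n using e[of n] by (auto simp: c_def)
  have "c \<longlonglongrightarrow> 1 - 0" unfolding c_def by (intro tendsto_intros e0)
  then have c1: "c \<longlonglongrightarrow> 1" by simp
  define F where "F = (\<lambda>n h (x::'a). (1 - 2 * e n) * ou (c n) h x + e n :: real)"
  have F: "F n h x \<in> {e n..1 - e n}" "F n h x \<in> {0..1}" "\<bar>F n h x - ou (c n) h x\<bar> \<le> e n"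
    if [measurable]: "h \<in> borel_measurable borel" and h: "\<And>x. h x \<in> {0..1}" for n h and x :: 'a
  proof -
    have o: "ou (c n) h x \<in> {0..1}" by (rule ou_Icc) (use h in auto)
    have "(1 - 2 * e n) * ou (c n) h x \<in> {0..1 - 2 * e n}" using o e[of n] by (auto intro: mult_left_le)
    then show "F n h x \<in> {e n..1 - e n}" by (auto simp: F_def)
    then show "F n h x \<in> {0..1}" using e[of n] by auto
    have "F n h x - ou (c n) h x = e n * (1 - 2 * ou (c n) h x)" by (simp add: F_def algebra_simps)
    also have "\<bar>\<dots>\<bar> \<le> e n * 1" unfolding abs_mult using e[of n] o by (intro mult_mono) auto
    finally show "\<bar>F n h x - ou (c n) h x\<bar> \<le> e n" by simp
  qed
  have Fm: "F n h \<in> borel_measurable borel" if [measurable]: "h \<in> borel_measurable borel" for n and h :: "'a \<Rightarrow> real"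
    unfolding F_def by measurable
  have FL: "(\<integral>x. \<bar>h x - F n h x\<bar> \<partial>std_gauss) \<le> (\<integral>x. \<bar>ou (c n) h x - h x\<bar> \<partial>std_gauss) + e n"
    if [measurable]: "h \<in> borel_measurable borel" and h: "\<And>x. h x \<in> {0..1}" for n and h :: "'a \<Rightarrow> real"
  proof -
    have i: "integrable std_gauss h" "integrable std_gauss (F n h)" "integrable std_gauss (ou (c n) h)"
      by (rule integrable_std_gauss_unit; use h F(2)[of h n] Fm[of h n] ou_Icc[of h 0 1 "c n"] in simp)+
    have "(\<integral>x. \<bar>h x - F n h x\<bar> \<partial>std_gauss) \<le> (\<integral>x. \<bar>ou (c n) h x - h x\<bar> + e n \<partial>std_gauss)"
    proof (rule integral_mono)
      fix x show "\<bar>h x - F n h x\<bar> \<le> \<bar>ou (c n) h x - h x\<bar> + e n" using F(3)[of h n x] h by fastforce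
    qed (use i in auto)
    then show ?thesis using i by simp
  qed
  have D: "0 \<le> deficit \<rho> (F n f) (F n g)" for n
  proof -
    obtain P p where p: "C11 1 P (ou (c n) f) p" using ou_C11[of f "c n"] f c by auto
    obtain Q q where q: "C11 1 Q (ou (c n) g) q" using ou_C11[of g "c n"] g c by auto
    show ?thesis
      unfolding F_def
      by (rule deficit_nonneg_C11[OF r e(1)[of n]
            C11_affine[OF C11_mono[OF p max.cobounded1[of P Q]] less_imp_le[OF e(1)] e(2)]
            C11_affine[OF C11_mono[OF q max.cobounded2[of Q P]] less_imp_le[OF e(1)] e(2)]])
         (use F(1)[of f n] F(1)[of g n] f g in \<open>auto simp: F_def\<close>)
  qed
  \<comment> \<open>An upper bound for the change of the deficit when f and g are replaced by their
    approximations; it tends to 0, so the sign passes to the limit.\<close>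
  define a where "a = (\<lambda>n. 2 * (((\<integral>x. \<bar>ou (c n) f x - f x\<bar> \<partial>std_gauss) + e n) + ((\<integral>x. \<bar>ou (c n) g x - g x\<bar> \<partial>std_gauss) + e n)))"
  have "a \<longlonglongrightarrow> 2 * ((0 + 0) + (0 + 0))"
    unfolding a_def by (intro tendsto_intros e0 ou_tendsto_L1 f g c c1 assms)
  then have "(\<lambda>n. deficit \<rho> f g + a n) \<longlonglongrightarrow> deficit \<rho> f g + 0" by (intro tendsto_intros) auto
  moreover have "0 \<le> deficit \<rho> f g + a n" for n
    using deficit_lipschitz[of f g "F n f" "F n g"] D[of n] FL[of f n] FL[of g n] f g F(2)[of f n] F(2)[of g n] Fm
    unfolding a_def by fastforce
  ultimately show ?thesis by (metis LIMSEQ_le_const add_0_right)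
qed

end

section \<open>The equality case\<close>

lemma C11_has_derivative:
  assumes "C11 1 P f p"
  shows "(f has_derivative (\<lambda>u. p x \<bullet> u)) (at x)"
  unfolding has_derivative_at
proof (intro conjI)
  show "bounded_linear (\<lambda>u. p x \<bullet> u)" by (rule bounded_linear_inner_right)
  have bound: "norm (norm (f (x + h) - f x - p x \<bullet> h) / norm h) \<le> P * norm h" for h
    using C11_D(6)[OF assms, of x h]
    by (cases "h = 0") (simp_all add: power2_norm_eq_inner[symmetric] power2_eq_square field_simps)
  have lim: "((\<lambda>h. P * norm h) \<longlongrightarrow> 0) (at 0)"
    by (rule tendsto_mult_right_zero, rule tendsto_norm_zero, rule tendsto_ident_at)
  show "(\<lambda>h. norm (f (x + h) - f x - p x \<bullet> h) / norm h) \<midarrow>0\<rightarrow> 0"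
    by (rule Lim_null_comparison[OF always_eventually[OF allI[OF bound]] lim])
qed

text \<open>The Mehler kernel is strictly positive, so a vanishing average at a single point forces
  the nonnegative function to vanish a.e.\<close>

lemma ou_zero_imp_AE:
  fixes f :: "'a::euclidean_space \<Rightarrow> real"
  assumes [measurable]: "f \<in> borel_measurable borel" and f: "\<And>x. f x \<in> {0..1}" and c: "0 < c" "c < 1"
    and 0: "ou c f x = 0"
  shows "AE x in std_gauss. f x = 0"
proof -
  let ?s = "sqrt (1 - c\<^sup>2)"
  have s: "?s \<noteq> 0" using c abs_square_less_1[of c] by auto
  have "integrable std_gauss (\<lambda>z. f (c *\<^sub>R x + ?s *\<^sub>R z))"
    by (rule integrable_std_gauss_unit) (use f in simp_all)
  then have "(\<integral>\<^sup>+z. ennreal (f (c *\<^sub>R x + ?s *\<^sub>R z)) \<partial>std_gauss) = 0"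
    using 0 f by (subst nn_integral_eq_integral) (auto simp: ou_def)
  then have "(\<integral>\<^sup>+w. mehler c ?s x w * ennreal (f w) \<partial>lborel) = 0"
    by (subst nn_integral_std_gauss_affine[OF _ s, symmetric]) auto
  then have "AE w in lborel. mehler c ?s x w * ennreal (f w) = 0"
    by (subst (asm) nn_integral_0_iff_AE) auto
  moreover have "ennreal (mehler c ?s x w) \<noteq> 0" for w using s by (simp add: mehler_def)
  ultimately show ?thesis
    unfolding AE_std_gauss_iff using f by (auto elim!: eventually_mono simp: order_antisym)
qed

text \<open>The upper bound is the lower bound for 1 - f. It places every smoothed value where
  \<open>quantile\<close> is differentiable while leaving the function itself unaltered.\<close>

lemma ou_strict_bounds:
  fixes f :: "'a::euclidean_space \<Rightarrow> real"
  assumes [measurable]: "f \<in> borel_measurable borel" and f: "\<And>x. f x \<in> {0..1}" and c: "0 < c" "c < 1"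
    and n0: "\<not> (AE x in std_gauss. f x = 0)" and n1: "\<not> (AE x in std_gauss. f x = 1)"
  shows "0 < ou c f x" "ou c f x < 1"
proof -
  have o: "ou c f x \<in> {0..1}" by (rule ou_Icc) (use f in simp_all)
  moreover have "ou c f x \<noteq> 0" using ou_zero_imp_AE[OF assms(1) f c] n0 by blast
  moreover have "ou c f x \<noteq> 1"
  proof
    assume "ou c f x = 1"
    moreover have "integrable std_gauss (\<lambda>z. f (c *\<^sub>R x + sqrt (1 - c\<^sup>2) *\<^sub>R z))"
      by (rule integrable_std_gauss_unit) (use f in simp_all)
    ultimately have "ou c (\<lambda>x. 1 - f x) x = 0" by (simp add: ou_def)
    then have "AE x in std_gauss. 1 - f x = 0"
      by (rule ou_zero_imp_AE[rotated 4]) (use f c in auto)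
    with n1 show False by simp
  qed
  ultimately show "0 < ou c f x" "ou c f x < 1" by auto
qed

lemma AE_std_gauss_open:
  assumes "open U" "AE x in (std_gauss :: 'a::euclidean_space measure). x \<notin> U"
  shows "U = {}"
proof (rule ccontr)
  assume "U \<noteq> {}"
  have "AE x in lborel. x \<notin> U" using assms(2) by (simp add: AE_std_gauss_iff)
  then have "U \<in> null_sets lborel" using assms(1) by (simp add: AE_iff_null_sets)
  then have "negligible U" by (simp add: negligible_iff_null_sets null_sets_completionI)
  with open_not_negligible[OF assms(1) \<open>U \<noteq> {}\<close>] show False by simp
qed

section \<open>From zero deficit to every base point and scale\<close>

context
  fixes \<rho> :: real
  assumes r: "-1 < \<rho>" "\<rho> < 1"
begin

text \<open>The pair has full support: it is the image of a Gaussian with positive density under a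
  continuous linear map, onto because tau > 0. Hence x and y may later be chosen independently of
  each other.\<close>

lemma AE_gauss_pair_open:
  assumes U: "open U" and ae: "AE x in (gauss_pair \<rho> :: ('a::euclidean_space \<times> 'a) measure). x \<notin> U"
  shows "U = {}"
proof -
  define L where "L = (\<lambda>p::'a\<times>'a. (fst p, \<rho> *\<^sub>R fst p + sqrt (1 - \<rho>\<^sup>2) *\<^sub>R snd p))"
  have Lc: "continuous_on UNIV L" unfolding L_def by (intro continuous_intros)
  have [measurable]: "L \<in> borel_measurable borel" by (rule borel_measurable_continuous_onI[OF Lc])
  have [measurable]: "U \<in> sets borel" using U by simp
  have "AE x in distr (std_gauss :: ('a\<times>'a) measure) borel L. x \<notin> U"
    using ae unfolding gauss_pair_eq L_def .
  then have "AE x in (std_gauss :: ('a\<times>'a) measure). x \<notin> L -` U"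
    by (subst (asm) AE_distr_iff) auto
  moreover have "open (L -` U)" by (rule open_vimage[OF U Lc])
  ultimately have "L -` U = {}" by (rule AE_std_gauss_open[rotated])
  moreover have "\<exists>z. L z = w" for w
    using tau[OF r] by (intro exI[of _ "(fst w, (snd w - \<rho> *\<^sub>R fst w) /\<^sub>R tau \<rho>)"])
      (simp add: L_def tau_def[OF r] prod_eq_iff)
  ultimately show ?thesis by blast
qed

text \<open>By \<open>deficit_nonneg\<close> both terms of the splitting are nonnegative, as is the
  integrand of the second; a zero sum annihilates all of them.\<close>

lemma deficit_zero_ou:
  fixes f g :: "'a::euclidean_space \<Rightarrow> real"
  assumes [measurable]: "f \<in> borel_measurable borel" "g \<in> borel_measurable borel"
    and f: "\<And>x. f x \<in> {0..1}" and g: "\<And>x. g x \<in> {0..1}" and c: "0 < c" "c < 1"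
    and d: "deficit \<rho> f g = 0"
  shows "deficit \<rho> (ou c f) (ou c g) = 0"
    and "AE w in gauss_pair \<rho>. deficit \<rho> (\<lambda>z. f (c *\<^sub>R fst w + sqrt (1 - c\<^sup>2) *\<^sub>R z)) (\<lambda>z. g (c *\<^sub>R snd w + sqrt (1 - c\<^sup>2) *\<^sub>R z)) = 0"
proof -
  let ?s = "sqrt (1 - c\<^sup>2)"
  let ?D = "\<lambda>w. deficit \<rho> (\<lambda>z. f (c *\<^sub>R fst w + ?s *\<^sub>R z)) (\<lambda>z. g (c *\<^sub>R snd w + ?s *\<^sub>R z))"
  have s: "?s \<noteq> 0" "c\<^sup>2 + ?s\<^sup>2 = 1" using c abs_square_less_1[of c] by auto
  have eq: "deficit \<rho> f g = deficit \<rho> (ou c f) (ou c g) + (\<integral>w. ?D w \<partial>gauss_pair \<rho>)"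
    unfolding ou_def[abs_def] by (rule deficit_split(1)[OF r]) (use f g s in simp_all)
  have int: "integrable (gauss_pair \<rho>) ?D"
    by (rule deficit_split(2)[OF r]) (use f g s in simp_all)
  have D: "?D w \<ge> 0" for w by (rule deficit_nonneg[OF r]) (use f g in simp_all)
  have "deficit \<rho> (ou c f) (ou c g) \<ge> 0"
  proof (rule deficit_nonneg[OF r])
    fix x show "ou c f x \<in> {0..1}" "ou c g x \<in> {0..1}" by (rule ou_Icc; use f g in simp)+
  qed measurable
  moreover have "(\<integral>w. ?D w \<partial>gauss_pair \<rho>) \<ge> 0" using D by (intro Bochner_Integration.integral_nonneg)
  ultimately have "deficit \<rho> (ou c f) (ou c g) = 0" "(\<integral>w. ?D w \<partial>gauss_pair \<rho>) = 0" using eq d by linarith+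
  then show "deficit \<rho> (ou c f) (ou c g) = 0" "AE w in gauss_pair \<rho>. ?D w = 0"
    using integral_nonneg_eq_0_iff_AE[OF int] D by auto
qed

text \<open>
  The deficit of the translates is continuous in the base point,
  so it vanishes everywhere and not only almost everywhere.
\<close>

lemma deficit_zero_local:
  fixes f g :: "'a::euclidean_space \<Rightarrow> real"
  assumes fp: "C11 1 P f p" and gq: "C11 1 P g q" and d: "deficit \<rho> f g = 0" and l: "0 < l" "l < 1"
  shows "deficit \<rho> (\<lambda>z. f (x + l *\<^sub>R z)) (\<lambda>z. g (y + l *\<^sub>R z)) = 0"
proof -
  note [measurable] = C11_D(1)[OF fp] C11_D(1)[OF gq]
  have f: "f x \<in> {0..1}" and g: "g x \<in> {0..1}" for x using C11_D(3,4)[OF fp, of x] C11_D(3,4)[OF gq, of x] by auto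
  \<comment> \<open>Chosen so that the complementary scale of the translates is the prescribed
    l.\<close>
  define c where "c = sqrt (1 - l\<^sup>2)"
  have l2: "0 < l\<^sup>2" "l\<^sup>2 < 1" using l abs_square_less_1[of l] by auto
  have c: "0 < c" "c < 1" using l2 by (auto simp: c_def)
  have sl: "sqrt (1 - c\<^sup>2) = l" using l l2 by (simp add: c_def)
  define D where "D = (\<lambda>w. deficit \<rho> (\<lambda>z. f (c *\<^sub>R fst w + l *\<^sub>R z)) (\<lambda>z. g (c *\<^sub>R snd w + l *\<^sub>R z)))"
  have ae: "AE w in gauss_pair \<rho>. D w = 0"
    using deficit_zero_ou(2)[OF C11_D(1)[OF fp] C11_D(1)[OF gq] f g c d] unfolding sl D_def .
  \<comment> \<open>Translates move continuously in L1 with the base point, which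
    \<open>deficit_lipschitz\<close> turns into continuity of D.\<close>
  have lip: "(\<integral>z. \<bar>h (c *\<^sub>R x + l *\<^sub>R z) - h (c *\<^sub>R x' + l *\<^sub>R z)\<bar> \<partial>std_gauss) \<le> P * norm (c *\<^sub>R (x - x')) + P * (norm (c *\<^sub>R (x - x')))\<^sup>2"
    if h: "C11 1 P h k" for h k and x x' :: 'a
  proof -
    note [measurable] = C11_D(1)[OF h]
    have "\<bar>h (c *\<^sub>R x + l *\<^sub>R z) - h (c *\<^sub>R x' + l *\<^sub>R z)\<bar> \<in> {0..P * norm (c *\<^sub>R (x - x')) + P * (norm (c *\<^sub>R (x - x')))\<^sup>2}" for z
    proof -
      let ?y = "c *\<^sub>R x' + l *\<^sub>R z" and ?u = "c *\<^sub>R (x - x')"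
      have eq: "c *\<^sub>R x + l *\<^sub>R z = ?y + ?u" by (simp add: algebra_simps)
      have "\<bar>h (?y + ?u) - h ?y - k ?y \<bullet> ?u\<bar> \<le> P * (?u \<bullet> ?u)"
        using C11_D(6)[OF h, of ?y ?u] by (simp only: mult_1 power_one)
      moreover have "\<bar>k ?y \<bullet> ?u\<bar> \<le> norm (k ?y) * norm ?u" by (rule Cauchy_Schwarz_ineq2)
      moreover have "norm (k ?y) * norm ?u \<le> P * norm ?u" using C11_D(5)[OF h] by (intro mult_right_mono) auto
      ultimately have "\<bar>h (c *\<^sub>R x + l *\<^sub>R z) - h (c *\<^sub>R x' + l *\<^sub>R z)\<bar> \<le> P * norm ?u + P * (norm ?u)\<^sup>2"
        unfolding power2_norm_eq_inner eq by linarith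
      then show ?thesis by simp
    qed
    then have "(\<integral>z. \<bar>h (c *\<^sub>R x + l *\<^sub>R z) - h (c *\<^sub>R x' + l *\<^sub>R z)\<bar> \<partial>std_gauss) \<in> {0..P * norm (c *\<^sub>R (x - x')) + P * (norm (c *\<^sub>R (x - x')))\<^sup>2}"
      by (intro integral_std_gauss_Icc) measurable
    then show ?thesis by simp
  qed
  have cont: "continuous_on UNIV D"
    unfolding continuous_on_eq_continuous_at[OF open_UNIV] isCont_def
  proof (intro ballI)
    fix w0 :: "'a \<times> 'a"
    define B where "B = (\<lambda>w. 2 * ((P * norm (c *\<^sub>R (fst w - fst w0)) + P * (norm (c *\<^sub>R (fst w - fst w0)))\<^sup>2) +
      (P * norm (c *\<^sub>R (snd w - snd w0)) + P * (norm (c *\<^sub>R (snd w - snd w0)))\<^sup>2)))"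
    have bound: "norm (D w - D w0) \<le> B w" for w
    proof -
      have "\<bar>D w - D w0\<bar> \<le> 2 * ((\<integral>z. \<bar>f (c *\<^sub>R fst w + l *\<^sub>R z) - f (c *\<^sub>R fst w0 + l *\<^sub>R z)\<bar> \<partial>std_gauss) +
         (\<integral>z. \<bar>g (c *\<^sub>R snd w + l *\<^sub>R z) - g (c *\<^sub>R snd w0 + l *\<^sub>R z)\<bar> \<partial>std_gauss))"
        unfolding D_def by (rule deficit_lipschitz[OF r]) (use f g in simp_all)
      also have "\<dots> \<le> B w" unfolding B_def by (intro mult_left_mono add_mono lip[OF fp] lip[OF gq]) auto
      finally show ?thesis by simp
    qed
    have "(B \<longlongrightarrow> 2 * ((P * norm (c *\<^sub>R (fst w0 - fst w0)) + P * (norm (c *\<^sub>R (fst w0 - fst w0)))\<^sup>2) +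
      (P * norm (c *\<^sub>R (snd w0 - snd w0)) + P * (norm (c *\<^sub>R (snd w0 - snd w0)))\<^sup>2))) (at w0)"
      unfolding B_def by (intro tendsto_intros)
    then have lim: "(B \<longlongrightarrow> 0) (at w0)" by simp
    have "((\<lambda>w. D w - D w0) \<longlongrightarrow> 0) (at w0)"
      by (rule Lim_null_comparison[OF always_eventually[OF allI[OF bound]] lim])
    then show "(D \<longlongrightarrow> D w0) (at w0)" by (simp add: LIM_zero_iff)
  qed
  have "open {w. D w \<noteq> 0}" using cont by (intro open_Collect_neq) auto
  then have "{w. D w \<noteq> 0} = {}" using ae by (intro AE_gauss_pair_open) auto
  \<comment> \<open>Dividing the base points by c cancels the factor c in the translates.\<close>
  then have "D (x /\<^sub>R c, y /\<^sub>R c) = 0" by auto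
  then show ?thesis using c by (simp add: D_def)
qed

text \<open>At scale l the deficit is exactly zero, so the expansion bounds (l^2 / 2) |Jquad| at the
  local means by its error term. After division by l^2 / 2, letting l tend to 0 carries the local
  means to f x and g y.\<close>

lemma Jquad_zero_of_deficit_zero:
  fixes f g :: "'a::euclidean_space \<Rightarrow> real"
  assumes nz: "\<rho> \<noteq> 0" and fp: "C11 1 P f p" and gq: "C11 1 P g q" and d: "deficit \<rho> f g = 0"
    and fx: "0 < f x" "f x < 1" and gy: "0 < g y" "g y < 1"
  shows "Jquad \<rho> (f x) (g y) (p x) (q y) = 0"
proof -
  note [measurable] = C11_D(1)[OF fp] C11_D(1)[OF gq]
  have f: "f x \<in> {0..1}" and g: "g x \<in> {0..1}" for x using C11_D(3,4)[OF fp, of x] C11_D(3,4)[OF gq, of x] by auto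
  have P: "P \<ge> 0" using C11_D(5)[OF fp] norm_ge_zero order_trans by blast
  \<comment> \<open>Half the distance of the two values from 0 and 1, so that the local means
    eventually lie in [e, 1-e].\<close>
  define e where "e = min (min (f x) (1 - f x)) (min (g y) (1 - g y)) / 2"
  have e: "e > 0" "e < f x" "f x < 1 - e" "e < g y" "g y < 1 - e" 
  proof -
    have "2 * e \<le> f x" "2 * e \<le> 1 - f x" "2 * e \<le> g y" "2 * e \<le> 1 - g y" by (simp_all add: e_def)
    moreover show "e > 0" using fx gy by (simp add: e_def)
    ultimately show "e < f x" "f x < 1 - e" "e < g y" "g y < 1 - e" by linarith+
  qed
  define l :: "nat \<Rightarrow> real" where "l = (\<lambda>n. 1 / real (n + 2))"
  have l: "0 < l n" "l n < 1" for n by (auto simp: l_def)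
  have l0: "l \<longlonglongrightarrow> 0" unfolding l_def using LIMSEQ_ignore_initial_segment[OF lim_1_over_n, of 2] by simp
  define X where "X = (\<lambda>n. \<integral>z. f (x + l n *\<^sub>R z) \<partial>std_gauss)"
  define Y where "Y = (\<lambda>n. \<integral>z. g (y + l n *\<^sub>R z) \<partial>std_gauss)"
  have avg: "(\<lambda>n. \<integral>z. h (w + l n *\<^sub>R z) \<partial>std_gauss) \<longlonglongrightarrow> h w" if h: "C11 1 P h k" for h k and w :: 'a
  proof -
    note [measurable] = C11_D(1)[OF h]
    have "(\<lambda>n. \<integral>z. h (w + l n *\<^sub>R z) \<partial>std_gauss) \<longlonglongrightarrow> (\<integral>z. h w \<partial>(std_gauss :: 'a measure))"
    proof (rule integral_dominated_convergence[where w="\<lambda>_. 1"])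
      have "(\<lambda>n. h (w + l n *\<^sub>R z)) \<longlonglongrightarrow> h w" for z
      proof -
        have "(\<lambda>n. w + l n *\<^sub>R z) \<longlonglongrightarrow> w + 0 *\<^sub>R z" by (intro tendsto_intros l0)
        then show ?thesis
          using isCont_tendsto_compose[OF has_derivative_continuous[OF C11_has_derivative[OF h, of w]], of "\<lambda>n. w + l n *\<^sub>R z"]
          by simp
      qed
      then show "AE z in std_gauss. (\<lambda>n. h (w + l n *\<^sub>R z)) \<longlonglongrightarrow> h w" by simp
      show "AE z in std_gauss. norm (h (w + l n *\<^sub>R z)) \<le> 1" for n
        using C11_D(3,4)[OF h] by (intro AE_I2) simp
    qed auto
    then show ?thesis by simp
  qed
  have X: "X \<longlonglongrightarrow> f x" and Y: "Y \<longlonglongrightarrow> g y" unfolding X_def Y_def by (rule avg[OF fp], rule avg[OF gq])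
  have ev: "eventually (\<lambda>n. X n \<in> {e..1-e} \<and> Y n \<in> {e..1-e}) sequentially"
    using order_tendstoD(1)[OF X e(2)] order_tendstoD(2)[OF X e(3)] order_tendstoD(1)[OF Y e(4)] order_tendstoD(2)[OF Y e(5)]
    by eventually_elim auto
  have lim: "(\<lambda>n. Jquad \<rho> (X n) (Y n) (p x) (q y)) \<longlonglongrightarrow> Jquad \<rho> (f x) (g y) (p x) (q y)"
  proof -
    have c: "(\<lambda>n. K (A n) (B n)) \<longlonglongrightarrow> K a b"
      if "continuous_on ({e..1-e} \<times> {e..1-e}) (\<lambda>z. K (fst z) (snd z))" "A \<longlonglongrightarrow> a" "B \<longlonglongrightarrow> b"
        "eventually (\<lambda>n. A n \<in> {e..1-e} \<and> B n \<in> {e..1-e}) sequentially" "a \<in> {e..1-e}" "b \<in> {e..1-e}"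
      for K :: "real \<Rightarrow> real \<Rightarrow> real" and A B a b
      using continuous_on_tendsto_compose[OF that(1), of "\<lambda>n. (A n, B n)" "(a, b)" sequentially] that(2-)
      by (auto intro: tendsto_Pair)
    have e1: "1 - e < 1" and I: "f x \<in> {e..1-e}" "g y \<in> {e..1-e}" using e by auto
    have ev': "eventually (\<lambda>n. Y n \<in> {e..1-e} \<and> X n \<in> {e..1-e}) sequentially"
      using ev by (simp only: conj_commute)
    note cJ = continuous_Jxx[OF r e(1) e1]
    show ?thesis
      unfolding Jquad_def[OF r]
      by (intro tendsto_add tendsto_mult tendsto_const c[OF cJ(1) X Y ev I] c[OF cJ(2) X Y ev I]
          c[OF cJ(1) Y X ev' I(2,1)])
  qed
  \<comment> \<open>C depends on \<eta>; therefore l tends to 0 for fixed \<eta>, and only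
    afterwards is \<eta> made small.\<close>
  have "\<bar>Jquad \<rho> (f x) (g y) (p x) (q y)\<bar> \<le> 0 + \<eta>" if eta: "\<eta> > 0" for \<eta>
  proof -
    have half: "\<eta> / 2 > 0" using eta by simp
    obtain C where C: "C \<ge> 0" and step:
      "\<And>l F G F0 G0 (p::'a) q. 0 \<le> l \<Longrightarrow> l \<le> 1 \<Longrightarrow> F \<in> borel_measurable borel \<Longrightarrow> G \<in> borel_measurable borel \<Longrightarrow>
        (\<And>x. F x \<in> {0..1}) \<Longrightarrow> (\<And>x. G x \<in> {0..1}) \<Longrightarrow> norm p \<le> P \<Longrightarrow> norm q \<le> P \<Longrightarrow>
        (\<And>x. \<bar>F x - F0 - l * (p \<bullet> x)\<bar> \<le> l\<^sup>2 * P * (x \<bullet> x)) \<Longrightarrow>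
        (\<And>x. \<bar>G x - G0 - l * (q \<bullet> x)\<bar> \<le> l\<^sup>2 * P * (x \<bullet> x)) \<Longrightarrow>
        (\<integral>x. F x \<partial>std_gauss) \<in> {e..1-e} \<Longrightarrow> (\<integral>x. G x \<partial>std_gauss) \<in> {e..1-e} \<Longrightarrow>
        \<bar>(\<integral>z. J (F (fst z)) (G (snd z)) \<rho> \<partial>gauss_pair \<rho>) - J (\<integral>x. F x \<partial>std_gauss) (\<integral>x. G x \<partial>std_gauss) \<rho>
           - l\<^sup>2 / 2 * Jquad \<rho> (\<integral>x. F x \<partial>std_gauss) (\<integral>x. G x \<partial>std_gauss) p q\<bar> \<le> l\<^sup>2 * (\<eta> / 2) + l ^ 3 * C"
      using J_step[OF r e(1) half P, where 'a='a] by blast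
    have "\<bar>Jquad \<rho> (X n) (Y n) (p x) (q y)\<bar> \<le> \<eta> + 2 * (l n * C)" if XY: "X n \<in> {e..1-e} \<and> Y n \<in> {e..1-e}" for n
    proof -
      let ?F = "\<lambda>z. f (x + l n *\<^sub>R z)" and ?G = "\<lambda>z. g (y + l n *\<^sub>R z)"
      have eq: "(\<integral>z. J (?F (fst z)) (?G (snd z)) \<rho> \<partial>gauss_pair \<rho>) = J (X n) (Y n) \<rho>"
        using deficit_zero_local[OF fp gq d l(1)[of n] l(2)[of n], of x y] nz by (simp add: deficit_def X_def Y_def sgn_if split: if_splits)
      have XY_eq: "(\<integral>z. ?F z \<partial>std_gauss) = X n" "(\<integral>z. ?G z \<partial>std_gauss) = Y n" by (simp_all add: X_def Y_def)
      have lin: "\<bar>h (w + l n *\<^sub>R z) - h w - l n * (k w \<bullet> z)\<bar> \<le> (l n)\<^sup>2 * P * (z \<bullet> z)" if h: "C11 1 P h k" for h k and w z :: 'a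
        using C11_D(6)[OF h, of w "l n *\<^sub>R z"] by (simp add: power2_eq_square algebra_simps)
      have "\<bar>(\<integral>z. J (?F (fst z)) (?G (snd z)) \<rho> \<partial>gauss_pair \<rho>) - J (\<integral>z. ?F z \<partial>std_gauss) (\<integral>z. ?G z \<partial>std_gauss) \<rho>
           - (l n)\<^sup>2 / 2 * Jquad \<rho> (\<integral>z. ?F z \<partial>std_gauss) (\<integral>z. ?G z \<partial>std_gauss) (p x) (q y)\<bar> \<le> (l n)\<^sup>2 * (\<eta> / 2) + (l n) ^ 3 * C"
      proof (rule step[where ?F0.0="f x" and ?G0.0="g y"])
        show "0 \<le> l n" "l n \<le> 1" using l[of n] by auto
        show "norm (p x) \<le> P" "norm (q y) \<le> P" using C11_D(5)[OF fp] C11_D(5)[OF gq] by auto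
        show "(\<integral>z. ?F z \<partial>std_gauss) \<in> {e..1-e}" "(\<integral>z. ?G z \<partial>std_gauss) \<in> {e..1-e}" using XY by (auto simp: X_def Y_def)
      qed (use f g lin[OF fp] lin[OF gq] in \<open>simp_all del: atLeastAtMost_iff\<close>)
      then have "(l n)\<^sup>2 / 2 * \<bar>Jquad \<rho> (X n) (Y n) (p x) (q y)\<bar> \<le> (l n)\<^sup>2 / 2 * (\<eta> + 2 * (l n * C))"
        unfolding eq XY_eq
        by (simp add: abs_mult power2_eq_square power3_eq_cube algebra_simps)
      then show ?thesis by (rule mult_left_le_imp_le) (use l[of n] in simp)
    qed
    then have "eventually (\<lambda>n. \<bar>Jquad \<rho> (X n) (Y n) (p x) (q y)\<bar> \<le> \<eta> + 2 * (l n * C)) sequentially"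
      using ev by (auto elim: eventually_mono)
    moreover have "(\<lambda>n. \<eta> + 2 * (l n * C)) \<longlonglongrightarrow> \<eta> + 2 * (0 * C)" by (intro tendsto_intros l0)
    moreover have "(\<lambda>n. \<bar>Jquad \<rho> (X n) (Y n) (p x) (q y)\<bar>) \<longlonglongrightarrow> \<bar>Jquad \<rho> (f x) (g y) (p x) (q y)\<bar>"
      by (intro tendsto_intros lim)
    ultimately show ?thesis using tendsto_le[OF sequentially_bot] by fastforce
  qed
  then have "\<bar>Jquad \<rho> (f x) (g y) (p x) (q y)\<bar> \<le> 0" by (rule field_le_epsilon)
  then show ?thesis by simp
qed

lemma deficit_zero_smooth:
  fixes f g :: "'a::euclidean_space \<Rightarrow> real"
  assumes nz: "\<rho> \<noteq> 0" and fp: "C11 1 P f p" and gq: "C11 1 P g q" and d: "deficit \<rho> f g = 0"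
    and f: "\<And>x. 0 < f x" "\<And>x. f x < 1" and g: "\<And>x. 0 < g x" "\<And>x. g x < 1"
  shows "\<exists>a b d. \<forall>x. f x = Phi (a \<bullet> x + b) \<and> g x = Phi (a \<bullet> x + d)"
proof -
  let ?P = "\<lambda>x. p x /\<^sub>R std_normal_density (quantile (f x))"
  let ?Q = "\<lambda>y. q y /\<^sub>R std_normal_density (quantile (g y))"
  \<comment> \<open>The points x and y are unrelated, so equality of a function of x with a function
    of y makes both constant, with one common value.\<close>
  have PQ: "?P x = ?Q y" for x y
  proof -
    have "Jquad \<rho> (f x) (g y) (p x) (q y) = 0"
      by (rule Jquad_zero_of_deficit_zero[OF nz fp gq d f g])
    then show ?thesis
      unfolding Jquad_eq[OF r] using tau[OF r] nz by simp
  qed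
  define a where "a = ?P 0"
  have aP: "?P x = a" "?Q x = a" for x
    using PQ[of x 0] PQ[of 0 0] PQ[of 0 x] by (simp_all add: a_def)
  have main: "h x = Phi (a \<bullet> x + quantile (h 0))"
    if h: "C11 1 P h k" and h01: "\<And>x. 0 < h x" "\<And>x. h x < 1"
      and a: "\<And>x. k x /\<^sub>R std_normal_density (quantile (h x)) = a" for h k x
  proof -
    have "((\<lambda>x. quantile (h x) - a \<bullet> x) has_derivative (\<lambda>u. 0)) (at x within UNIV)" for x
    proof -
      have "((\<lambda>x. quantile (h x) - a \<bullet> x) has_derivative
          (\<lambda>u. (k x \<bullet> u) * (1 / std_normal_density (quantile (h x))) - a \<bullet> u)) (at x)"
        by (intro has_derivative_diff DERIV_compose_FDERIV[where f=quantile and g=h, OF DERIV_quantile[OF h01]] C11_has_derivative[OF h]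
             bounded_linear_imp_has_derivative bounded_linear_inner_right)
      moreover have "(k x \<bullet> u) * (1 / std_normal_density (quantile (h x))) - a \<bullet> u = 0" for u
        unfolding a[of x, symmetric] by (simp add: divide_inverse mult.commute)
      ultimately show ?thesis by simp
    qed
    then obtain C where C: "\<And>x. quantile (h x) - a \<bullet> x = C"
      using has_derivative_zero_constant[OF convex_UNIV, of "\<lambda>x. quantile (h x) - a \<bullet> x"] by auto
    have "quantile (h x) = a \<bullet> x + quantile (h 0)" using C[of x] C[of 0] by simp
    then show ?thesis using Phi_quantile[OF h01, of x] by simp
  qed
  show ?thesis
    using main[OF fp f aP(1)] main[OF gq g aP(2)] by blast
qed

end

section \<open>Limits of probit functions as the smoothing is removed\<close>

lemma Phi_limit_degenerate:
  assumes "k \<longlonglongrightarrow> k0" "t \<longlonglongrightarrow> (0::real)" "\<And>n. t n > 0" "k0 \<noteq> 0"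
  shows "(\<lambda>n. Phi (k n / t n)) \<longlonglongrightarrow> (if k0 > 0 then 1 else 0)"
proof -
  have inv: "filterlim (\<lambda>n. inverse (t n)) at_top sequentially"
    using assms(2,3) by (intro filterlim_inverse_at_top) (auto intro: always_eventually)
  show ?thesis
  proof (cases "k0 > 0")
    case True
    have "filterlim (\<lambda>n. k n * inverse (t n)) at_top sequentially"
      by (rule filterlim_tendsto_pos_mult_at_top[OF assms(1) True inv])
    from filterlim_compose[OF Phi_at_top this] True show ?thesis by (simp add: divide_inverse)
  next
    case False
    then have "k0 < 0" using assms(4) by simp
    then have "filterlim (\<lambda>n. k n * inverse (t n)) at_bot sequentially"
      by (rule filterlim_tendsto_neg_mult_at_bot[OF assms(1) _ inv])
    from filterlim_compose[OF Phi_at_bot this] False show ?thesis by (simp add: divide_inverse)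
  qed
qed

lemma AE_std_gauss_hyperplane:
  fixes a :: "'a::euclidean_space"
  assumes "a \<noteq> 0"
  shows "AE x in std_gauss. a \<bullet> x + b \<noteq> 0"
proof -
  have "closed {x. a \<bullet> x = - b}" by (rule closed_hyperplane)
  moreover have "negligible {x. a \<bullet> x = - b}" using assms by (intro negligible_hyperplane) auto
  ultimately have "{x. a \<bullet> x = - b} \<in> null_sets lborel"
    by (simp add: negligible_iff_null_sets null_sets_completion_iff)
  then have "AE x in lborel. x \<notin> {x. a \<bullet> x = - b}" by (rule AE_not_in)
  then show ?thesis unfolding AE_std_gauss_iff by (auto elim!: eventually_mono)
qed

text \<open>The witness is the point of the hyperplane a.x + b = 0 nearest to the origin.\<close>

lemma affine_eq_inner:
  fixes a :: "'a::euclidean_space"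
  assumes "a \<noteq> 0"
  obtains v where "\<And>x. a \<bullet> x + b = a \<bullet> (x - v)"
  by (rule that[of "- (b / (a \<bullet> a)) *\<^sub>R a"]) (use assms in \<open>simp add: inner_add_right\<close>)

context
  fixes \<rho> :: real
  assumes r: "-1 < \<rho>" "\<rho> < 1"
begin

lemma ou_probit:
  fixes f g :: "'a::euclidean_space \<Rightarrow> real"
  assumes nz: "\<rho> \<noteq> 0" and m: "f \<in> borel_measurable borel" "g \<in> borel_measurable borel"
    and f: "\<And>x. f x \<in> {0..1}" and g: "\<And>x. g x \<in> {0..1}"
    and f0: "\<not> (AE x in std_gauss. f x = 0)" and f1: "\<not> (AE x in std_gauss. f x = 1)"
    and g0: "\<not> (AE x in std_gauss. g x = 0)" and g1: "\<not> (AE x in std_gauss. g x = 1)"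
    and d: "deficit \<rho> f g = 0" and c: "0 < c" "c < 1"
  shows "\<exists>a b d. \<forall>x. ou c f x = Phi (a \<bullet> x + b) \<and> ou c g x = Phi (a \<bullet> x + d)"
proof -
  obtain P p where p: "C11 1 P (ou c f) p" using ou_C11[OF m(1) f c] by blast
  obtain Q q where q: "C11 1 Q (ou c g) q" using ou_C11[OF m(2) g c] by blast
  show ?thesis
    by (rule deficit_zero_smooth[OF r nz C11_mono[OF p max.cobounded1[of P Q]] C11_mono[OF q max.cobounded2[of Q P]]
          deficit_zero_ou(1)[OF r m f g c d] ou_strict_bounds[OF m(1) f c f0 f1] ou_strict_bounds[OF m(2) g c g0 g1]])
qed

text \<open>
  The coefficients of \<open>Phi (a \<bullet> x + b)\<close> and \<open>Phi (a \<bullet> x + d)\<close> may blow up in the limit \<open>c \<rightarrow> 1\<close>.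
  The unit vectors \<open>(a, b, d, 1) / norm (a, b, d, 1)\<close> converge along a subsequence;
  the limit of the last entry is positive in the probit case and zero in the half-space case.
\<close>

lemma deficit_zero_cases:
  fixes f g :: "'a::euclidean_space \<Rightarrow> real"
  assumes nz: "\<rho> \<noteq> 0" and m: "f \<in> borel_measurable borel" "g \<in> borel_measurable borel"
    and f: "\<And>x. f x \<in> {0..1}" and g: "\<And>x. g x \<in> {0..1}"
    and f0: "\<not> (AE x in std_gauss. f x = 0)" and f1: "\<not> (AE x in std_gauss. f x = 1)"
    and g0: "\<not> (AE x in std_gauss. g x = 0)" and g1: "\<not> (AE x in std_gauss. g x = 1)"
    and d: "deficit \<rho> f g = 0"
  obtains (probit) a b d where "AE x in std_gauss. f x = Phi (a \<bullet> x + b)" "AE x in std_gauss. g x = Phi (a \<bullet> x + d)"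
  | (halfspace) a b d where "a \<noteq> 0" "AE x in std_gauss. f x = (if a \<bullet> x + b > 0 then 1 else 0)"
      "AE x in std_gauss. g x = (if a \<bullet> x + d > 0 then 1 else 0)"
proof -
  define c where "c = (\<lambda>n. 1 - 1 / real (n + 2))"
  have c: "0 < c n" "c n < 1" for n by (auto simp: c_def)
  have "c \<longlonglongrightarrow> 1 - 0" unfolding c_def
    using LIMSEQ_ignore_initial_segment[OF lim_1_over_n, of 2] by (intro tendsto_diff tendsto_const) simp
  then have c1: "c \<longlonglongrightarrow> 1" by simp
  have "\<forall>n. \<exists>a b d. \<forall>x. ou (c n) f x = Phi (a \<bullet> x + b) \<and> ou (c n) g x = Phi (a \<bullet> x + d)"
    using ou_probit[OF nz m f g f0 f1 g0 g1 d c] by blast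
  then obtain A B D where AB: "\<And>n x. ou (c n) f x = Phi (A n \<bullet> x + B n)" "\<And>n x. ou (c n) g x = Phi (A n \<bullet> x + D n)"
    by metis
  have i: "integrable std_gauss h" if "h \<in> borel_measurable borel" "\<And>x. h x \<in> {0..1}" for h :: "'a \<Rightarrow> real"
    using integrable_std_gauss_unit that by blast
  have io: "integrable std_gauss (\<lambda>x. ou k h x - h x)" if "h \<in> borel_measurable borel" "\<And>x. h x \<in> {0..1}" for h :: "'a \<Rightarrow> real" and k
    by (intro Bochner_Integration.integrable_diff i that ou_measurable ou_Icc)
  \<comment> \<open>L1 convergence gives a.e. convergence only along a subsequence. The one for g is
    extracted from the one for f, since both must use the same indices to share the direction
    a.\<close>
  obtain r1 where r1: "strict_mono r1" "AE x in std_gauss. (\<lambda>n. ou (c (r1 n)) f x - f x) \<longlonglongrightarrow> 0"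
    using tendsto_L1_AE_subseq[of std_gauss "\<lambda>n x. ou (c n) f x - f x", OF io[OF m(1) f]] ou_tendsto_L1[OF m(1) f c c1]
    by auto
  have c2: "(\<lambda>n. c (r1 n)) \<longlonglongrightarrow> 1" using LIMSEQ_subseq_LIMSEQ[OF c1 r1(1)] by (simp add: comp_def)
  obtain r2 where r2: "strict_mono r2" "AE x in std_gauss. (\<lambda>n. ou (c (r1 (r2 n))) g x - g x) \<longlonglongrightarrow> 0"
    using tendsto_L1_AE_subseq[of std_gauss "\<lambda>n x. ou (c (r1 n)) g x - g x", OF io[OF m(2) g]]
      ou_tendsto_L1[OF m(2) g c(1) c(2) c2]
    by auto
  \<comment> \<open>Both intercepts are normalised together with the common slope, so a single limit
    direction serves f and g. The entry 1 keeps the norm positive and records its reciprocal after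
    normalisation.\<close>
  define V where "V = (\<lambda>n. (A (r1 (r2 n)), B (r1 (r2 n)), D (r1 (r2 n)), 1 :: real))"
  have Vn: "norm (V n) > 0" for n by (simp add: V_def prod_eq_iff)
  define U where "U = (\<lambda>n. V n /\<^sub>R norm (V n))"
  have "U n \<in> sphere 0 1" for n using Vn[of n] by (simp add: U_def)
  then obtain u r3 where u: "u \<in> sphere 0 1" "strict_mono r3" "(U \<circ> r3) \<longlonglongrightarrow> u"
    using compact_sphere[of 0 1] unfolding compact_def by metis
  obtain a b e t where abet: "u = (a, b, e, t)" by (metis prod.exhaust)
  define R where "R = (\<lambda>n. r1 (r2 (r3 n)))"
  define A' where "A' = (\<lambda>n. fst (U (r3 n)))"
  define B' where "B' = (\<lambda>n. fst (snd (U (r3 n))))"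
  define D' where "D' = (\<lambda>n. fst (snd (snd (U (r3 n)))))"
  define T where "T = (\<lambda>n. snd (snd (snd (U (r3 n)))))"
  have U: "(\<lambda>n. U (r3 n)) \<longlonglongrightarrow> (a, b, e, t)" using u(3) by (simp add: comp_def abet)
  have lim: "A' \<longlonglongrightarrow> a" "B' \<longlonglongrightarrow> b" "D' \<longlonglongrightarrow> e" "T \<longlonglongrightarrow> t"
    unfolding A'_def B'_def D'_def T_def
    using tendsto_fst[OF U] tendsto_fst[OF tendsto_snd[OF U]] tendsto_fst[OF tendsto_snd[OF tendsto_snd[OF U]]]
      tendsto_snd[OF tendsto_snd[OF tendsto_snd[OF U]]] by simp_all
  have T: "T n > 0" for n using Vn[of "r3 n"] by (simp add: T_def U_def V_def)
  have form: "A (R n) \<bullet> x + B (R n) = (A' n \<bullet> x + B' n) / T n" "A (R n) \<bullet> x + D (R n) = (A' n \<bullet> x + D' n) / T n" for n x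
  proof -
    define N where "N = norm (V (r3 n))"
    have N: "N > 0" using Vn by (simp add: N_def)
    have "A' n = A (R n) /\<^sub>R N" "B' n = B (R n) / N" "D' n = D (R n) / N" "T n = 1 / N"
      by (simp_all add: A'_def B'_def D'_def T_def U_def R_def N_def[symmetric] divide_inverse mult.commute)
         (simp_all add: V_def)
    then show "A (R n) \<bullet> x + B (R n) = (A' n \<bullet> x + B' n) / T n" "A (R n) \<bullet> x + D (R n) = (A' n \<bullet> x + D' n) / T n"
      using N by (simp_all add: field_simps)
  qed
  have sub: "(\<lambda>n. k (r3 n)) \<longlonglongrightarrow> l" if "k \<longlonglongrightarrow> l" for k :: "nat \<Rightarrow> real" and l
    using LIMSEQ_subseq_LIMSEQ[OF that u(2)] by (simp add: comp_def)
  have aef: "AE x in std_gauss. (\<lambda>n. Phi ((A' n \<bullet> x + B' n) / T n)) \<longlonglongrightarrow> f x"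
    using r1(2)
  proof eventually_elim
    case (elim x)
    then have "(\<lambda>n. ou (c (r1 (r2 n))) f x - f x) \<longlonglongrightarrow> 0" using LIMSEQ_subseq_LIMSEQ[OF _ r2(1)] by (simp add: comp_def)
    from sub[OF this] show ?case
      unfolding form[symmetric] AB[symmetric] R_def by (simp add: LIM_zero_iff)
  qed
  have aeg: "AE x in std_gauss. (\<lambda>n. Phi ((A' n \<bullet> x + D' n) / T n)) \<longlonglongrightarrow> g x"
    using r2(2)
  proof eventually_elim
    case (elim x)
    from sub[OF this] show ?case
      unfolding form[symmetric] AB[symmetric] R_def by (simp add: LIM_zero_iff)
  qed
  have "t \<ge> 0" using lim(4) T by (intro LIMSEQ_le_const) (auto intro: less_imp_le)
  show ?thesis
  proof (cases "t = 0")
    case False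
    then have t: "t > 0" using \<open>t \<ge> 0\<close> by simp
    have main: "AE x in std_gauss. h x = Phi ((a /\<^sub>R t) \<bullet> x + k0 / t)"
      if "AE x in std_gauss. (\<lambda>n. Phi ((A' n \<bullet> x + K n) / T n)) \<longlonglongrightarrow> h x" "K \<longlonglongrightarrow> k0" for h K k0
      using that(1)
    proof eventually_elim
      case (elim x)
      have "(\<lambda>n. Phi ((A' n \<bullet> x + K n) / T n)) \<longlonglongrightarrow> Phi ((a \<bullet> x + k0) / t)"
        using t by (intro isCont_tendsto_compose[OF DERIV_isCont[OF DERIV_Phi]] tendsto_intros lim that(2)) auto
      from LIMSEQ_unique[OF elim this] show ?case using t by (simp add: field_simps)
    qed
    show ?thesis by (rule probit[OF main[OF aef lim(2)] main[OF aeg lim(3)]])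
  next
    case True
    have T0: "T \<longlonglongrightarrow> 0" using lim(4) True by simp
    \<comment> \<open>The numerator tends to a.x + k0 while T tends to 0 from above, so the quotient
      diverges according to the sign; where that limit is zero nothing can be said.\<close>
    have main: "AE x in std_gauss. a \<bullet> x + k0 \<noteq> 0 \<longrightarrow> h x = (if a \<bullet> x + k0 > 0 then 1 else 0)"
      if "AE x in std_gauss. (\<lambda>n. Phi ((A' n \<bullet> x + K n) / T n)) \<longlonglongrightarrow> h x" "K \<longlonglongrightarrow> k0" for h K k0
      using that(1)
    proof eventually_elim
      case (elim x)
      show ?case
      proof
        assume "a \<bullet> x + k0 \<noteq> 0"
        then have "(\<lambda>n. Phi ((A' n \<bullet> x + K n) / T n)) \<longlonglongrightarrow> (if a \<bullet> x + k0 > 0 then 1 else 0)"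
          by (intro Phi_limit_degenerate T0 T tendsto_intros lim that(2))
        from LIMSEQ_unique[OF elim this] show "h x = (if a \<bullet> x + k0 > 0 then 1 else 0)" .
      qed
    qed
    note mf = main[OF aef lim(2)] and mg = main[OF aeg lim(3)]
    \<comment> \<open>If a and t vanish, the unit length leaves b or e nonzero, and then f or g
      would be a.e. equal to 0 or to 1.\<close>
    have "a \<noteq> 0"
    proof
      assume a: "a = 0"
      have const: False if "AE x in std_gauss. a \<bullet> x + k0 \<noteq> 0 \<longrightarrow> h x = (if a \<bullet> x + k0 > 0 then 1 else 0)" "k0 \<noteq> 0"
        "\<not> (AE x in std_gauss. h x = 0)" "\<not> (AE x in std_gauss. h x = 1)" for h :: "'a \<Rightarrow> real" and k0
        using that by (cases "k0 > 0") (auto simp: a)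
      have "b \<noteq> 0 \<or> e \<noteq> 0"
        using u(1) by (auto simp: abet a True norm_Pair)
      then show False using const[OF mf _ f0 f1] const[OF mg _ g0 g1] by blast
    qed
    moreover have "AE x in std_gauss. f x = (if a \<bullet> x + b > 0 then 1 else 0)"
      using mf AE_std_gauss_hyperplane[OF \<open>a \<noteq> 0\<close>, of b] by eventually_elim auto
    moreover have "AE x in std_gauss. g x = (if a \<bullet> x + e > 0 then 1 else 0)"
      using mg AE_std_gauss_hyperplane[OF \<open>a \<noteq> 0\<close>, of e] by eventually_elim auto
    ultimately show ?thesis by (rule halfspace)
  qed
qed

end

text \<open>The exclusions remove trivial equality cases that the conclusion does not describe. If f
  is a.e. 0 or 1, equality holds for every g, and symmetrically; two constants also give equality,
  whereas the formulas with a = 0 produce only the constants 1/2 and 1.\<close>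

theorem theorem1p3:
  fixes f g :: "real ^ 'n \<Rightarrow> real" and \<rho> :: real
  assumes "f \<in> borel_measurable borel" and "g \<in> borel_measurable borel"
    and "\<And>x. f x \<in> {0..1}" and "\<And>x. g x \<in> {0..1}"
    and "-1 < \<rho>" and "\<rho> < 1" and "\<rho> \<noteq> 0"
    and "\<not> (AE x in std_gauss. f x = 0)" and "\<not> (AE x in std_gauss. f x = 1)"
    and "\<not> (AE x in std_gauss. g x = 0)" and "\<not> (AE x in std_gauss. g x = 1)"
    and "\<not> (\<exists>c c'. (AE x in std_gauss. f x = c) \<and> (AE x in std_gauss. g x = c'))"
    and "(\<integral>(x, y). J (f x) (g y) \<rho> \<partial>gauss_pair \<rho>) =
         J (\<integral>x. f x \<partial>std_gauss) (\<integral>x. g x \<partial>std_gauss) \<rho>"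
  shows "\<exists>a b d :: real ^ 'n.
      ((AE x in std_gauss. f x = Phi (a \<bullet> (x - b))) \<and>
       (AE x in std_gauss. g x = Phi (a \<bullet> (x - d)))) \<or>
      ((AE x in std_gauss. f x = indicator {y. a \<bullet> (y - b) \<ge> 0} x) \<and>
       (AE x in std_gauss. g x = indicator {y. a \<bullet> (y - d) \<ge> 0} x))"
proof -
  have "deficit \<rho> f g = 0" using assms(13) by (simp add: deficit_def split_beta')
  then show ?thesis
  proof (cases rule: deficit_zero_cases[OF assms(5-7,1,2,3,4,8-11), consumes 1, case_names probit halfspace])
    case (probit a b d)
    \<comment> \<open>For a = 0 both functions would be constant. A nonzero a is needed to write the
      intercepts as shifts of the argument.\<close>
    have "a \<noteq> 0" using probit assms(12) by auto
    then obtain v w where "\<And>x. a \<bullet> x + b = a \<bullet> (x - v)" "\<And>x. a \<bullet> x + d = a \<bullet> (x - w)"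
      using affine_eq_inner by metis
    with probit show ?thesis by auto
  next
    case (halfspace a b d)
    obtain v w where v: "\<And>x. a \<bullet> x + b = a \<bullet> (x - v)" and w: "\<And>x. a \<bullet> x + d = a \<bullet> (x - w)"
      using affine_eq_inner[OF halfspace(1)] by metis
    \<comment> \<open>The strict and the non-strict half-space differ by a null hyperplane.\<close>
    have "AE x in std_gauss. f x = indicator {y. a \<bullet> (y - v) \<ge> 0} x"
      using halfspace(2) AE_std_gauss_hyperplane[OF halfspace(1), of b]
      by eventually_elim (auto simp: v indicator_def)
    moreover have "AE x in std_gauss. g x = indicator {y. a \<bullet> (y - w) \<ge> 0} x"
      using halfspace(3) AE_std_gauss_hyperplane[OF halfspace(1), of d]
      by eventually_elim (auto simp: w indicator_def)
    ultimately show ?thesis by blast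
  qed
qed

end
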